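(* The set $\{X_w\}_{w\in\mathcal{W}_f}$ is a $\mathbb{Z}[v,v^{-1}]$-basis of the Temperley-Lieb algebra $\mathrm{TL}_n$.
   Context: Let $n\ge 1$, $\mathcal{W}=\mathfrak{S}_{n+1}$, $s_i=(i,i+1)$, $\mathcal{S}=\{s_1,\dots,s_n\}$, $\mathcal{T}$ the set of all transpositions; $\ell_{\mathcal{S}}$ and $\ell_{\mathcal{T}}$ are the word lengths with respect to $\mathcal{S}$ and $\mathcal{T}$. Permutations are composed from right to left, so $c:=s_1s_2\cdots s_n=(1,2,\dots,n+1)$. For $A\subset\mathbb{Z}$ and $m\in\mathbb{Z}$, $A[m]:=\{a+m\mid a\in A\}$. Fully commutative elements: $w\in\mathcal{W}$ is fully commutative if any two reduced $\mathcal{S}$-decompositions of $w$ are related by a sequence of relations $st=ts$ with $s,t\in\mathcal{S}$. $\mathcal{W}_f$ is the set of fully commutative elements. Every $w\in\mathcal{W}_f$ has a unique reduced $\mathcal{S}$-decomposition of the form $(s_{i_1}s_{i_1-1}\cdots s_{j_1})\cdots(s_{i_\ell}s_{i_\ell-1}\cdots s_{j_\ell})$ with all indices in $\{1,\dots,n\}$, $i_1<\dots<i_\ell$, $j_1<\dots<j_\ell$, $j_m\le i_m$ for all $m$. Set $I_w:=\{i_1,\dots,i_\ell\}$, $J_w:=\{j_1,\dots,j_\ell\}$. Noncrossing partitions: $u<_{\mathcal{T}}v$ means $\ell_{\mathcal{T}}(u)+\ell_{\mathcal{T}}(u^{-1}v)=\ell_{\mathcal{T}}(v)$ (equality allowed),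 and $\mathcal{P}_c:=\{x\in\mathcal{W}\mid x<_{\mathcal{T}}c\}$. Each $x\in\mathcal{P}_c$ is a product of disjoint cycles $(i_1,\dots,i_k)$ with $i_1<\dots<i_k$ whose supports are the non-singleton blocks of a noncrossing partition of $\{1,\dots,n+1\}$; a cycle with $k\ge2$ is represented by a polygon $[i_1\cdots i_k]$ with initial vertex $i_1$ and terminal vertex $i_k$. Let $\mathrm{Vert}(x)$ be the set of vertices of all polygons of $x$, $U_x:=\mathrm{Vert}(x)\setminus\{\text{initial vertices}\}$, $D_x:=\mathrm{Vert}(x)\setminus\{\text{terminal vertices}\}$. There is a bijection $\psi:\mathcal{W}_f\to\mathcal{P}_c$ characterized by $(D_{\psi(w)},U_{\psi(w)})=(J_w,I_w[1])$. Temperley-Lieb algebra: $\mathrm{TL}_n$ is the associative unital $\mathbb{Z}[v,v^{-1}]$-algebra with generators $b_1,\dots,b_n$ and relations $b_jb_ib_j=b_j$ if $|i-j|=1$, $b_ib_j=b_jb_i$ if $|i-j|>1$, $b_i^2=(v+v^{-1})b_i$. Let $\mathcal{B}_{n+1}$ be the braid group on $n+1$ strands with standard generators $\mathbf{s}_1,\dots,\mathbf{s}_n$, and $\omega:\mathbb{Z}[v,v^{-1}]\mathcal{B}_{n+1}\to\mathrm{TL}_n$ the algebra homomorphism $\mathbf{s}_i\mapsto v^{-1}-b_i$ (so $\mathbf{s}_i^{-1}\mapsto v-b_i$). For $t=(i,k+1)\in\mathcal{T}$, $i\le k$, let $i_c(t):=\mathbf{s}_k^{-1}\cdots\mathbf{s}_{i+1}^{-1}\mathbf{s}_i\mathbf{s}_{i+1}\cdots\mathbf{s}_k\in\mathcal{B}_{n+1}$,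 and for $x\in\mathcal{P}_c$ with reduced $\mathcal{T}$-decomposition $t_1\cdots t_k$ let $i_c(x):=i_c(t_1)\cdots i_c(t_k)$ (independent of the decomposition). Set $Z_x:=\omega(i_c(x))$; $\{Z_x\}_{x\in\mathcal{P}_c}$ is a $\mathbb{Z}[v,v^{-1}]$-basis of $\mathrm{TL}_n$ (Zinno). Elements $X_w$: for $w\in\mathcal{W}_f$ let $L(w)=\{s\in\mathcal{S}\mid \ell_{\mathcal{S}}(sw)<\ell_{\mathcal{S}}(w)\}$, $R(w)=\{s\in\mathcal{S}\mid\ell_{\mathcal{S}}(ws)<\ell_{\mathcal{S}}(w)\}$; the elements of $L(w)$ commute pairwise, and so do those of $R(w)$. For $L\subset L(w)$, $R\subset R(w)$, an ending pair $(L',R')$ for $(L,R)$ is a pair obtained from $(L,R)$ by the following process: if some $s$ lies in both sets, remove it from exactly one of them; if $s_j$ lies in the left set and $s_{j-1}$ in the right set, remove $s_j$ from the left set or $s_{j-1}$ from the right set; repeat until $L'\cap R'=\emptyset$ and there is no $j$ with $s_j\in L'$, $s_{j-1}\in R'$. Set $x_{L,R}:=\left(\prod_{s\in L'}s\right)\psi(w)\left(\prod_{s\in R'}s\right)$; it lies in $\mathcal{P}_c$ and does not depend on the chosen ending pair. Let $Q_w:=\{x_{L,R}\mid L\subset L(w),R\subset R(w)\}\subset\mathcal{P}_c$, and $$X_w:=\sum_{x\in Q_w}p_x^wZ_x,\qquad p_x^w:=(-1)^{\alpha_w(x)}v^{\beta_w(x)},$$ with $\alpha_w(x):=\ell_{\mathcal{S}}(w)+\ell_{\mathcal{S}}(\psi(w))-\ell_{\mathcal{S}}(x)$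 and $\beta_w(x):=\ell_{\mathcal{T}}(x)-\ell_{\mathcal{T}}(\psi(w))$. *)

theory Defs
  imports
    "HOL-Library.Poly_Mapping"
    "HOL-Combinatorics.Permutations"
    "HOL-Combinatorics.Orbits"
    "HOL-Algebra.Module"
    "HOL-Algebra.QuotRing"
    "HOL-Algebra.Sym_Groups"
    "HOL-Algebra.Algebraic_Closure_Type"
begin

section \<open>Bases of modules\<close>

definition module_basis ::
  "('r, 'x) ring_scheme \<Rightarrow> ('r, 'a, 'y) module_scheme \<Rightarrow> 'i set \<Rightarrow> ('i \<Rightarrow> 'a) \<Rightarrow> bool"
  where "module_basis R M I b \<longleftrightarrow>
    b \<in> I \<rightarrow> carrier M \<and>
    (\<forall>m \<in> carrier M. \<exists>A a. finite A \<and> A \<subseteq> I \<and> a \<in> A \<rightarrow> carrier R \<and>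
        m = finsum M (\<lambda>i. a i \<odot>\<^bsub>M\<^esub> b i) A) \<and>
    (\<forall>A a. finite A \<longrightarrow> A \<subseteq> I \<longrightarrow> a \<in> A \<rightarrow> carrier R \<longrightarrow>
        finsum M (\<lambda>i. a i \<odot>\<^bsub>M\<^esub> b i) A = \<zero>\<^bsub>M\<^esub> \<longrightarrow> (\<forall>i \<in> A. a i = \<zero>\<^bsub>R\<^esub>))"


section \<open>The symmetric group\<close>

text \<open>Permutations are functions, composed from right to left. The group for the parameter \<open>n\<close>
  is the symmetric group on \<open>{1..n+1}\<close>.\<close>

abbreviation Wgrp :: "nat \<Rightarrow> (nat \<Rightarrow> nat) set"
  where "Wgrp n \<equiv> carrier (sym_group (n + 1))"

definition simple_refl :: "nat \<Rightarrow> nat \<Rightarrow> nat"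
  where "simple_refl i = transpose i (i + 1)"

definition simple_refls :: "nat \<Rightarrow> (nat \<Rightarrow> nat) set"
  where "simple_refls n = simple_refl ` {1..n}"

definition transpositions :: "nat \<Rightarrow> (nat \<Rightarrow> nat) set"
  where "transpositions n = {transpose a b | a b. a \<in> {1..n+1} \<and> b \<in> {1..n+1} \<and> a \<noteq> b}"

definition word_prod :: "('a \<Rightarrow> 'a) list \<Rightarrow> 'a \<Rightarrow> 'a"
  where "word_prod ws = foldr (\<circ>) ws id"

definition word_length :: "('a \<Rightarrow> 'a) set \<Rightarrow> ('a \<Rightarrow> 'a) \<Rightarrow> nat"
  where "word_length G w = (LEAST k. \<exists>ws. set ws \<subseteq> G \<and> word_prod ws = w \<and> length ws = k)"

definition reduced_words :: "('a \<Rightarrow> 'a) set \<Rightarrow> ('a \<Rightarrow> 'a) \<Rightarrow> ('a \<Rightarrow> 'a) list set"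
  where "reduced_words G w =
    {ws. set ws \<subseteq> G \<and> word_prod ws = w \<and> length ws = word_length G w}"

abbreviation len_S :: "nat \<Rightarrow> (nat \<Rightarrow> nat) \<Rightarrow> nat"
  where "len_S n \<equiv> word_length (simple_refls n)"

abbreviation len_T :: "nat \<Rightarrow> (nat \<Rightarrow> nat) \<Rightarrow> nat"
  where "len_T n \<equiv> word_length (transpositions n)"

definition coxeter_elt :: "nat \<Rightarrow> nat \<Rightarrow> nat"
  where "coxeter_elt n = word_prod (map simple_refl [1..<n+1])"


section \<open>Fully commutative elements\<close>

inductive commutation_move :: "nat \<Rightarrow> (nat \<Rightarrow> nat) list \<Rightarrow> (nat \<Rightarrow> nat) list \<Rightarrow> bool"
  for n where
  "s \<in> simple_refls n \<Longrightarrow> t \<in> simple_refls n \<Longrightarrow> s \<circ> t = t \<circ> s \<Longrightarrow>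
    commutation_move n (xs @ [s, t] @ ys) (xs @ [t, s] @ ys)"

definition fully_commutative :: "nat \<Rightarrow> (nat \<Rightarrow> nat) set"
  where "fully_commutative n = {w \<in> Wgrp n.
    \<forall>xs \<in> reduced_words (simple_refls n) w. \<forall>ys \<in> reduced_words (simple_refls n) w.
      (commutation_move n)\<^sup>*\<^sup>* xs ys}"

text \<open>The list \<open>[(i\<^sub>1, j\<^sub>1), \<dots>, (i\<^sub>l, j\<^sub>l)]\<close> encodes the word
  \<open>(s\<^bsub>i\<^sub>1\<^esub> \<dots> s\<^bsub>j\<^sub>1\<^esub>) \<dots> (s\<^bsub>i\<^sub>l\<^esub> \<dots> s\<^bsub>j\<^sub>l\<^esub>)\<close>
  with decreasing indices inside each bracket.\<close>

definition is_normal_form :: "nat \<Rightarrow> (nat \<Rightarrow> nat) \<Rightarrow> (nat \<times> nat) list \<Rightarrow> bool"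
  where "is_normal_form n w ps \<longleftrightarrow>
    (\<forall>(i, j) \<in> set ps. 1 \<le> j \<and> j \<le> i \<and> i \<le> n) \<and>
    sorted_wrt (<) (map fst ps) \<and> sorted_wrt (<) (map snd ps) \<and>
    concat (map (\<lambda>(i, j). map simple_refl (rev [j..<i+1])) ps) \<in> reduced_words (simple_refls n) w"

definition normal_form :: "nat \<Rightarrow> (nat \<Rightarrow> nat) \<Rightarrow> (nat \<times> nat) list"
  where "normal_form n w = (THE ps. is_normal_form n w ps)"

definition I_set :: "nat \<Rightarrow> (nat \<Rightarrow> nat) \<Rightarrow> nat set"
  where "I_set n w = fst ` set (normal_form n w)"

definition J_set :: "nat \<Rightarrow> (nat \<Rightarrow> nat) \<Rightarrow> nat set"
  where "J_set n w = snd ` set (normal_form n w)"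


section \<open>Noncrossing partitions\<close>

definition abs_le :: "nat \<Rightarrow> (nat \<Rightarrow> nat) \<Rightarrow> (nat \<Rightarrow> nat) \<Rightarrow> bool"
  where "abs_le n u v \<longleftrightarrow> len_T n u + len_T n (inv_into UNIV u \<circ> v) = len_T n v"

definition noncrossing :: "nat \<Rightarrow> (nat \<Rightarrow> nat) set"
  where "noncrossing n = {x \<in> Wgrp n. abs_le n x (coxeter_elt n)}"

text \<open>A polygon is identified with its vertex set. The cycles of a noncrossing \<open>x\<close> are increasing,
  so the initial and the terminal vertex of a polygon are its minimum and its maximum.\<close>

definition polygons :: "(nat \<Rightarrow> nat) \<Rightarrow> nat set set"
  where "polygons x = {orbit x i | i. x i \<noteq> i}"

definition Vert :: "(nat \<Rightarrow> nat) \<Rightarrow> nat set"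
  where "Vert x = \<Union> (polygons x)"

definition U_vert :: "(nat \<Rightarrow> nat) \<Rightarrow> nat set"
  where "U_vert x = Vert x - Min ` polygons x"

definition D_vert :: "(nat \<Rightarrow> nat) \<Rightarrow> nat set"
  where "D_vert x = Vert x - Max ` polygons x"

definition psi :: "nat \<Rightarrow> (nat \<Rightarrow> nat) \<Rightarrow> nat \<Rightarrow> nat"
  where "psi n w =
    (THE x. x \<in> noncrossing n \<and> D_vert x = J_set n w \<and> U_vert x = (\<lambda>i. i + 1) ` I_set n w)"


section \<open>The Temperley-Lieb algebra\<close>

text \<open>Laurent polynomials over the integers are the finitely supported functions
  \<open>int \<Rightarrow> int\<close> with the convolution product, where \<open>single k a\<close> stands for \<open>a v\<^sup>k\<close>.\<close>

type_synonym laurent = "int \<Rightarrow>\<^sub>0 int"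

abbreviation laurent_ring :: "laurent ring"
  where "laurent_ring \<equiv> ring_of_type_algebra"

definition v_pow :: "int \<Rightarrow> laurent"
  where "v_pow k = Poly_Mapping.single k 1"

text \<open>Finitely supported functions from the free monoid of words to the Laurent polynomials form
  the free associative algebra. The multiplication of finitely supported functions uses an additive monoid of exponents, so \<open>+\<close> is
  concatenation.\<close>

datatype fmon = Word (letters: "nat list")

instantiation fmon :: monoid_add
begin

definition "0 = Word []"

definition "a + b = Word (letters a @ letters b)"

instance
  by standard (simp_all add: zero_fmon_def plus_fmon_def)

end

type_synonym free_elt = "fmon \<Rightarrow>\<^sub>0 laurent"

definition scal :: "laurent \<Rightarrow> free_elt"
  where "scal a = Poly_Mapping.single 0 a"

definition free_gen :: "nat \<Rightarrow> free_elt"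
  where "free_gen i = Poly_Mapping.single (Word [i]) 1"

definition free_alg :: "nat \<Rightarrow> free_elt ring"
  where "free_alg n =
    \<lparr>carrier = {p. \<forall>w \<in> Poly_Mapping.keys p. set (letters w) \<subseteq> {1..n}},
     mult = (*), one = 1, zero = 0, add = (+)\<rparr>"

definition TL_relators :: "nat \<Rightarrow> free_elt set"
  where "TL_relators n =
    {free_gen j * free_gen i * free_gen j - free_gen j | i j.
       i \<in> {1..n} \<and> j \<in> {1..n} \<and> \<bar>int i - int j\<bar> = 1} \<union>
    {free_gen i * free_gen j - free_gen j * free_gen i | i j.
       i \<in> {1..n} \<and> j \<in> {1..n} \<and> \<bar>int i - int j\<bar> > 1} \<union>
    {free_gen i * free_gen i - scal (v_pow 1 + v_pow (- 1)) * free_gen i | i. i \<in> {1..n}}"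

definition TL_ideal :: "nat \<Rightarrow> free_elt set"
  where "TL_ideal n = Idl\<^bsub>free_alg n\<^esub> (TL_relators n)"

definition TL :: "nat \<Rightarrow> (laurent, free_elt set) module"
  where "TL n = (let Q = free_alg n Quot TL_ideal n in
    \<lparr>carrier = carrier Q, mult = mult Q, one = one Q, zero = zero Q, add = add Q,
     module.smult = (\<lambda>a A. (TL_ideal n +>\<^bsub>free_alg n\<^esub> scal a) \<otimes>\<^bsub>Q\<^esub> A)\<rparr>)"

definition TL_gen :: "nat \<Rightarrow> nat \<Rightarrow> free_elt set"
  where "TL_gen n i = TL_ideal n +>\<^bsub>free_alg n\<^esub> free_gen i"


section \<open>The braid group and the homomorphism to the Temperley-Lieb algebra\<close>

text \<open>The letter \<open>(i, True)\<close> stands for the \<open>i\<close>-th standard generator, \<open>(i, False)\<close> for its inverse.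
  The parameter \<open>n\<close> is the number of generators, hence there are \<open>n + 1\<close> strands.\<close>

type_synonym braid_word = "(nat \<times> bool) list"

definition braid_words :: "nat \<Rightarrow> braid_word set"
  where "braid_words n = {w. fst ` set w \<subseteq> {1..n}}"

inductive braid_move :: "nat \<Rightarrow> braid_word \<Rightarrow> braid_word \<Rightarrow> bool" for n where
  cancel: "i \<in> {1..n} \<Longrightarrow> braid_move n (xs @ [(i, e), (i, \<not> e)] @ ys) (xs @ ys)"
| commute: "i \<in> {1..n} \<Longrightarrow> j \<in> {1..n} \<Longrightarrow> \<bar>int i - int j\<bar> > 1 \<Longrightarrow>
    braid_move n (xs @ [(i, True), (j, True)] @ ys) (xs @ [(j, True), (i, True)] @ ys)"
| braid: "i \<in> {1..n} \<Longrightarrow> j \<in> {1..n} \<Longrightarrow> \<bar>int i - int j\<bar> = 1 \<Longrightarrow>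
    braid_move n (xs @ [(i, True), (j, True), (i, True)] @ ys)
                 (xs @ [(j, True), (i, True), (j, True)] @ ys)"

definition braid_eq :: "nat \<Rightarrow> (braid_word \<times> braid_word) set"
  where "braid_eq n = {(x, y). x \<in> braid_words n \<and> y \<in> braid_words n \<and> equivclp (braid_move n) x y}"

definition braid_group :: "nat \<Rightarrow> braid_word set monoid"
  where "braid_group n =
    \<lparr>carrier = braid_words n // braid_eq n,
     mult = (\<lambda>A B. \<Union>a\<in>A. \<Union>b\<in>B. braid_eq n `` {a @ b}),
     one = braid_eq n `` {[]}\<rparr>"

definition omega_letter :: "nat \<Rightarrow> nat \<times> bool \<Rightarrow> free_elt set"
  where "omega_letter n = (\<lambda>(i, e).
    (v_pow (if e then - 1 else 1) \<odot>\<^bsub>TL n\<^esub> \<one>\<^bsub>TL n\<^esub>) \<ominus>\<^bsub>TL n\<^esub> TL_gen n i)"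

definition omega_word :: "nat \<Rightarrow> braid_word \<Rightarrow> free_elt set"
  where "omega_word n w = foldr (\<lambda>l A. omega_letter n l \<otimes>\<^bsub>TL n\<^esub> A) w \<one>\<^bsub>TL n\<^esub>"

text \<open>The restriction to the braid group of the homomorphism from its group algebra;
  \<open>omega_word n\<close> is constant on braid classes.\<close>

definition omega :: "nat \<Rightarrow> braid_word set \<Rightarrow> free_elt set"
  where "omega n A = the_elem (omega_word n ` A)"

text \<open>For \<open>t = (i, k+1)\<close> with \<open>i \<le> k\<close>, the two moved points are the minimum \<open>i\<close> and the
  maximum \<open>k+1\<close>.\<close>

definition ic_transp :: "nat \<Rightarrow> (nat \<Rightarrow> nat) \<Rightarrow> braid_word set"
  where "ic_transp n t =
    (let i = Min {a. t a \<noteq> a}; k = Max {a. t a \<noteq> a} - 1 in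
     braid_eq n `` {map (\<lambda>a. (a, False)) (rev [i+1..<k+1]) @ [(i, True)] @
                    map (\<lambda>a. (a, True)) [i+1..<k+1]})"

definition ic :: "nat \<Rightarrow> (nat \<Rightarrow> nat) \<Rightarrow> braid_word set"
  where "ic n x =
    foldr (\<lambda>t B. ic_transp n t \<otimes>\<^bsub>braid_group n\<^esub> B)
      (SOME ts. ts \<in> reduced_words (transpositions n) x) \<one>\<^bsub>braid_group n\<^esub>"

definition Z_elt :: "nat \<Rightarrow> (nat \<Rightarrow> nat) \<Rightarrow> free_elt set"
  where "Z_elt n x = omega n (ic n x)"


section \<open>The elements \<open>X\<^sub>w\<close>\<close>

definition left_descents :: "nat \<Rightarrow> (nat \<Rightarrow> nat) \<Rightarrow> (nat \<Rightarrow> nat) set"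
  where "left_descents n w = {s \<in> simple_refls n. len_S n (s \<circ> w) < len_S n w}"

definition right_descents :: "nat \<Rightarrow> (nat \<Rightarrow> nat) \<Rightarrow> (nat \<Rightarrow> nat) set"
  where "right_descents n w = {s \<in> simple_refls n. len_S n (w \<circ> s) < len_S n w}"

type_synonym perm_set_pair = "(nat \<Rightarrow> nat) set \<times> (nat \<Rightarrow> nat) set"

inductive removal :: "nat \<Rightarrow> perm_set_pair \<Rightarrow> perm_set_pair \<Rightarrow> bool" for n where
  "s \<in> L \<Longrightarrow> s \<in> R \<Longrightarrow> removal n (L, R) (L - {s}, R)"
| "s \<in> L \<Longrightarrow> s \<in> R \<Longrightarrow> removal n (L, R) (L, R - {s})"
| "j \<in> {2..n} \<Longrightarrow> simple_refl j \<in> L \<Longrightarrow> simple_refl (j - 1) \<in> R \<Longrightarrow>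
    removal n (L, R) (L - {simple_refl j}, R)"
| "j \<in> {2..n} \<Longrightarrow> simple_refl j \<in> L \<Longrightarrow> simple_refl (j - 1) \<in> R \<Longrightarrow>
    removal n (L, R) (L, R - {simple_refl (j - 1)})"

definition ending_pair :: "nat \<Rightarrow> perm_set_pair \<Rightarrow> perm_set_pair \<Rightarrow> bool"
  where "ending_pair n = (\<lambda>(L, R) (L', R').
    (removal n)\<^sup>*\<^sup>* (L, R) (L', R') \<and> L' \<inter> R' = {} \<and>
    \<not> (\<exists>j \<in> {2..n}. simple_refl j \<in> L' \<and> simple_refl (j - 1) \<in> R'))"

text \<open>Only used for finite sets of pairwise commuting permutations.\<close>

definition commuting_prod :: "('a \<Rightarrow> 'a) set \<Rightarrow> 'a \<Rightarrow> 'a"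
  where "commuting_prod A = Finite_Set.fold (\<circ>) id A"

definition x_elt ::
  "nat \<Rightarrow> (nat \<Rightarrow> nat) \<Rightarrow> (nat \<Rightarrow> nat) set \<Rightarrow> (nat \<Rightarrow> nat) set \<Rightarrow> nat \<Rightarrow> nat"
  where "x_elt n w L R =
    (let (L', R') = (SOME p. ending_pair n (L, R) p) in
     commuting_prod L' \<circ> psi n w \<circ> commuting_prod R')"

definition Q_set :: "nat \<Rightarrow> (nat \<Rightarrow> nat) \<Rightarrow> (nat \<Rightarrow> nat) set"
  where "Q_set n w =
    {x_elt n w L R | L R. L \<subseteq> left_descents n w \<and> R \<subseteq> right_descents n w}"

definition alpha :: "nat \<Rightarrow> (nat \<Rightarrow> nat) \<Rightarrow> (nat \<Rightarrow> nat) \<Rightarrow> int"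
  where "alpha n w x = int (len_S n w) + int (len_S n (psi n w)) - int (len_S n x)"

definition beta :: "nat \<Rightarrow> (nat \<Rightarrow> nat) \<Rightarrow> (nat \<Rightarrow> nat) \<Rightarrow> int"
  where "beta n w x = int (len_T n x) - int (len_T n (psi n w))"

definition p_coeff :: "nat \<Rightarrow> (nat \<Rightarrow> nat) \<Rightarrow> (nat \<Rightarrow> nat) \<Rightarrow> laurent"
  where "p_coeff n w x = (if even (alpha n w x) then 1 else - 1) * v_pow (beta n w x)"

definition X_elt :: "nat \<Rightarrow> (nat \<Rightarrow> nat) \<Rightarrow> free_elt set"
  where "X_elt n w =
    finsum (TL n) (\<lambda>x. p_coeff n w x \<odot>\<^bsub>TL n\<^esub> Z_elt n x) (Q_set n w)"


section \<open>The Temperley-Lieb algebra is a ring and a module over the Laurent polynomials\<close>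

lemma free_alg_sel [simp]:
  "mult (free_alg n) = (*)" "one (free_alg n) = 1" "zero (free_alg n) = 0" "add (free_alg n) = (+)"
  by (simp_all add: free_alg_def)

lemma free_alg_closed:
  assumes "p \<in> carrier (free_alg n)" "q \<in> carrier (free_alg n)"
  shows "p + q \<in> carrier (free_alg n)" "p * q \<in> carrier (free_alg n)" "- p \<in> carrier (free_alg n)"
proof -
  show "p + q \<in> carrier (free_alg n)"
    using assms Poly_Mapping.keys_add[of p q] unfolding free_alg_def by fastforce
  show "- p \<in> carrier (free_alg n)"
    using assms unfolding free_alg_def by simp
  show "p * q \<in> carrier (free_alg n)"
    using assms keys_mult[of p q] unfolding free_alg_def
    by (fastforce simp: plus_fmon_def)
qed

lemma scal_closed: "scal a \<in> carrier (free_alg n)"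
  by (auto simp: scal_def free_alg_def zero_fmon_def)

lemma free_gen_closed: "i \<in> {1..n} \<Longrightarrow> free_gen i \<in> carrier (free_alg n)"
  by (auto simp: free_gen_def free_alg_def)

lemma ring_free_alg: "ring (free_alg n)"
proof (rule ringI)
  show "abelian_group (free_alg n)"
  proof (rule abelian_groupI)
    show "\<exists>y\<in>carrier (free_alg n). y \<oplus>\<^bsub>free_alg n\<^esub> x = \<zero>\<^bsub>free_alg n\<^esub>"
      if "x \<in> carrier (free_alg n)" for x
      using free_alg_closed(3)[OF that that] by (intro bexI[of _ "- x"]) auto
  qed (auto simp: free_alg_closed add.assoc add.commute, simp add: free_alg_def)
  show "monoid (free_alg n)"
    using scal_closed[of 1 n]
    by (intro monoidI) (auto simp: free_alg_closed mult.assoc scal_def)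
qed (auto simp: distrib_left distrib_right)

lemma TL_relators_subset: "TL_relators n \<subseteq> carrier (free_alg n)"
proof -
  have d: "p - q \<in> carrier (free_alg n)"
    if "p \<in> carrier (free_alg n)" "q \<in> carrier (free_alg n)" for p q
    using free_alg_closed(1)[OF that(1) free_alg_closed(3)[OF that(2,2)]] by simp
  show ?thesis
    unfolding TL_relators_def
    by (auto intro!: d free_alg_closed(2) scal_closed free_gen_closed)
qed

lemma ideal_TL: "ideal (TL_ideal n) (free_alg n)"
  unfolding TL_ideal_def by (intro ring.genideal_ideal ring_free_alg TL_relators_subset)

lemma TL_sel [simp]:
  "carrier (TL n) = carrier (free_alg n Quot TL_ideal n)"
  "mult (TL n) = mult (free_alg n Quot TL_ideal n)"
  "one (TL n) = one (free_alg n Quot TL_ideal n)"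
  "zero (TL n) = zero (free_alg n Quot TL_ideal n)"
  "add (TL n) = add (free_alg n Quot TL_ideal n)"
  "module.smult (TL n) a A =
    (TL_ideal n +>\<^bsub>free_alg n\<^esub> scal a) \<otimes>\<^bsub>free_alg n Quot TL_ideal n\<^esub> A"
  by (simp_all add: TL_def Let_def)

lemma ring_TL: "ring (TL n)"
proof -
  interpret Q: ring "free_alg n Quot TL_ideal n"
    by (rule ideal.quotient_is_ring[OF ideal_TL])
  show ?thesis
  proof (rule ringI)
    show "abelian_group (TL n)"
      by (rule abelian_groupI) (auto simp: Q.a_ac intro!: bexI[OF _ Q.a_inv_closed] Q.l_neg)
    show "monoid (TL n)"
      by (rule monoidI) (auto simp: Q.m_assoc)
  qed (auto simp: Q.l_distr Q.r_distr)
qed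

lemma module_TL: "module laurent_ring (TL n)"
proof -
  interpret Q: ring "free_alg n Quot TL_ideal n"
    by (rule ideal.quotient_is_ring[OF ideal_TL])
  interpret h: ring_hom_ring "free_alg n" "free_alg n Quot TL_ideal n" "(+>\<^bsub>free_alg n\<^esub>) (TL_ideal n)"
    by (rule ideal.rcos_ring_hom_ring[OF ideal_TL])
  have scal: "scal (a + b) = scal a + scal b" "scal (a * b) = scal a * scal b" "scal 1 = 1" for a b
    by (simp_all add: scal_def single_add mult_single)
  show ?thesis
  proof (rule moduleI)
    show "cring laurent_ring"
      by (rule cring_from_type_algebra)
    show "abelian_group (TL n)"
      by (rule ring.is_abelian_group[OF ring_TL])
  qed (use h.hom_add[of "scal _" "scal _"] h.hom_mult[of "scal _" "scal _"] h.hom_one in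
      \<open>auto simp: ring_of_type_algebra_def scal scal_closed Q.l_distr Q.r_distr Q.m_assoc\<close>)
qed

end

theory Submission
  imports Defs "Jordan_Normal_Form.Determinant"
begin

text \<open>
  The Temperley-Lieb algebra acts on functions on subsets of the strands (spin configurations). For
  a noncrossing permutation \<open>x\<close> with ascent positions \<open>D\<close> and ascent values \<open>U\<close>, consider the matrix
  entry of this action from the configuration \<open>D\<close> to the configuration \<open>U\<close>. Every factor \<open>i\<^sub>c(t)\<close>
  carries at most one occupied site to the right across each cut between neighbouring strands.
  Counting the occupied sites that cross each cut shows that the matrix of these entries on the
  elements \<open>Z\<^sub>y\<close> is triangular with powers of \<open>v\<close> on the diagonal. The elements of \<open>Q\<^sub>w\<close> other than
  \<open>\<psi>(w)\<close> arise from \<open>\<psi>(w)\<close> by inserting vertices in the interior of polygons or by cutting off end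
  vertices, and both operations go down in the order in question, so the same triangularity
  holds for the elements \<open>X\<^sub>w\<close>; in particular they are linearly independent. They also span: the
  monomials of the normal forms span, they are indexed by the same finite set, and the triangular
  matrix is the product of the matrix of entries of these monomials and of the
  matrix that expresses the \<open>X\<^sub>w\<close> through the monomials, so the latter has an invertible determinant.
\<close>

section \<open>Noncrossing permutations\<close>

text \<open>The set \<open>exc x\<close> and its image under \<open>x\<close> are D_x and U_x for
  noncrossing \<open>x\<close>, and J_w and I_w[1] for fully commutative \<open>w\<close>. So
  \<open>w\<close> and \<open>psi n w\<close> select the same entry, and fully commutative elements
  can index rows and columns alike. Two obstacles shape the proof. \<open>Z_elt\<close> comes from
  an unspecified reduced word, while entries can be controlled only along a convenient one, which
  peels off the least moved point again and again; the dual braid relations, checked for invertible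
  operators, make all reduced words act alike. Moreover, the counts at the cuts do not separate
  noncrossing permutations: a vertex inserted on an edge enters D and U together and leaves every
  count unchanged. Hence the order compares the total length of the edges and then the number of
  ascents, and equal counts have to be complemented by an inclusion between the sets U. The
  coefficients do not form a field, so spanning has to come from a determinant that is a unit and
  not from a comparison of dimensions.\<close>

definition exc :: "(nat \<Rightarrow> nat) \<Rightarrow> nat set"
  where "exc x = {p. p < x p}"

text \<open>The equivalence, rather than mere closure under \<open>f\<close>, lets invariance pass
  to differences and preimages; for finite sets and injective \<open>f\<close> closure is
  enough.\<close>

definition stable_set :: "(nat \<Rightarrow> nat) \<Rightarrow> nat set \<Rightarrow> bool"
  where "stable_set f S \<longleftrightarrow> (\<forall>q. f q \<in> S \<longleftrightarrow> q \<in> S)"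

text \<open>For a permutation of finite support this is the cycle through \<open>a\<close>.\<close>

definition cycle_of :: "(nat \<Rightarrow> nat) \<Rightarrow> nat \<Rightarrow> nat set"
  where "cycle_of f a = {b. \<forall>S. stable_set f S \<longrightarrow> (a \<in> S \<longleftrightarrow> b \<in> S)}"

text \<open>\<open>nc_perm x\<close> says that the cycles of \<open>x\<close> are increasing and that their supports form a noncrossing
  partition: the points between a point and its image, in the cyclic order, are permuted among
  themselves.\<close>

definition nc_perm :: "(nat \<Rightarrow> nat) \<Rightarrow> bool"
  where "nc_perm x \<longleftrightarrow> bij x \<and> (\<forall>p. p < x p \<longrightarrow> stable_set x {p<..<x p}) \<and>
    (\<forall>p. x p < p \<longrightarrow> stable_set x {x p..p})"

lemma nc_permD:
  assumes "nc_perm x"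
  shows "bij x" "p < x p \<Longrightarrow> stable_set x {p<..<x p}" "x p < p \<Longrightarrow> stable_set x {x p..p}"
  using assms unfolding nc_perm_def by auto

lemma stable_setD: "stable_set f S \<Longrightarrow> f q \<in> S \<longleftrightarrow> q \<in> S"
  unfolding stable_set_def by blast

lemma stable_set_Un: "stable_set f S \<Longrightarrow> stable_set f T \<Longrightarrow> stable_set f (S \<union> T)"
  and stable_set_Diff: "stable_set f S \<Longrightarrow> stable_set f T \<Longrightarrow> stable_set f (S - T)"
  and stable_set_empty: "stable_set f {}"
  unfolding stable_set_def by blast+

lemma stable_setI:
  assumes "inj f" "finite S" "\<And>q. q \<in> S \<Longrightarrow> f q \<in> S"
  shows "stable_set f S"
proof -
  have "f ` S = S"
    using assms by (intro endo_inj_surj) (auto intro: inj_on_subset)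
  then show ?thesis
    unfolding stable_set_def using assms(1) by (metis inj_image_mem_iff)
qed

lemma stable_set_fixed:
  assumes "inj f" "f q = q" shows "stable_set f {q}"
  unfolding stable_set_def using inj_eq[OF assms(1), of _ q] assms(2) by simp

lemma transpose_mem_iff: "(a \<in> S \<longleftrightarrow> b \<in> S) \<Longrightarrow> transpose a b r \<in> S \<longleftrightarrow> r \<in> S"
  by (auto simp: transpose_def)

lemma cycle_of_self: "a \<in> cycle_of f a"
  unfolding cycle_of_def by blast

lemma cycle_of_cong: "b \<in> cycle_of f a \<Longrightarrow> stable_set f S \<Longrightarrow> a \<in> S \<longleftrightarrow> b \<in> S"
  unfolding cycle_of_def by blast

lemma stable_cycle_of: "stable_set f (cycle_of f a)"
  unfolding cycle_of_def stable_set_def by auto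

lemma cycle_of_apply: "f a \<in> cycle_of f a"
  using stable_cycle_of cycle_of_self unfolding stable_set_def by blast

lemma cycle_of_eq_iff: "cycle_of f a = cycle_of f b \<longleftrightarrow> b \<in> cycle_of f a"
  unfolding cycle_of_def by blast

lemma cycle_of_sym: "b \<in> cycle_of f a \<longleftrightarrow> a \<in> cycle_of f b"
  unfolding cycle_of_def by blast

lemma cycle_of_subset: "stable_set f S \<Longrightarrow> a \<in> S \<Longrightarrow> cycle_of f a \<subseteq> S"
  unfolding cycle_of_def by blast

text \<open>A stable set cannot separate two members of one cycle. If \<open>x q\<close> jumped
  beyond \<open>b\<close>, the open interval up to \<open>x q\<close> would contain \<open>b\<close>
  but not \<open>a\<close>; if it fell back to \<open>a\<close> or below, the closed interval from
  \<open>x q\<close> to \<open>q\<close> would contain \<open>a\<close> but not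
  \<open>b\<close>.\<close>

lemma nc_perm_cycle_step:
  assumes x: "nc_perm x" and ab: "b \<in> cycle_of x a" "a \<le> q" "q < b"
  shows "a < x q" "x q \<le> b"
proof -
  show "x q \<le> b"
  proof (rule ccontr)
    assume *: "\<not> x q \<le> b"
    then have "stable_set x {q<..<x q}" using nc_permD(2)[OF x, of q] ab by simp
    from cycle_of_cong[OF ab(1) this] show False using * ab by auto
  qed
  show "a < x q"
  proof (rule ccontr)
    assume *: "\<not> a < x q"
    show False
    proof (cases "x q = q")
      case True
      then have "stable_set x {q}" using nc_permD(1)[OF x] bij_is_inj stable_set_fixed by blast
      from cycle_of_cong[OF ab(1) this] show False using * ab True by auto
    next
      case False
      then have "stable_set x {x q..q}" using nc_permD(3)[OF x, of q] ab * by simp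
      from cycle_of_cong[OF ab(1) this] show False using * ab by auto
    qed
  qed
qed

text \<open>The transposition cuts the cycle through \<open>a\<close> and \<open>b\<close> in two.
  Stable sets of \<open>y\<close> stay stable, since each contains both of \<open>a\<close>,
  \<open>b\<close> or neither; the intervals whose ends move are obtained from these by adding or
  removing the block \<open>{a..<b}\<close>.\<close>

lemma nc_perm_split:
  assumes y: "nc_perm y" and ab: "b \<in> cycle_of y a" "a < b"
  shows "nc_perm (transpose a b \<circ> y)"
proof -
  let ?t = "transpose a b"
  let ?z = "?t \<circ> y"
  have bij: "bij ?z" using nc_permD(1)[OF y] by (intro bij_comp) auto
  then have inj: "inj ?z" by (rule bij_is_inj)
  have st: "stable_set ?z S" if "stable_set y S" for S
    using transpose_mem_iff[OF cycle_of_cong[OF ab(1) that]] stable_setD[OF that]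
    by (simp add: stable_set_def)
  \<comment> \<open>Under \<open>y\<close> these points go to values above \<open>a\<close> and at
    most \<open>b\<close>, and the value \<open>b\<close> is replaced by \<open>a\<close>.\<close>
  have K: "stable_set ?z {a..<b}"
  proof (rule stable_setI[OF inj])
    fix q assume "q \<in> {a..<b}"
    then have "a < y q" "y q \<le> b" using nc_perm_cycle_step[OF y ab(1), of q] by auto
    then show "?z q \<in> {a..<b}" using ab by (auto simp: transpose_def)
  qed simp
  have nob: "stable_set y S \<Longrightarrow> a \<notin> S \<longleftrightarrow> b \<notin> S" for S
    using cycle_of_cong[OF ab(1)] by blast
  have one: "stable_set ?z {p<..<?z p}" if "p < ?z p" for p
  proof -
    consider "y p \<noteq> a" "y p \<noteq> b" | "y p = b" | "y p = a" by blast
    then show ?thesis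
    proof cases
      case 1 then show ?thesis using st nc_permD(2)[OF y, of p] that by (simp add: transpose_def)
    next
      case 2
      then have z: "?z p = a" by simp
      with that have "p < a" by simp
      then have "stable_set y {p<..<b}" using nc_permD(2)[OF y, of p] 2 ab by simp
      from nob[OF this] show ?thesis using \<open>p < a\<close> ab by auto
    next
      case 3
      then have z: "?z p = b" by simp
      with that have pb: "p < b" by simp
      have "p < a"
      proof (rule ccontr)
        assume "\<not> p < a"
        then show False using nc_perm_cycle_step[OF y ab(1), of p] pb 3 by simp
      qed
      then have "stable_set y {p<..<a}" using nc_permD(2)[OF y, of p] 3 by simp
      then have "stable_set ?z ({p<..<a} \<union> {a..<b})" using st K stable_set_Un by blast
      moreover have "{p<..<a} \<union> {a..<b} = {p<..<b}" using \<open>p < a\<close> ab by auto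
      ultimately show ?thesis using z by simp
    qed
  qed
  have two: "stable_set ?z {?z p..p}" if "?z p < p" for p
  proof -
    consider "y p \<noteq> a" "y p \<noteq> b" | "y p = b" | "y p = a" by blast
    then show ?thesis
    proof cases
      case 1 then show ?thesis using st nc_permD(3)[OF y, of p] that by (simp add: transpose_def)
    next
      case 2
      then have z: "?z p = a" by simp
      with that have ap: "a < p" by simp
      have "p \<noteq> b"
      proof
        assume "p = b"
        then have "stable_set y {b}" using nc_permD(1)[OF y] 2 bij_is_inj stable_set_fixed by blast
        from nob[OF this] show False using ab by auto
      qed
      moreover have "\<not> b < p"
      proof
        assume "b < p"
        then have "stable_set y {b..p}" using nc_permD(3)[OF y, of p] 2 by simp
        from nob[OF this] show False using ab \<open>b < p\<close> by auto
      qed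
      ultimately have pb: "p < b" by simp
      then have "stable_set y {p<..<b}" using nc_permD(2)[OF y, of p] 2 by simp
      then have "stable_set ?z ({a..<b} - {p<..<b})" using st K stable_set_Diff by blast
      moreover have "{a..<b} - {p<..<b} = {a..p}" using ap pb by auto
      ultimately show ?thesis using z by simp
    next
      case 3
      then have z: "?z p = b" by simp
      with that have pb: "b < p" by simp
      then have "stable_set y {a..p}" using nc_permD(3)[OF y, of p] 3 ab by simp
      then have "stable_set ?z ({a..p} - {a..<b})" using st K stable_set_Diff by blast
      moreover have "{a..p} - {a..<b} = {b..p}" using ab by auto
      ultimately show ?thesis using z by simp
    qed
  qed
  show ?thesis unfolding nc_perm_def using bij one two by blast
qed

section \<open>Cycle counts and reflection length\<close>

lemma cycle_of_transpose_avoid: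
  assumes "a \<notin> cycle_of f q" "b \<notin> cycle_of f q"
  shows "cycle_of (transpose a b \<circ> f) q = cycle_of f q"
proof -
  let ?g = "transpose a b \<circ> f"
  have st: "stable_set ?g S \<longleftrightarrow> stable_set f S" if "a \<notin> S" "b \<notin> S" for S
    using transpose_mem_iff[of a S b] that by (simp add: stable_set_def)
  have sub: "cycle_of ?g q \<subseteq> cycle_of f q"
    using st[OF assms] stable_cycle_of[of f q] cycle_of_self[of q f] by (intro cycle_of_subset) auto
  then have "stable_set f (cycle_of ?g q)"
    using st[of "cycle_of ?g q"] stable_cycle_of[of ?g q] assms by blast
  then have "cycle_of f q \<subseteq> cycle_of ?g q"
    using cycle_of_self by (intro cycle_of_subset)
  with sub show ?thesis by blast
qed

definition cycles_on :: "nat set \<Rightarrow> (nat \<Rightarrow> nat) \<Rightarrow> nat set set"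
  where "cycles_on A f = cycle_of f ` A"

lemma cycles_on_transpose_avoid:
  "{C \<in> cycles_on A (transpose a b \<circ> f). a \<notin> C \<and> b \<notin> C} = {C \<in> cycles_on A f. a \<notin> C \<and> b \<notin> C}"
proof -
  have sub: "{C \<in> cycles_on A f. a \<notin> C \<and> b \<notin> C} \<subseteq>
      {C \<in> cycles_on A (transpose a b \<circ> f). a \<notin> C \<and> b \<notin> C}" for f
    unfolding cycles_on_def using cycle_of_transpose_avoid[of a f _ b] by (auto simp: image_iff)
  have "transpose a b \<circ> (transpose a b \<circ> f) = f" by (simp add: fun_eq_iff)
  with sub[of f] sub[of "transpose a b \<circ> f"] show ?thesis by simp
qed

lemma cycles_on_eq_insert:
  assumes "a \<in> A" "b \<in> A"
  shows "cycles_on A f =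
    insert (cycle_of f a) (insert (cycle_of f b) {C \<in> cycles_on A f. a \<notin> C \<and> b \<notin> C})"
proof (intro equalityI subsetI)
  fix C assume "C \<in> cycles_on A f"
  moreover from this obtain q where "q \<in> A" "C = cycle_of f q" unfolding cycles_on_def by auto
  ultimately show "C \<in> insert (cycle_of f a) (insert (cycle_of f b) {C \<in> cycles_on A f. a \<notin> C \<and> b \<notin> C})"
    using cycle_of_eq_iff[of f q] by auto
qed (use assms in \<open>auto simp: cycles_on_def\<close>)

text \<open>Only the cycles through \<open>a\<close> and \<open>b\<close> change. Afterwards there
  are at most two of them; before there was at least one, and there were two if \<open>a\<close> and
  \<open>b\<close> lay in different cycles.\<close>

lemma card_cycles_on_transpose:
  assumes A: "finite A" "a \<in> A" "b \<in> A"
  shows "card (cycles_on A (transpose a b \<circ> f)) \<le> card (cycles_on A f) + 1"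
    and "b \<notin> cycle_of f a \<Longrightarrow> card (cycles_on A (transpose a b \<circ> f)) \<le> card (cycles_on A f)"
proof -
  let ?g = "transpose a b \<circ> f"
  define C0 where "C0 = {C \<in> cycles_on A f. a \<notin> C \<and> b \<notin> C}"
  have fin: "finite (cycles_on A f)" for f unfolding cycles_on_def using A by simp
  have C0: "finite C0" unfolding C0_def using fin by simp
  have g: "cycles_on A ?g = insert (cycle_of ?g a) (insert (cycle_of ?g b) C0)"
    using cycles_on_eq_insert[OF A(2,3), of ?g] unfolding cycles_on_transpose_avoid C0_def .
  have f: "cycles_on A f = insert (cycle_of f a) (insert (cycle_of f b) C0)"
    using cycles_on_eq_insert[OF A(2,3), of f] unfolding C0_def .
  have n: "cycle_of f a \<notin> C0" "cycle_of f b \<notin> C0" unfolding C0_def using cycle_of_self by auto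
  have up: "card (cycles_on A ?g) \<le> card C0 + 2"
    unfolding g using C0 by (simp add: card_insert_if)
  have "card C0 + 1 \<le> card (cycles_on A f)"
    unfolding f using C0 n by (simp add: card_insert_if)
  with up show "card (cycles_on A ?g) \<le> card (cycles_on A f) + 1" by simp
  assume "b \<notin> cycle_of f a"
  then have "cycle_of f a \<noteq> cycle_of f b" by (simp add: cycle_of_eq_iff)
  then have "card C0 + 2 = card (cycles_on A f)"
    unfolding f using C0 n by (simp add: card_insert_if)
  with up show "card (cycles_on A ?g) \<le> card (cycles_on A f)" by simp
qed

lemma Wgrp_iff: "x \<in> Wgrp n \<longleftrightarrow> x permutes {1..n+1}"
  by (simp add: sym_group_def)

abbreviation perm_inv :: "('a \<Rightarrow> 'a) \<Rightarrow> 'a \<Rightarrow> 'a"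
  where "perm_inv f \<equiv> inv_into UNIV f"

lemma word_prod_Nil: "word_prod [] = id"
  and word_prod_Cons: "word_prod (t # ts) = t \<circ> word_prod ts"
  by (simp_all add: word_prod_def)

lemma word_prod_append: "word_prod (us @ vs) = word_prod us \<circ> word_prod vs"
  by (induct us) (simp_all add: word_prod_Nil word_prod_Cons comp_assoc)

lemma word_prod_apply [simp]:
  "word_prod [] q = q" "word_prod (t # ts) q = t (word_prod ts q)"
  "word_prod (us @ vs) q = word_prod us (word_prod vs q)"
  by (simp_all add: word_prod_Nil word_prod_Cons word_prod_append)

lemma transpositionsE:
  assumes "t \<in> transpositions n"
  obtains a b where "a < b" "a \<in> {1..n+1}" "b \<in> {1..n+1}" "t = transpose a b"
proof -
  from assms obtain a b where *: "a \<in> {1..n+1}" "b \<in> {1..n+1}" "a \<noteq> b" "t = transpose a b"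
    unfolding transpositions_def by auto
  then show thesis
    using that[of a b] that[of b a] by (cases "a < b") (auto simp: transpose_commute)
qed

lemma transpositionsI:
  "a < b \<Longrightarrow> a \<in> {1..n+1} \<Longrightarrow> b \<in> {1..n+1} \<Longrightarrow> transpose a b \<in> transpositions n"
  unfolding transpositions_def mem_Collect_eq by (rule exI[of _ a], rule exI[of _ b]) simp

lemma permutes_word_prod_transpositions:
  "set ts \<subseteq> transpositions n \<Longrightarrow> word_prod ts permutes {1..n+1}"
proof (induct ts)
  case (Cons t ts)
  then have "t \<in> transpositions n" by simp
  then obtain a b where "a \<in> {1..n+1}" "b \<in> {1..n+1}" "t = transpose a b"
    by (rule transpositionsE)
  then have "t permutes {1..n+1}" by (metis permutes_swap_id)
  moreover have "word_prod ts permutes {1..n+1}" using Cons by simp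
  ultimately show ?case unfolding word_prod_Cons by (rule permutes_compose[rotated])
qed (simp add: word_prod_Nil permutes_id)

lemma transposition_word_exists:
  assumes "x permutes {1..n+1}"
  shows "\<exists>ts. set ts \<subseteq> transpositions n \<and> word_prod ts = x"
  using assms
proof (induct rule: permutes_induct[OF assms])
  case 1 then show ?case by simp
next
  case 2 show ?case by (rule exI[of _ "[]"]) (simp add: word_prod_Nil)
next
  case (3 a b p)
  then obtain ts where ts: "set ts \<subseteq> transpositions n" "word_prod ts = p" by auto
  have "transpose a b \<in> transpositions n" using 3 unfolding transpositions_def by blast
  then show ?case using ts by (intro exI[of _ "transpose a b # ts"]) (simp add: word_prod_Cons)
qed

lemma word_length_le:
  "set ws \<subseteq> G \<Longrightarrow> word_length G (word_prod ws) \<le> length ws"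
  unfolding word_length_def by (rule Least_le) blast

lemma reduced_word_exists:
  assumes "set ws \<subseteq> G" "word_prod ws = w"
  shows "\<exists>us. us \<in> reduced_words G w"
proof -
  let ?P = "\<lambda>k. \<exists>us. set us \<subseteq> G \<and> word_prod us = w \<and> length us = k"
  have "?P (length ws)" using assms by blast
  then have "?P (word_length G w)" unfolding word_length_def by (rule LeastI)
  then show ?thesis unfolding reduced_words_def by blast
qed

text \<open>The identity has \<open>n + 1\<close> cycles, counting fixed points, and each letter can
  merge at most two of them.\<close>

lemma length_add_card_cycles_ge:
  assumes "set ts \<subseteq> transpositions n"
  shows "n + 1 \<le> card (cycles_on {1..n+1} (word_prod ts)) + length ts"
  using assms
proof (induct ts)
  case Nil
  have "stable_set id S" for S by (simp add: stable_set_def)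
  then have "cycle_of id a = {a}" for a unfolding cycle_of_def by blast
  then have "cycles_on {1..n+1} id = (\<lambda>a. {a}) ` {1..n+1}" unfolding cycles_on_def by simp
  then have "card (cycles_on {1..n+1} id) = n + 1" by (simp add: card_image inj_on_def)
  then show ?case unfolding word_prod_Nil by linarith
next
  case (Cons t ts)
  then have "t \<in> transpositions n" by simp
  then obtain a b where ab: "a \<in> {1..n+1}" "b \<in> {1..n+1}" "t = transpose a b"
    by (rule transpositionsE)
  have "t \<circ> (t \<circ> word_prod ts) = word_prod ts" unfolding ab by (simp add: fun_eq_iff)
  then have "card (cycles_on {1..n+1} (word_prod ts)) \<le> card (cycles_on {1..n+1} (t \<circ> word_prod ts)) + 1"
    using card_cycles_on_transpose(1)[of "{1..n+1}" a b "t \<circ> word_prod ts"] ab by simp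
  moreover have "n + 1 \<le> card (cycles_on {1..n+1} (word_prod ts)) + length ts" using Cons by simp
  ultimately show ?case unfolding word_prod_Cons list.size by linarith
qed

lemma permutes_exc_subset:
  assumes "x permutes {1..N}" shows "exc x \<subseteq> {1..N}" "x ` exc x \<subseteq> {1..N}"
proof -
  show "exc x \<subseteq> {1..N}"
    unfolding exc_def using permutes_not_in[OF assms] by (metis (mono_tags) mem_Collect_eq nat_less_le subsetI)
  then show "x ` exc x \<subseteq> {1..N}"
    using permutes_in_image[OF assms] by auto
qed

lemma finite_exc: "x permutes {1..N} \<Longrightarrow> finite (exc x)"
  using permutes_exc_subset(1) finite_subset by blast

text \<open>The maximum of a cycle is not an ascent, so every cycle is represented by a
  non-ascent.\<close>

lemma card_cycles_add_exc_le:
  assumes "x permutes {1..N}"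
  shows "card (cycles_on {1..N} x) + card (exc x) \<le> N"
proof -
  have "cycles_on {1..N} x \<subseteq> cycle_of x ` ({1..N} - exc x)"
  proof
    fix C assume "C \<in> cycles_on {1..N} x"
    then obtain a where a: "a \<in> {1..N}" "C = cycle_of x a" unfolding cycles_on_def by auto
    have "stable_set x {1..N}" unfolding stable_set_def using permutes_in_image[OF assms] by blast
    then have sub: "C \<subseteq> {1..N}" using a cycle_of_subset by blast
    then have fin: "finite C" using finite_subset by blast
    have ne: "a \<in> C" using a cycle_of_self by simp
    have M: "Max C \<in> C" using fin ne by (intro Max_in) auto
    then have "x (Max C) \<in> C" using a stable_cycle_of stable_setD by blast
    then have "Max C \<notin> exc x" using Max_ge[OF fin] unfolding exc_def by (auto simp: not_less)
    moreover have "C = cycle_of x (Max C)" using M a cycle_of_eq_iff by blast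
    ultimately show "C \<in> cycle_of x ` ({1..N} - exc x)" using M sub by blast
  qed
  then have "card (cycles_on {1..N} x) \<le> card ({1..N} - exc x)"
    using surj_card_le by (metis finite_Diff finite_atLeastAtMost)
  also have "\<dots> = N - card (exc x)"
    using permutes_exc_subset(1)[OF assms] finite_exc[OF assms] by (simp add: card_Diff_subset)
  finally show ?thesis
    using card_mono[OF _ permutes_exc_subset(1)[OF assms]] by simp
qed

lemma card_exc_le_length:
  assumes "set ts \<subseteq> transpositions n"
  shows "card (exc (word_prod ts)) \<le> length ts"
  using length_add_card_cycles_ge[OF assms]
    card_cycles_add_exc_le[OF permutes_word_prod_transpositions[OF assms]] by simp

lemma exists_least_moved:
  assumes "inj x" "x \<noteq> id"
  obtains p :: nat where "p < x p" "\<And>q. q < p \<Longrightarrow> x q = q"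
proof -
  define p where "p = (LEAST p. x p \<noteq> p)"
  have "\<exists>p. x p \<noteq> p" using assms(2) by (auto simp: fun_eq_iff)
  then have l: "x p \<noteq> p" unfolding p_def by (rule LeastI_ex)
  have q: "x q = q" if "q < p" for q using not_less_Least[of q "\<lambda>p. x p \<noteq> p"] that by (simp add: p_def)
  have "\<not> x p < p"
  proof
    assume "x p < p"
    from injD[OF assms(1) q[OF this]] l show False by contradiction
  qed
  then show thesis using that[of p] l q by simp
qed

text \<open>The least moved point \<open>p\<close> is the initial vertex of its polygon and is
  detached from it. The point that closed the polygon at \<open>p\<close> now closes it at
  \<open>x p\<close>; by noncrossingness it is not below \<open>x p\<close>, so no new ascent
  arises. This step drives the inductions on the number of ascents.\<close>

lemma nc_perm_peel:
  assumes x: "nc_perm x" and p: "p < x p" "\<And>q. q < p \<Longrightarrow> x q = q"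
  defines "y \<equiv> transpose p (x p) \<circ> x"
  shows "nc_perm y" "y p = p" "\<And>q. q < p \<Longrightarrow> y q = q" "p \<notin> exc y" "exc x = insert p (exc y)"
    "\<And>q. q \<in> exc y \<Longrightarrow> y q = x q"
proof -
  have inj: "inj x" using nc_permD(1)[OF x] bij_is_inj by blast
  show "nc_perm y" unfolding y_def
    using nc_perm_split[OF x cycle_of_apply p(1)] .
  show yp: "y p = p" by (simp add: y_def)
  show yq: "y q = q" if "q < p" for q using p that by (simp add: y_def transpose_def)
  show "p \<notin> exc y" using yp by (simp add: exc_def)
  have *: "y q = x q" if "q \<noteq> p" "x q \<noteq> p" for q
    using that injD[OF inj, of q p] by (auto simp: y_def transpose_def)
  have r: "\<not> q < y q" if "x q = p" for q
  proof -
    have "p < q" using that p by (metis linorder_neqE_nat nat_less_le)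
    then have "stable_set x {p..q}" using nc_permD(3)[OF x, of q] that by simp
    from stable_setD[OF this, of p] have "x p \<in> {p..q}" using \<open>p < q\<close> by simp
    then show ?thesis using that by (simp add: y_def)
  qed
  have **: "q \<in> exc y \<longleftrightarrow> q \<in> exc x" if "q \<noteq> p" for q
  proof (cases "x q = p")
    case True
    then have "q > p" using p that by (metis linorder_neqE_nat nat_less_le)
    then show ?thesis using r[OF True] True by (simp add: exc_def)
  qed (use * that in \<open>simp add: exc_def\<close>)
  show "exc x = insert p (exc y)"
  proof (intro equalityI subsetI)
    fix q assume "q \<in> exc x" then show "q \<in> insert p (exc y)" using **[of q] by auto
  next
    fix q assume "q \<in> insert p (exc y)"
    then show "q \<in> exc x" using **[of q] p(1) by (cases "q = p") (auto simp: exc_def)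
  qed
  show "\<And>q. q \<in> exc y \<Longrightarrow> y q = x q"
    using * r yp by (metis exc_def mem_Collect_eq nat_less_le)
qed

lemma permutes_transpose_comp:
  assumes "x permutes S" "p \<in> S" "q \<in> S"
  shows "transpose p q \<circ> x permutes S"
  using assms by (intro permutes_compose permutes_swap_id)

text \<open>Peeling the least moved point costs one letter and one ascent. With the lower bound from
  the cycle count, the reflection length of a noncrossing permutation is its number of
  ascents.\<close>

lemma nc_perm_word_exists:
  assumes "nc_perm x" "x permutes {1..n+1}"
  shows "\<exists>ts. set ts \<subseteq> transpositions n \<and> word_prod ts = x \<and> length ts = card (exc x)"
  using assms
proof (induct "card (exc x)" arbitrary: x rule: less_induct)
  case less
  show ?case
  proof (cases "x = id")
    case True
    then show ?thesis by (intro exI[of _ "[]"]) (simp add: exc_def word_prod_Nil)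
  next
    case False
    then obtain p where p: "p < x p" "\<And>q. q < p \<Longrightarrow> x q = q"
      using exists_least_moved nc_permD(1)[OF less(2)] bij_is_inj by metis
    define y where "y = transpose p (x p) \<circ> x"
    note pl = nc_perm_peel[OF less(2) p, folded y_def]
    have pin: "p \<in> {1..n+1}" "x p \<in> {1..n+1}"
      using permutes_exc_subset[OF less(3)] p(1) by (auto simp: exc_def)
    have per: "y permutes {1..n+1}" unfolding y_def using permutes_transpose_comp[OF less(3) pin] .
    have c: "card (exc x) = Suc (card (exc y))"
      using pl(4,5) finite_exc[OF per] by simp
    with less(1)[of y] pl(1) per obtain ts where
      ts: "set ts \<subseteq> transpositions n" "word_prod ts = y" "length ts = card (exc y)" by auto
    have "transpose p (x p) \<circ> y = x" by (simp add: y_def fun_eq_iff)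
    then show ?thesis using ts c pin p(1)
      by (intro exI[of _ "transpose p (x p) # ts"]) (simp add: transpositionsI word_prod_Cons)
  qed
qed

lemma len_T_nc_perm:
  assumes "nc_perm x" "x permutes {1..n+1}"
  shows "len_T n x = card (exc x)"
proof -
  obtain ts where ts: "set ts \<subseteq> transpositions n" "word_prod ts = x" "length ts = card (exc x)"
    using nc_perm_word_exists[OF assms] by blast
  obtain us where "us \<in> reduced_words (transpositions n) x"
    using reduced_word_exists[OF ts(1,2)] by blast
  then have us: "set us \<subseteq> transpositions n" "word_prod us = x" "length us = len_T n x"
    unfolding reduced_words_def by auto
  show ?thesis
    using word_length_le[OF ts(1)] ts us card_exc_le_length[OF us(1)] by auto
qed

text \<open>A reduced word leaves no slack in the cycle count, so its first letter must split a
  cycle of \<open>x\<close> rather than join two; the remainder is then noncrossing again.\<close>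

lemma nc_perm_word_tail:
  assumes x: "nc_perm x" "x permutes {1..n+1}" and ab: "a < b" "a \<in> {1..n+1}" "b \<in> {1..n+1}"
    and ts: "set ts \<subseteq> transpositions n" "transpose a b \<circ> word_prod ts = x" "Suc (length ts) = card (exc x)"
  shows "b \<in> cycle_of x a" "nc_perm (word_prod ts)" "card (exc (word_prod ts)) = length ts"
proof -
  let ?y = "word_prod ts"
  have y: "transpose a b \<circ> x = ?y" unfolding ts(2)[symmetric] by (simp add: fun_eq_iff)
  show cyc: "b \<in> cycle_of x a"
  proof (rule ccontr)
    assume "b \<notin> cycle_of x a"
    then have "card (cycles_on {1..n+1} ?y) \<le> card (cycles_on {1..n+1} x)"
      using card_cycles_on_transpose(2)[of "{1..n+1}" a b x] ab y by simp
    with length_add_card_cycles_ge[OF ts(1)] card_cycles_add_exc_le[OF x(2)] ts(3)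
    show False by simp
  qed
  show nc: "nc_perm ?y" using nc_perm_split[OF x(1) cyc ab(1)] y by simp
  obtain us where us: "set us \<subseteq> transpositions n" "word_prod us = ?y" "length us = card (exc ?y)"
    using nc_perm_word_exists[OF nc permutes_word_prod_transpositions[OF ts(1)]] by blast
  have "set (transpose a b # us) \<subseteq> transpositions n" "word_prod (transpose a b # us) = x"
    using us transpositionsI[OF ab] ts(2) by (simp_all add: word_prod_Cons)
  from card_exc_le_length[OF this(1)] this(2) us(3) ts(3) have "length ts \<le> card (exc ?y)" by simp
  with card_exc_le_length[OF ts(1)] show "card (exc ?y) = length ts" by simp
qed

lemma nc_perm_word_suffix:
  assumes "nc_perm (word_prod (us @ vs))" "set (us @ vs) \<subseteq> transpositions n"
    "length (us @ vs) = card (exc (word_prod (us @ vs)))"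
  shows "nc_perm (word_prod vs)"
  using assms
proof (induct us)
  case (Cons u us)
  then have "u \<in> transpositions n" by simp
  then obtain a b where ab: "a < b" "a \<in> {1..n+1}" "b \<in> {1..n+1}" "u = transpose a b"
    by (rule transpositionsE)
  have per: "word_prod ((u # us) @ vs) permutes {1..n+1}"
    using Cons(3) by (intro permutes_word_prod_transpositions)
  have eq: "transpose a b \<circ> word_prod (us @ vs) = word_prod ((u # us) @ vs)"
    unfolding append_Cons word_prod_Cons ab(4) ..
  have T: "set (us @ vs) \<subseteq> transpositions n" using Cons(3) by simp
  have "Suc (length (us @ vs)) = card (exc (word_prod ((u # us) @ vs)))"
    using Cons(4) by (simp only: append_Cons length_Cons)
  note tail = nc_perm_word_tail(2,3)[OF Cons(2) per ab(1-3) T eq this]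
  show ?case by (rule Cons(1)[OF tail(1) T tail(2)[symmetric]])
qed simp

section \<open>The Coxeter element and the Kreweras complement\<close>

lemma coxeter_elt_apply:
  "coxeter_elt n p = (if p \<in> {1..n} then p + 1 else if p = n + 1 then 1 else p)"
proof (induct n arbitrary: p)
  case 0
  then show ?case by (simp add: coxeter_elt_def)
next
  case (Suc n)
  have "coxeter_elt (Suc n) = coxeter_elt n \<circ> simple_refl (Suc n)"
    by (simp add: coxeter_elt_def fun_eq_iff)
  then show ?case using Suc by (auto simp: simple_refl_def transpose_def)
qed

lemma permutes_coxeter_elt: "coxeter_elt n permutes {1..n+1}"
proof (induct n)
  case (Suc n)
  have "coxeter_elt (Suc n) = coxeter_elt n \<circ> simple_refl (Suc n)"
    by (simp add: coxeter_elt_def fun_eq_iff)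
  moreover have "coxeter_elt n permutes {1..Suc n+1}"
    using Suc by (rule permutes_subset) auto
  moreover have "simple_refl (Suc n) permutes {1..Suc n+1}"
    unfolding simple_refl_def by (rule permutes_swap_id) auto
  ultimately show ?case by (metis permutes_compose)
next
  case 0
  have "coxeter_elt 0 = id" unfolding coxeter_elt_def by (simp add: word_prod_Nil)
  then show ?case by (simp only: permutes_id)
qed

lemma exc_coxeter_elt: "exc (coxeter_elt n) = {1..n}"
  by (auto simp: exc_def coxeter_elt_apply split: if_splits)

lemma nc_perm_coxeter_elt: "nc_perm (coxeter_elt n)"
  unfolding nc_perm_def
proof (intro conjI allI impI)
  have inj: "inj (coxeter_elt n)" using permutes_coxeter_elt permutes_inj by blast
  show "bij (coxeter_elt n)" using permutes_coxeter_elt permutes_bij by blast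
  show "stable_set (coxeter_elt n) {p<..<coxeter_elt n p}" if "p < coxeter_elt n p" for p
    using that by (intro stable_setI[OF inj]) (auto simp: coxeter_elt_apply split: if_splits)
  show "stable_set (coxeter_elt n) {coxeter_elt n p..p}" if "coxeter_elt n p < p" for p
    using that by (intro stable_setI[OF inj]) (auto simp: coxeter_elt_apply split: if_splits)
qed

text \<open>A form of the Kreweras complement; it swaps the two conditions in the definition of \<open>nc_perm\<close>.\<close>

lemma nc_perm_coxeter_comp_inv:
  assumes y: "nc_perm y" "y permutes {1..n+1}"
  shows "nc_perm (coxeter_elt n \<circ> perm_inv y)"
proof -
  let ?x = "coxeter_elt n \<circ> perm_inv y"
  have per: "?x permutes {1..n+1}"
    using permutes_compose[OF permutes_inv[OF y(2)] permutes_coxeter_elt] .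
  then have inj: "inj ?x" by (rule permutes_inj)
  note [simp] = permutes_inverses[OF y(2)]
  have mem: "perm_inv y r \<in> S \<longleftrightarrow> r \<in> S" if "stable_set y S" for r S
    using stable_setD[OF that, of "perm_inv y r"] by simp
  have range: "p \<in> {1..n+1}" "?x p \<in> {1..n+1}" "perm_inv y p \<in> {1..n+1}" if "?x p \<noteq> p" for p
  proof -
    show p: "p \<in> {1..n+1}" using that permutes_not_in[OF per] by blast
    then show "?x p \<in> {1..n+1}" using permutes_in_image[OF per] by blast
    show "perm_inv y p \<in> {1..n+1}" using p permutes_in_image[OF permutes_inv[OF y(2)]] by blast
  qed
  have "stable_set ?x {p<..<?x p}" if p: "p < ?x p" for p
  proof -
    define q where "q = perm_inv y p"
    have yq: "y q = p" by (simp add: q_def)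
    have q: "q \<in> {1..n+1}" using range(3) p q_def by auto
    have qn: "q \<in> {1..n}" "?x p = q + 1"
      using p q range(1)[of p] by (auto simp: coxeter_elt_apply q_def split: if_splits)
    show ?thesis
    proof (cases "q = p")
      case True then have "{p<..<?x p} = {}" using qn by auto
      then show ?thesis by (simp only: stable_set_empty)
    next
      case False
      then have st: "stable_set y {p..q}" using nc_permD(3)[OF y(1), of q] yq p qn by auto
      show ?thesis
      proof (rule stable_setI[OF inj])
        fix r assume "r \<in> {p<..<?x p}"
        then have r: "p < r" "r \<le> q" using qn by auto
        then have "perm_inv y r \<in> {p..q}" using mem[OF st] by auto
        moreover have "perm_inv y r \<noteq> q" using yq r by (metis permutes_inverses(1)[OF y(2)] less_irrefl)
        ultimately show "?x r \<in> {p<..<?x p}" using qn range(1)[of p] p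
          by (auto simp: coxeter_elt_apply)
      qed simp
    qed
  qed
  moreover have "stable_set ?x {?x p..p}" if p: "?x p < p" for p
  proof -
    define q where "q = perm_inv y p"
    have yq: "y q = p" by (simp add: q_def)
    have q: "q \<in> {1..n+1}" using range(3) p q_def by auto
    have rg: "p \<in> {1..n+1}" using range(1) p by auto
    show ?thesis
    proof (cases "q = n + 1")
      \<comment> \<open>The Coxeter element wraps \<open>n + 1\<close> round to 1, so the interval
        to be preserved is \<open>{1..p}\<close>. As \<open>y\<close> sends \<open>n + 1\<close> to
        \<open>p\<close>, this follows from stability of the upper interval \<open>{p..n+1}\<close>,
        or directly if \<open>p = n + 1\<close>.\<close>
      case True
      then have x1: "?x p = 1" by (simp add: coxeter_elt_apply flip: q_def)
      have st: "stable_set y {p..n+1}" if "p \<noteq> n + 1"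
        using nc_permD(3)[OF y(1), of q] yq True that rg by auto
      show ?thesis
      proof (rule stable_setI[OF inj])
        fix r assume "r \<in> {?x p..p}"
        then have r: "1 \<le> r" "r \<le> p" using x1 by auto
        show "?x r \<in> {?x p..p}"
        proof (cases "r = p")
          case False
          have rr: "perm_inv y r \<in> {1..n+1}" using r rg permutes_in_image[OF permutes_inv[OF y(2)]] by auto
          have "perm_inv y r < p"
          proof (cases "p = n + 1")
            case True
            have "perm_inv y r \<noteq> n + 1" using yq \<open>q = n + 1\<close> False by (metis permutes_inverses(1)[OF y(2)])
            with rr True show ?thesis by auto
          next
            case p: False
            from mem[OF st[OF p], of r] r False rg have "perm_inv y r \<notin> {p..n+1}" by auto
            with rr show ?thesis by auto
          qed
          then show ?thesis using x1 rr rg by (auto simp: coxeter_elt_apply)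
        qed (use p in auto)
      qed simp
    next
      case False
      then have xp: "?x p = q + 1" using q by (simp add: coxeter_elt_apply flip: q_def)
      then have "q < p" using p by simp
      then have st: "stable_set y {q<..<p}" using nc_permD(2)[OF y(1), of q] yq by simp
      show ?thesis
      proof (rule stable_setI[OF inj])
        fix r assume "r \<in> {?x p..p}"
        then have r: "q < r" "r \<le> p" using xp by auto
        show "?x r \<in> {?x p..p}"
        proof (cases "r = p")
          case False
          then have "perm_inv y r \<in> {q<..<p}" using mem[OF st] r by auto
          then show ?thesis using xp rg by (auto simp: coxeter_elt_apply)
        qed (use p in auto)
      qed simp
    qed
  qed
  ultimately show ?thesis unfolding nc_perm_def using permutes_bij[OF per] by blast
qed

text \<open>Reduced words of \<open>x\<close> and of its complement \<open>x^-1 c\<close>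
  concatenate to a reduced word of \<open>c\<close>. The suffix is noncrossing because
  \<open>c\<close> is, and the other complement \<open>c y^-1\<close> of \<open>y = x^-1 c\<close>
  is \<open>x\<close> again.\<close>

lemma noncrossing_imp_nc_perm:
  assumes "x \<in> noncrossing n"
  shows "nc_perm x" "x permutes {1..n+1}"
proof -
  let ?c = "coxeter_elt n"
  show x: "x permutes {1..n+1}" using assms unfolding noncrossing_def Wgrp_iff by blast
  let ?y = "perm_inv x \<circ> ?c"
  have len: "len_T n x + len_T n ?y = len_T n ?c"
    using assms unfolding noncrossing_def abs_le_def by blast
  have y: "?y permutes {1..n+1}"
    using permutes_compose[OF permutes_coxeter_elt permutes_inv[OF x]] .
  obtain us where us: "set us \<subseteq> transpositions n" "word_prod us = x" "length us = len_T n x"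
    using transposition_word_exists[OF x] reduced_word_exists unfolding reduced_words_def by blast
  obtain vs where vs: "set vs \<subseteq> transpositions n" "word_prod vs = ?y" "length vs = len_T n ?y"
    using transposition_word_exists[OF y] reduced_word_exists unfolding reduced_words_def by blast
  have c: "word_prod (us @ vs) = ?c"
    using us vs by (simp add: fun_eq_iff permutes_inverses[OF x])
  have "nc_perm (word_prod vs)"
  proof (rule nc_perm_word_suffix)
    show "nc_perm (word_prod (us @ vs))" using c nc_perm_coxeter_elt by metis
    show "set (us @ vs) \<subseteq> transpositions n" using us vs by simp
    show "length (us @ vs) = card (exc (word_prod (us @ vs)))"
      using us vs len c len_T_nc_perm[OF nc_perm_coxeter_elt permutes_coxeter_elt] by simp
  qed
  then have "nc_perm ?y" using vs by simp
  from nc_perm_coxeter_comp_inv[OF this y] have "nc_perm (?c \<circ> perm_inv ?y)" .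
  moreover have "?c \<circ> perm_inv ?y = x"
    using permutes_bij[OF x] permutes_bij[OF permutes_coxeter_elt] permutes_inverses[OF permutes_coxeter_elt[of n]]
    by (subst o_inv_distrib) (auto simp: bij_imp_bij_inv inv_inv_eq fun_eq_iff)
  ultimately show "nc_perm x" by simp
qed

text \<open>Bounds the ascents of the complement by \<open>n - card (exc x)\<close>, hence its
  reflection length from above.\<close>

lemma exc_coxeter_comp_inv:
  assumes x: "x permutes {1..n+1}"
  shows "exc (coxeter_elt n \<circ> perm_inv x) \<subseteq> x ` ({1..n} - exc x)"
proof
  fix p assume "p \<in> exc (coxeter_elt n \<circ> perm_inv x)"
  then have p: "p < coxeter_elt n (perm_inv x p)" by (simp add: exc_def)
  have pq: "x (perm_inv x p) = p" using permutes_inverses[OF x] by simp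
  have "perm_inv x p \<in> {1..n+1}"
  proof (rule ccontr)
    assume *: "perm_inv x p \<notin> {1..n+1}"
    then have "x (perm_inv x p) = perm_inv x p" using permutes_not_in[OF x] by blast
    then show False using p pq * by (auto simp: coxeter_elt_apply split: if_splits)
  qed
  moreover have "p \<noteq> 0"
    using permutes_in_image[OF x, of "perm_inv x p"] \<open>perm_inv x p \<in> {1..n+1}\<close> pq by auto
  ultimately have "perm_inv x p \<in> {1..n}" "\<not> perm_inv x p < p"
    using p by (auto simp: coxeter_elt_apply split: if_splits)
  then have "perm_inv x p \<in> {1..n} - exc x" using pq by (simp add: exc_def)
  then show "p \<in> x ` ({1..n} - exc x)" using pq by (metis imageI)
qed

text \<open>The element \<open>x^-1 c\<close> is conjugate under \<open>x\<close> to
  \<open>c x^-1\<close>, whose reduced words have one letter per ascent. Conjugating such a word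
  letter by letter bounds the length of \<open>x^-1 c\<close> by \<open>n - card (exc x)\<close>;
  the opposite inequality holds because \<open>c\<close> has \<open>n\<close> ascents.\<close>

lemma nc_perm_imp_noncrossing:
  assumes x: "nc_perm x" "x permutes {1..n+1}"
  shows "x \<in> noncrossing n"
proof -
  let ?c = "coxeter_elt n"
  let ?z = "?c \<circ> perm_inv x" and ?y = "perm_inv x \<circ> ?c"
  have zp: "?z permutes {1..n+1}"
    using permutes_compose[OF permutes_inv[OF x(2)] permutes_coxeter_elt] .
  have y: "?y permutes {1..n+1}"
    using permutes_compose[OF permutes_coxeter_elt permutes_inv[OF x(2)]] .
  obtain ws where ws: "set ws \<subseteq> transpositions n" "word_prod ws = ?z" "length ws = card (exc ?z)"
    using nc_perm_word_exists[OF nc_perm_coxeter_comp_inv[OF x] zp] by blast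
  define vs where "vs = map (\<lambda>t. perm_inv x \<circ> t \<circ> x) ws"
  have vsT: "set vs \<subseteq> transpositions n"
  proof
    fix v assume "v \<in> set vs"
    then obtain t where t: "t \<in> set ws" "v = perm_inv x \<circ> t \<circ> x" by (auto simp: vs_def)
    then have "t \<in> transpositions n" using ws(1) by blast
    then obtain a b where ab: "a < b" "a \<in> {1..n+1}" "b \<in> {1..n+1}" "t = transpose a b"
      by (rule transpositionsE)
    have "v = transpose (perm_inv x a) (perm_inv x b)"
      using transpose_comp_eq[OF permutes_bij[OF x(2)], of a b] t(2) ab(4)
      by (simp add: comp_assoc permutes_inverses[OF x(2)] fun_eq_iff)
    moreover have "perm_inv x a \<noteq> perm_inv x b" using ab(1) permutes_inverses(1)[OF x(2)] by (metis less_irrefl)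
    moreover have "perm_inv x a \<in> {1..n+1}" "perm_inv x b \<in> {1..n+1}"
      using ab permutes_in_image[OF permutes_inv[OF x(2)]] by blast+
    ultimately show "v \<in> transpositions n" unfolding transpositions_def by blast
  qed
  have "word_prod (map (\<lambda>t. perm_inv x \<circ> t \<circ> x) us) = perm_inv x \<circ> word_prod us \<circ> x" for us
    by (induct us) (auto simp: fun_eq_iff permutes_inverses[OF x(2)])
  then have "word_prod vs = perm_inv x \<circ> ?z \<circ> x" unfolding vs_def ws(2)[symmetric] .
  then have "word_prod vs = ?y" by (simp add: fun_eq_iff permutes_inverses[OF x(2)])
  then have "len_T n ?y \<le> card (exc ?z)"
    using word_length_le[OF vsT] ws(3) vs_def by simp
  also have "card (exc ?z) \<le> card (x ` ({1..n} - exc x))"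
    by (intro card_mono exc_coxeter_comp_inv[OF x(2)]) simp
  also have "\<dots> \<le> card ({1..n} - exc x)" by (rule card_image_le) simp
  also have sub: "exc x \<subseteq> {1..n}"
  proof
    fix p assume "p \<in> exc x"
    then show "p \<in> {1..n}"
      using permutes_exc_subset[OF x(2)] by (force simp: exc_def)
  qed
  then have "card ({1..n} - exc x) = n - card (exc x)"
    using card_Diff_subset[OF finite_exc[OF x(2)] sub] by simp
  finally have up: "len_T n ?y \<le> n - card (exc x)" .
  have len: "len_T n x = card (exc x)" using len_T_nc_perm[OF x] .
  have cn: "card (exc x) \<le> n" using card_mono[OF _ sub] by simp
  obtain us where us: "set us \<subseteq> transpositions n" "word_prod us = x" "length us = len_T n x"
    using transposition_word_exists[OF x(2)] reduced_word_exists unfolding reduced_words_def by blast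
  obtain ys where ys: "set ys \<subseteq> transpositions n" "word_prod ys = ?y" "length ys = len_T n ?y"
    using transposition_word_exists[OF y] reduced_word_exists unfolding reduced_words_def by blast
  have c: "word_prod (us @ ys) = ?c"
    using us ys by (simp add: fun_eq_iff permutes_inverses[OF x(2)])
  have n: "len_T n ?c = n"
    using len_T_nc_perm[OF nc_perm_coxeter_elt permutes_coxeter_elt] exc_coxeter_elt by simp
  have "set (us @ ys) \<subseteq> transpositions n" using us ys by simp
  from card_exc_le_length[OF this] c have "n \<le> len_T n x + len_T n ?y"
    using exc_coxeter_elt us ys by simp
  then show ?thesis
    using up len cn n x(2) unfolding noncrossing_def abs_le_def Wgrp_iff by simp
qed

section \<open>Noncrossing permutations are determined by their ascents and ascent values\<close>

text \<open>Ascents are opening brackets and their images closing ones. The points strictly between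
  \<open>p\<close> and \<open>x p\<close> are permuted among themselves, so \<open>x p\<close> is
  the first place after \<open>p\<close> where the closings catch up with the openings.\<close>

lemma nc_perm_matching_count:
  assumes x: "nc_perm x" and p: "p \<in> exc x"
  shows "card (exc x \<inter> {p..<x p}) = card (x ` exc x \<inter> {p<..x p})"
    and "p < u \<Longrightarrow> u < x p \<Longrightarrow> card (exc x \<inter> {p..<u}) \<noteq> card (x ` exc x \<inter> {p<..u})"
proof -
  have inj: "inj x" using nc_permD(1)[OF x] bij_is_inj by blast
  have px: "p < x p" using p by (simp add: exc_def)
  have st: "stable_set x {p<..<x p}" using nc_permD(2)[OF x px] .
  have sub: "x ` exc x \<inter> {p<..u} \<subseteq> x ` (exc x \<inter> {p<..<u})" if "u < x p" for u
  proof
    fix r assume r: "r \<in> x ` exc x \<inter> {p<..u}"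
    then obtain q where q: "q < x q" "r = x q" by (auto simp: exc_def)
    then have "q \<in> {p<..<x p}" using stable_setD[OF st, of q] r that by auto
    then show "r \<in> x ` (exc x \<inter> {p<..<u})" using q r by (auto simp: exc_def)
  qed
  have less: "card (x ` exc x \<inter> {p<..u}) < card (exc x \<inter> {p..<u})" if "p < u" "u < x p" for u
  proof -
    have "card (x ` exc x \<inter> {p<..u}) \<le> card (x ` (exc x \<inter> {p<..<u}))"
      by (rule card_mono[OF _ sub[OF that(2)]]) simp
    also have "\<dots> \<le> card (exc x \<inter> {p<..<u})" by (rule card_image_le) simp
    also have "\<dots> < card (exc x \<inter> {p..<u})"
      using p that by (intro psubset_card_mono) auto
    finally show ?thesis .
  qed
  then show "p < u \<Longrightarrow> u < x p \<Longrightarrow> card (exc x \<inter> {p..<u}) \<noteq> card (x ` exc x \<inter> {p<..u})"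
    by (metis less_irrefl)
  have "x ` (exc x \<inter> {p..<x p}) = x ` exc x \<inter> {p<..x p}"
  proof (intro equalityI subsetI)
    fix r assume "r \<in> x ` (exc x \<inter> {p..<x p})"
    then obtain q where q: "q < x q" "p \<le> q" "q < x p" "r = x q" by (auto simp: exc_def)
    then show "r \<in> x ` exc x \<inter> {p<..x p}"
      using stable_setD[OF st, of q] by (cases "q = p") (auto simp: exc_def)
  next
    fix r assume "r \<in> x ` exc x \<inter> {p<..x p}"
    then obtain q where q: "q < x q" "p < x q" "x q \<le> x p" "r = x q" by (auto simp: exc_def)
    then show "r \<in> x ` (exc x \<inter> {p..<x p})"
      using stable_setD[OF st, of q] injD[OF inj, of q p] px
      by (cases "q = p") (auto simp: exc_def)
  qed
  then show "card (exc x \<inter> {p..<x p}) = card (x ` exc x \<inter> {p<..x p})"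
    using card_image[of x "exc x \<inter> {p..<x p}"] inj by (metis inj_on_subset subset_UNIV)
qed

lemma nc_perm_eq_on_exc:
  assumes x: "nc_perm x" and y: "nc_perm y" and D: "exc x = exc y" and U: "x ` exc x = y ` exc y"
    and p: "p \<in> exc x"
  shows "x p = y p"
proof (rule ccontr)
  have 1: "p < x p" "p < y p" using p D by (auto simp: exc_def)
  assume "x p \<noteq> y p"
  then consider "x p < y p" | "y p < x p" by linarith
  then show False
  proof cases
    case 1
    then show False
      using nc_perm_matching_count(1)[OF x p] nc_perm_matching_count(2)[OF y, of p "x p"] p D U
      by (auto simp: exc_def)
  next
    case 2
    then show False
      using nc_perm_matching_count(2)[OF x p, of "y p"] nc_perm_matching_count(1)[OF y, of p] p D U
      by (auto simp: exc_def)
  qed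
qed

text \<open>If \<open>x p < y p\<close>, some point of \<open>{x p..<y p}\<close> leaves this
  interval under \<open>x\<close>. It must leave upwards, so it is an ascent, where \<open>y\<close>
  agrees with \<open>x\<close>; but then \<open>y\<close> carries it from outside into the stable
  interval \<open>{y p..p}\<close>.\<close>

lemma nc_perm_not_exc_ge:
  assumes x: "nc_perm x" and y: "nc_perm y" and eq: "\<And>q. q \<in> exc x \<Longrightarrow> x q = y q"
    and p: "p \<notin> exc x" "p \<notin> exc y"
  shows "y p \<le> x p"
proof (rule ccontr)
  assume "\<not> y p \<le> x p"
  then have lt: "x p < y p" by simp
  have yp: "y p \<le> p" using p by (simp add: exc_def)
  have inj: "inj x" using nc_permD(1)[OF x] bij_is_inj by blast
  have injy: "inj y" using nc_permD(1)[OF y] bij_is_inj by blast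
  have stx: "stable_set x {x p..p}" using nc_permD(3)[OF x, of p] lt yp by simp
  have sty: "stable_set y {y p..p}"
  proof (cases "y p = p")
    case True
    then show ?thesis using stable_set_fixed[OF injy True] by simp
  next
    case False
    then show ?thesis using nc_permD(3)[OF y, of p] yp by simp
  qed
  have "\<exists>q\<in>{x p..<y p}. x q \<notin> {x p..<y p}"
  proof (rule ccontr)
    assume "\<not> ?thesis"
    then have "stable_set x {x p..<y p}" by (intro stable_setI[OF inj]) auto
    from stable_setD[OF this, of p] show False using lt yp by auto
  qed
  then obtain q where q: "x p \<le> q" "q < y p" "x q \<notin> {x p..<y p}" by auto
  then have xq: "x q \<in> {y p..p}" using stable_setD[OF stx, of q] yp by auto
  then have "q \<in> exc x" using q by (auto simp: exc_def)
  then have "y q \<in> {y p..p}" using eq xq by simp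
  then show False using stable_setD[OF sty, of q] q by auto
qed

lemma nc_perm_unique:
  assumes x: "nc_perm x" and y: "nc_perm y" and D: "exc x = exc y" and U: "x ` exc x = y ` exc y"
  shows "x = y"
proof
  fix p
  note e = nc_perm_eq_on_exc[OF x y D U]
  show "x p = y p"
  proof (cases "p \<in> exc x")
    case False
    then show ?thesis
      using nc_perm_not_exc_ge[OF x y, of p] nc_perm_not_exc_ge[OF y x, of p] e D by force
  qed (rule e)
qed

section \<open>Polygons and their vertex sets\<close>

lemma orbit_eq_cycle_of:
  assumes "x permutes {1..n+1}"
  shows "orbit x i = cycle_of x i"
proof
  show sub: "orbit x i \<subseteq> cycle_of x i"
  proof
    fix q assume "q \<in> orbit x i"
    then show "q \<in> cycle_of x i"
      by induct (use cycle_of_apply stable_setD[OF stable_cycle_of] in \<open>auto\<close>)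
  qed
  have self: "i \<in> orbit x i"
    by (rule permutation_self_in_orbit[OF permutes_imp_permutation[OF _ assms]]) simp
  have "finite (cycle_of x i)"
  proof (cases "i \<in> {1..n+1}")
    case True
    have "stable_set x {1..n+1}" unfolding stable_set_def using permutes_in_image[OF assms] by blast
    from cycle_of_subset[OF this True] show ?thesis using finite_subset by blast
  next
    case False
    then have "stable_set x {i}"
      using permutes_not_in[OF assms] permutes_inj[OF assms] by (intro stable_set_fixed) auto
    from cycle_of_subset[OF this, of i] show ?thesis using finite_subset by auto
  qed
  then have "finite (orbit x i)" using sub finite_subset by blast
  then have "stable_set x (orbit x i)"
    by (intro stable_setI permutes_inj[OF assms]) (auto intro: orbit.step)
  then show "cycle_of x i \<subseteq> orbit x i" using self cycle_of_subset by blast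
qed

text \<open>A descent from \<open>p\<close> to \<open>x p\<close> makes \<open>{x p..p}\<close>
  stable, so this interval contains the whole cycle. Each polygon therefore has exactly one descent,
  from its terminal to its initial vertex.\<close>

lemma polygon_extrema:
  assumes x: "nc_perm x" "x permutes {1..n+1}"
  shows "Max ` polygons x = {p. x p < p}" "Min ` polygons x = x ` {p. x p < p}"
    "Vert x = {p. x p \<noteq> p}"
proof -
  have orb: "polygons x = cycle_of x ` {p. x p \<noteq> p}"
    using orbit_eq_cycle_of[OF x(2)] by (auto simp: polygons_def)
  have inj: "inj x" using permutes_inj[OF x(2)] .
  have moved: "x q \<noteq> q" if "q \<in> cycle_of x i" "x i \<noteq> i" for q i
  proof
    assume "x q = q"
    then have "stable_set x {q}" using stable_set_fixed[OF inj] by simp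
    from cycle_of_cong[OF that(1) this] show False using that \<open>x q = q\<close> by auto
  qed
  have ext: "Max (cycle_of x i) = p \<and> Min (cycle_of x i) = x p"
    if "p \<in> cycle_of x i" "x p < p" for p i
  proof -
    have st: "stable_set x {x p..p}" using nc_permD(3)[OF x(1) that(2)] .
    then have sub: "cycle_of x i \<subseteq> {x p..p}"
      using cycle_of_cong[OF that(1) st] that(2) by (intro cycle_of_subset[OF st]) simp
    then have "finite (cycle_of x i)" using finite_subset by blast
    moreover have "x p \<in> cycle_of x i" using that(1) stable_setD[OF stable_cycle_of] by blast
    ultimately show ?thesis using that(1) sub by (auto intro!: Max_eqI Min_eqI)
  qed
  have ex: "\<exists>p\<in>cycle_of x i. x p < p" if "x i \<noteq> i" for i
  proof -
    have "i \<in> {1..n+1}" using that permutes_not_in[OF x(2)] by blast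
    moreover have "stable_set x {1..n+1}" unfolding stable_set_def using permutes_in_image[OF x(2)] by blast
    ultimately have fin: "finite (cycle_of x i)" using cycle_of_subset finite_subset by (metis finite_atLeastAtMost)
    have M: "Max (cycle_of x i) \<in> cycle_of x i" using fin cycle_of_self by (intro Max_in) auto
    then have "x (Max (cycle_of x i)) \<le> Max (cycle_of x i)"
      using stable_setD[OF stable_cycle_of] fin by simp
    moreover have "x (Max (cycle_of x i)) \<noteq> Max (cycle_of x i)" using moved[OF M that] .
    ultimately show ?thesis using M by (metis order_le_less)
  qed
  show "Vert x = {p. x p \<noteq> p}"
    unfolding Vert_def orb using moved cycle_of_self by blast
  show "Max ` polygons x = {p. x p < p}"
  proof (intro equalityI subsetI)
    fix p assume "p \<in> Max ` polygons x"
    then obtain i where i: "x i \<noteq> i" "p = Max (cycle_of x i)" unfolding orb by auto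
    then show "p \<in> {p. x p < p}" using ex[OF i(1)] ext by auto
  next
    fix p assume p: "p \<in> {p. x p < p}"
    then have "p = Max (cycle_of x p)" using ext[of p p] cycle_of_self by simp
    then show "p \<in> Max ` polygons x" using p unfolding orb by auto
  qed
  show "Min ` polygons x = x ` {p. x p < p}"
  proof (intro equalityI subsetI)
    fix m assume "m \<in> Min ` polygons x"
    then obtain i where i: "x i \<noteq> i" "m = Min (cycle_of x i)" unfolding orb by auto
    then show "m \<in> x ` {p. x p < p}" using ex[OF i(1)] ext by auto
  next
    fix m assume "m \<in> x ` {p. x p < p}"
    then obtain p where p: "x p < p" "m = x p" by auto
    then have "m = Min (cycle_of x p)" using ext[of p p] cycle_of_self by simp
    then show "m \<in> Min ` polygons x" using p unfolding orb by auto
  qed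
qed

lemma D_vert_nc_perm:
  assumes x: "nc_perm x" "x permutes {1..n+1}"
  shows "D_vert x = exc x"
  unfolding D_vert_def polygon_extrema[OF x] by (auto simp: exc_def)

lemma U_vert_nc_perm:
  assumes x: "nc_perm x" "x permutes {1..n+1}"
  shows "U_vert x = x ` exc x"
proof -
  have "inj x" "surj x" using permutes_inj[OF x(2)] permutes_surj[OF x(2)] by auto
  then have "x (x q) = x q \<longleftrightarrow> x q = q" for q by (auto dest: injD)
  moreover have "\<exists>q. r = x q" for r using \<open>surj x\<close> by (metis surjD)
  ultimately have "{p. x p \<noteq> p} = x ` {p. x p \<noteq> p}" by (auto simp: image_iff) metis
  then have "U_vert x = x ` {p. x p \<noteq> p} - x ` {p. x p < p}"
    unfolding U_vert_def polygon_extrema[OF x] by simp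
  also have "\<dots> = x ` ({p. x p \<noteq> p} - {p. x p < p})" using \<open>inj x\<close> by (simp add: image_set_diff)
  also have "{p. x p \<noteq> p} - {p. x p < p} = exc x" by (auto simp: exc_def)
  finally show ?thesis .
qed

section \<open>Inserting and cutting off vertices\<close>

text \<open>The edge from \<open>p\<close> to \<open>x p\<close> is replaced by two edges through
  the fixed point \<open>i\<close>. As \<open>i\<close> is next to an end of this edge, an interval
  spanned by another point and its image contains \<open>p\<close> exactly if it contains
  \<open>i\<close>, so it stays stable.\<close>

lemma nc_perm_insert:
  assumes x: "nc_perm x" and i: "p < i" "i < x p" "x i = i" and adj: "i = Suc p \<or> x p = Suc i"
  defines "y \<equiv> transpose i (x p) \<circ> x"
  shows "nc_perm y" "exc y = insert i (exc x)" "y ` exc y = insert i (x ` exc x)"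
proof -
  define u where "u = x p"
  have inj: "inj x" using nc_permD(1)[OF x] bij_is_inj by blast
  have y: "y = transpose i u \<circ> x" by (simp add: y_def u_def)
  have yp: "y p = i" "y i = u" using i by (simp_all add: y u_def transpose_def)
  have yq: "y q = x q" if "q \<noteq> p" "q \<noteq> i" for q
    using that injD[OF inj, of q p] injD[OF inj, of q i] i by (auto simp: y u_def transpose_def)
  have st: "stable_set y S" if "stable_set x S" "p \<in> S \<longleftrightarrow> i \<in> S" for S
    using transpose_mem_iff[of i S u] stable_setD[OF that(1)] that(2) unfolding y stable_set_def u_def
    by simp
  have sti: "stable_set y ({p<..<u} - {i})"
  proof -
    have "stable_set x ({p<..<u} - {i})"
      using nc_permD(2)[OF x, of p] i stable_set_fixed[OF inj i(3)] by (auto intro: stable_set_Diff simp: u_def)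
    then show ?thesis by (rule st) auto
  qed
  have mid: "{p<..<i} = {} \<and> {i<..<u} = {p<..<u} - {i} \<or> {i<..<u} = {} \<and> {p<..<i} = {p<..<u} - {i}"
    using adj i by (auto simp: u_def)
  have gap: "p \<in> S \<longleftrightarrow> i \<in> S" if "S = {q<..<x q} \<or> S = {x q..q}" "stable_set x S" "q \<noteq> p" "q \<noteq> i" for S q
  proof -
    have pu: "p \<in> S \<longleftrightarrow> u \<in> S" using stable_setD[OF that(2), of p] by (simp add: u_def)
    have ne: "x q \<noteq> i" "x q \<noteq> u" using injD[OF inj, of q i] injD[OF inj, of q p] that i by (auto simp: u_def)
    from adj show ?thesis
    proof
      assume "i = Suc p" then show ?thesis using that ne by auto
    next
      assume "x p = Suc i" then have "u = Suc i" by (simp add: u_def)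
      then show ?thesis using that ne pu by auto
    qed
  qed
  have bij: "bij y" unfolding y using nc_permD(1)[OF x] by (intro bij_comp) auto
  show "nc_perm y" unfolding nc_perm_def
  proof (intro conjI allI impI bij)
    fix q assume q: "q < y q"
    consider "q = p" | "q = i" | "q \<noteq> p" "q \<noteq> i" by blast
    then show "stable_set y {q<..<y q}"
    proof cases
      case 3
      then have "stable_set x {q<..<x q}" using nc_permD(2)[OF x, of q] q yq by simp
      from st[OF this gap[OF _ this 3]] show ?thesis using yq[OF 3] by simp
    qed (use yp mid sti stable_set_empty[of y] in auto)
  next
    fix q assume q: "y q < q"
    then have 3: "q \<noteq> p" "q \<noteq> i" using yp i by (auto simp: u_def)
    then have "stable_set x {x q..q}" using nc_permD(3)[OF x, of q] q yq by simp
    from st[OF this gap[OF _ this 3]] show "stable_set y {y q..q}" using yq[OF 3] by simp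
  qed
  have pe: "p \<in> exc x" using i by (simp add: exc_def)
  have ie: "i \<notin> exc x" using i by (simp add: exc_def)
  show ex: "exc y = insert i (exc x)"
  proof (intro equalityI subsetI)
    fix q assume "q \<in> exc y" then show "q \<in> insert i (exc x)"
      using yq[of q] pe by (cases "q = p"; cases "q = i") (auto simp: exc_def)
  next
    fix q assume "q \<in> insert i (exc x)" then show "q \<in> exc y"
      using yq[of q] yp i by (cases "q = p"; cases "q = i") (auto simp: exc_def u_def)
  qed
  have "exc y = insert i (insert p (exc x - {p}))" using ex pe by auto
  moreover have "y ` (exc x - {p}) = x ` (exc x - {p})"
    using yq ie by (intro image_cong refl) auto
  ultimately have "y ` exc y = insert u (insert i (x ` (exc x - {p})))"
    by (simp only: image_insert yp)
  also have "\<dots> = insert i (x ` insert p (exc x - {p}))" by (auto simp: u_def)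
  finally show "y ` exc y = insert i (x ` exc x)" using pe by (simp add: insert_absorb)
qed

text \<open>The hypothesis \<open>adj\<close> makes \<open>a\<close> an initial vertex: it is
  reached only by the closing step of its polygon. Redirected to \<open>b\<close>, this step still
  does not ascend.\<close>

lemma nc_perm_remove:
  assumes x: "nc_perm x" and ab: "a < b" "x a = b"
    and adj: "\<And>q. x q = a \<Longrightarrow> b \<le> q" 
  defines "y \<equiv> transpose a b \<circ> x"
  shows "nc_perm y" "exc y = exc x - {a}" "y ` exc y = x ` exc x - {b}"
proof -
  have inj: "inj x" using nc_permD(1)[OF x] bij_is_inj by blast
  show "nc_perm y" unfolding y_def
    using nc_perm_split[OF x _ ab(1)] cycle_of_apply[of x a] ab(2) by simp
  have ya: "y a = a" using ab by (simp add: y_def)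
  have yq: "y q = x q" if "q \<noteq> a" "x q \<noteq> a" for q
    using that injD[OF inj, of q a] ab by (auto simp: y_def transpose_def)
  have yr: "y q = b" "b \<le> q" if "x q = a" for q using that adj by (auto simp: y_def)
  show ex: "exc y = exc x - {a}"
  proof (intro equalityI subsetI)
    fix q assume "q \<in> exc y" then show "q \<in> exc x - {a}"
      using yq[of q] yr[of q] ya by (cases "q = a"; cases "x q = a") (auto simp: exc_def)
  next
    fix q assume "q \<in> exc x - {a}" then show "q \<in> exc y"
      using yq[of q] yr[of q] ab by (cases "x q = a") (auto simp: exc_def)
  qed
  have "y ` exc y = x ` (exc x - {a})" unfolding ex
  proof (intro image_cong refl)
    fix q assume "q \<in> exc x - {a}" then show "y q = x q"
      using yq[of q] yr[of q] ab by (cases "x q = a") (auto simp: exc_def)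
  qed
  also have "\<dots> = x ` exc x - {b}" using inj ab by (simp add: image_set_diff)
  finally show "y ` exc y = x ` exc x - {b}" .
qed

text \<open>If \<open>Suc i\<close> is reached from \<open>i\<close>, then \<open>i\<close> is an
  initial vertex and is cut off. Otherwise \<open>i\<close> lies just before the end of the edge
  into \<open>Suc i\<close>; what is nested below this edge is permuted within itself, which forces
  \<open>i\<close> to be fixed, and \<open>i\<close> is inserted on the edge.\<close>

lemma nc_perm_left_toggle:
  assumes x: "nc_perm x" and i: "Suc i \<in> x ` exc x" "i \<notin> x ` exc x"
  defines "y \<equiv> transpose i (Suc i) \<circ> x"
  shows "nc_perm y"
    "i \<notin> exc x \<and> exc y = insert i (exc x) \<and> y ` exc y = insert i (x ` exc x) \<or>
     i \<in> exc x \<and> exc y = exc x - {i} \<and> y ` exc y = x ` exc x - {Suc i}"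
proof -
  obtain p where p: "p < x p" "x p = Suc i" using i by (auto simp: exc_def)
  have ne: "\<not> q < i" if "x q = i" for q using i(2) that by (force simp: exc_def)
  have "nc_perm y \<and> (i \<notin> exc x \<and> exc y = insert i (exc x) \<and> y ` exc y = insert i (x ` exc x) \<or>
     i \<in> exc x \<and> exc y = exc x - {i} \<and> y ` exc y = x ` exc x - {Suc i})"
  proof (cases "p = i")
    case True
    have "Suc i \<le> q" if "x q = i" for q using ne[OF that] that p True by (cases "q = i") auto
    moreover have "i \<in> exc x" using p True by (simp add: exc_def)
    ultimately show ?thesis
      using nc_perm_remove[OF x, of i "Suc i"] p True unfolding y_def by simp
  next
    case False
    then have pi: "p < i" using p by simp
    have "surj x" using nc_permD(1)[OF x] bij_is_surj by blast
    then obtain r where r: "x r = i" by (metis surjD)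
    have "r \<in> {p<..<x p}" using stable_setD[OF nc_permD(2)[OF x p(1)], of r] r pi p by simp
    then have "x i = i" using ne[OF r] r p by (metis Suc_leI greaterThanLessThan_iff le_antisym less_Suc_eq_le not_less)
    from nc_perm_insert[OF x pi _ this] p show ?thesis by (simp add: y_def exc_def \<open>x i = i\<close>)
  qed
  then show "nc_perm y"
    "i \<notin> exc x \<and> exc y = insert i (exc x) \<and> y ` exc y = insert i (x ` exc x) \<or>
     i \<in> exc x \<and> exc y = exc x - {i} \<and> y ` exc y = x ` exc x - {Suc i}" by blast+
qed

text \<open>The mirror image: if \<open>x j = Suc j\<close>, then \<open>Suc j\<close> is a terminal
  vertex and is cut off; otherwise it is a fixed point just after the start of the edge from
  \<open>j\<close> and is inserted there.\<close>

lemma nc_perm_right_toggle: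
  assumes x: "nc_perm x" and j: "j \<in> exc x" "Suc j \<notin> exc x"
  defines "y \<equiv> x \<circ> transpose j (Suc j)"
  shows "nc_perm y"
    "Suc j \<notin> x ` exc x \<and> exc y = insert (Suc j) (exc x) \<and> y ` exc y = insert (Suc j) (x ` exc x) \<or>
     Suc j \<in> x ` exc x \<and> exc y = exc x - {j} \<and> y ` exc y = x ` exc x - {Suc j}"
proof -
  have p: "j < x j" "x (Suc j) \<le> Suc j" using j by (auto simp: exc_def)
  have inj: "inj x" using nc_permD(1)[OF x] bij_is_inj by blast
  \<comment> \<open>Multiplication on the right becomes a transposition of values on the left, the
    form in which splitting and insertion are available.\<close>
  have y: "y = transpose (x j) (x (Suc j)) \<circ> x"
    using inj by (auto simp: y_def fun_eq_iff transpose_def dest: injD)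
  have "nc_perm y \<and> (Suc j \<notin> x ` exc x \<and> exc y = insert (Suc j) (exc x) \<and> y ` exc y = insert (Suc j) (x ` exc x) \<or>
     Suc j \<in> x ` exc x \<and> exc y = exc x - {j} \<and> y ` exc y = x ` exc x - {Suc j})"
  proof (cases "x j = Suc j")
    case True
    have "x (Suc j) \<noteq> Suc j" using injD[OF inj, of j "Suc j"] True by auto
    then have lt: "x (Suc j) < Suc j" using p by simp
    have yq: "y q = x q" if "q \<noteq> j" "q \<noteq> Suc j" for q using that by (simp add: y_def)
    have yj: "y j = x (Suc j)" "y (Suc j) = Suc j" by (simp_all add: y_def True)
    have "Suc j \<in> cycle_of x (x (Suc j))" using cycle_of_apply[of x "Suc j"] cycle_of_sym by metis
    then have nc: "nc_perm y" unfolding y using nc_perm_split[OF x _ lt] True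
      by (simp add: transpose_commute)
    have ex: "exc y = exc x - {j}"
    proof (intro equalityI subsetI)
      fix q assume "q \<in> exc y" then show "q \<in> exc x - {j}"
        using yq[of q] yj lt by (cases "q = j"; cases "q = Suc j") (auto simp: exc_def)
    next
      fix q assume "q \<in> exc x - {j}" then show "q \<in> exc y"
        using yq[of q] yj lt j by (cases "q = Suc j") (auto simp: exc_def)
    qed
    have "y ` exc y = x ` (exc x - {j})" unfolding ex
      using yq j by (intro image_cong refl) auto
    also have "\<dots> = x ` exc x - {Suc j}" using inj True by (simp add: image_set_diff)
    finally show ?thesis using nc ex j True by (metis imageI)
  next
    case False
    then have pj: "j < Suc j" "Suc j < x j" using p by auto
    have "x (Suc j) \<in> {j<..<x j}" using stable_setD[OF nc_permD(2)[OF x p(1)], of "Suc j"] pj by simp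
    then have fx: "x (Suc j) = Suc j" using p by simp
    have "Suc j \<notin> x ` exc x" using fx injD[OF inj, of _ "Suc j"] j by (metis imageE)
    then show ?thesis using nc_perm_insert[OF x pj fx] fx by (simp add: y transpose_commute)
  qed
  then show "nc_perm y" "Suc j \<notin> x ` exc x \<and> exc y = insert (Suc j) (exc x) \<and> y ` exc y = insert (Suc j) (x ` exc x) \<or>
     Suc j \<in> x ` exc x \<and> exc y = exc x - {j} \<and> y ` exc y = x ` exc x - {Suc j}" by blast+
qed

lemma nc_perm_fixed:
  assumes x: "nc_perm x" and q: "q \<notin> exc x" "q \<notin> x ` exc x"
  shows "x q = q"
proof (rule ccontr)
  assume *: "x q \<noteq> q"
  then have lt: "x q < q" using q by (simp add: exc_def)
  have "surj x" using nc_permD(1)[OF x] bij_is_surj by blast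
  then obtain r where r: "x r = q" by (metis surjD)
  then have "q \<le> r" using q by (force simp: exc_def)
  then have "q < r" using * r by (metis order_le_less)
  then have "stable_set x {q..r}" using nc_permD(3)[OF x, of r] r by simp
  from stable_setD[OF this, of q] show False using lt \<open>q < r\<close> by simp
qed

section \<open>Existence for prescribed ascents and ascent values\<close>

text \<open>As \<open>u\<close> is not an ascent value, it is fixed or the initial vertex of its
  polygon. The point \<open>d\<close> becomes the new initial vertex, and the new edge spans nothing
  but fixed points.\<close>

lemma nc_perm_join:
  assumes x: "nc_perm x" and du: "d < u" "\<And>q. d \<le> q \<Longrightarrow> q < u \<Longrightarrow> x q = q" "u \<notin> x ` exc x"
  defines "y \<equiv> transpose d u \<circ> x"
  shows "nc_perm y" "exc y = insert d (exc x)" "y ` exc y = insert u (x ` exc x)"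
proof -
  have inj: "inj x" using nc_permD(1)[OF x] bij_is_inj by blast
  have surj: "surj x" using nc_permD(1)[OF x] bij_is_surj by blast
  obtain r where r: "x r = u" using surj by (metis surjD)
  have ur: "u \<le> r" using r du(3) by (force simp: exc_def)
  have xd: "x d = d" using du by simp
  have yd: "y d = u" "y r = d" using xd r by (simp_all add: y_def)
  have yq: "y q = x q" if "q \<noteq> d" "q \<noteq> r" for q
    using that injD[OF inj, of q d] injD[OF inj, of q r] xd r by (auto simp: y_def transpose_def)
  have st: "stable_set y S" if "stable_set x S" "d \<in> S \<longleftrightarrow> u \<in> S" for S
    using transpose_mem_iff[of d S u] stable_setD[OF that(1)] that(2) unfolding y_def stable_set_def by simp
  have fix_st: "stable_set x S" if "S \<subseteq> {d..<u}" for S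
    using that finite_subset[OF that] du(2) by (intro stable_setI[OF inj]) auto
  have bij: "bij y" unfolding y_def using nc_permD(1)[OF x] by (intro bij_comp) auto
  show "nc_perm y" unfolding nc_perm_def
  proof (intro conjI allI impI bij)
    fix q assume q: "q < y q"
    show "stable_set y {q<..<y q}"
    proof (cases "q = d")
      case True
      have "stable_set y {d<..<u}" by (intro st fix_st) auto
      then show ?thesis using True yd by simp
    next
      case False
      have "q \<noteq> r" using q yd ur du(1) by auto
      then have e: "y q = x q" "x q \<noteq> u" using yq False r injD[OF inj, of q r] by auto
      then have s: "stable_set x {q<..<x q}" using nc_permD(2)[OF x, of q] q by simp
      have "\<not> (d \<le> x q \<and> x q < u)" using du(2)[of "x q"] injD[OF inj, of q "x q"] q e by auto
      moreover have "\<not> (d \<le> q \<and> q < u)" using du(2)[of q] q e by auto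
      ultimately show ?thesis using st[OF s] e du(1) by auto
    qed
  next
    fix q assume q: "y q < q"
    show "stable_set y {y q..q}"
    proof (cases "q = r")
      case True
      have "stable_set x {u..r}"
      proof (cases "u = r")
        case True then show ?thesis using stable_set_fixed[OF inj, of r] r by simp
      next
        case False then show ?thesis using nc_permD(3)[OF x, of r] r ur by simp
      qed
      then have "stable_set x ({d..<u} \<union> {u..r})" using fix_st by (intro stable_set_Un) auto
      moreover have "{d..<u} \<union> {u..r} = {d..r}" using du(1) ur by auto
      ultimately have "stable_set y {d..r}" using du(1) ur by (intro st) auto
      then show ?thesis using True yd by simp
    next
      case False
      have "q \<noteq> d" using q yd du(1) by auto
      then have e: "y q = x q" "x q \<noteq> u" using yq False r injD[OF inj, of q r] by auto
      then have s: "stable_set x {x q..q}" using nc_permD(3)[OF x, of q] q by simp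
      have "\<not> (d \<le> x q \<and> x q < u)" using du(2)[of "x q"] injD[OF inj, of q "x q"] q e by auto
      moreover have "\<not> (d \<le> q \<and> q < u)" using du(2)[of q] q e by auto
      ultimately show ?thesis using st[OF s] e du(1) by auto
    qed
  qed
  have re: "r \<notin> exc x" using r ur by (simp add: exc_def)
  show ex: "exc y = insert d (exc x)"
  proof (intro equalityI subsetI)
    fix q assume "q \<in> exc y" then show "q \<in> insert d (exc x)"
      using yq[of q] yd du(1) ur by (cases "q = d"; cases "q = r") (auto simp: exc_def)
  next
    fix q assume "q \<in> insert d (exc x)" then show "q \<in> exc y"
      using yq[of q] yd du(1) re by (cases "q = d"; cases "q = r") (auto simp: exc_def)
  qed
  have "y ` exc x = x ` exc x"
    using yq re xd by (intro image_cong refl) (metis exc_def less_irrefl mem_Collect_eq)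
  then show "y ` exc y = insert u (x ` exc x)" unfolding ex by (simp add: yd)
qed

lemma nc_perm_exists:
  assumes "D \<subseteq> {1..N}" "U \<subseteq> {1..N}" "card D = card U"
    and "\<And>m. card (U \<inter> {..m}) \<le> card (D \<inter> {..<m})"
  shows "\<exists>x. nc_perm x \<and> x permutes {1..N} \<and> exc x = D \<and> x ` exc x = U"
  using assms
proof (induct "card U" arbitrary: D U)
  case 0
  have fin: "finite U" "finite D" using 0 finite_subset by blast+
  then have "U = {}" "D = {}" using 0 by auto
  moreover have "nc_perm id" unfolding nc_perm_def by (simp add: bij_id)
  moreover have "exc id = {}" by (simp add: exc_def)
  ultimately show ?case using permutes_id by (metis image_empty)
next
  case (Suc k)
  have fin: "finite U" "finite D" using Suc.prems finite_subset by blast+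
  define u where "u = Min U"
  have "U \<noteq> {}" using Suc.hyps(2) by auto
  then have uU: "u \<in> U" "\<And>q. q \<in> U \<Longrightarrow> u \<le> q" unfolding u_def using fin by auto
  have "U \<inter> {..u} = {u}" using uU by force
  then have "1 \<le> card (D \<inter> {..<u})" using Suc.prems(4)[of u] by simp
  then have "D \<inter> {..<u} \<noteq> {}" by force
  define d where "d = Max (D \<inter> {..<u})"
  have "d \<in> D \<inter> {..<u}" unfolding d_def using \<open>D \<inter> {..<u} \<noteq> {}\<close> fin by (intro Max_in) auto
  then have dD: "d \<in> D" "d < u" by auto
  have dmax: "q \<le> d" if "q \<in> D" "q < u" for q unfolding d_def using that fin by (intro Max_ge) auto
  have cU: "card (U - {u}) = k" using Suc.hyps(2) uU by simp
  have cD: "card (D - {d}) = k" using Suc.hyps(2) Suc.prems(3) dD by simp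
  have ball: "card ((U - {u}) \<inter> {..m}) \<le> card ((D - {d}) \<inter> {..<m})" for m
  proof (cases "m < u")
    case True
    then have "(U - {u}) \<inter> {..m} = {}" using uU by force
    then show ?thesis by simp
  next
    case False
    have "(U - {u}) \<inter> {..m} = U \<inter> {..m} - {u}" "(D - {d}) \<inter> {..<m} = D \<inter> {..<m} - {d}" by auto
    then show ?thesis using Suc.prems(4)[of m] False uU dD by simp
  qed
  obtain x where x: "nc_perm x" "x permutes {1..N}" "exc x = D - {d}" "x ` exc x = U - {u}"
    using Suc.hyps(1)[of "U - {u}" "D - {d}"] cU cD ball Suc.prems(1,2) by (metis Diff_subset order_trans)
  have fx: "x q = q" if "d \<le> q" "q < u" for q
  proof (rule nc_perm_fixed[OF x(1)])
    show "q \<notin> exc x" unfolding x(3) using dmax[of q] that by auto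
    show "q \<notin> x ` exc x" unfolding x(4) using uU(2)[of q] that by auto
  qed
  have "u \<notin> x ` exc x" unfolding x(4) by simp
  note j = nc_perm_join[OF x(1) dD(2) fx this]
  have "transpose d u \<circ> x permutes {1..N}"
    using permutes_transpose_comp[OF x(2)] dD uU Suc.prems(1,2) by blast
  then show ?case
    using j x(3,4) dD uU by (intro exI[of _ "transpose d u \<circ> x"]) (simp add: insert_absorb)
qed

section \<open>A key that toggles decrease\<close>

text \<open>The total length of the ascending edges of an injective \<open>x\<close>, written
  through the two sets because these are what the toggle lemmas describe.\<close>

definition arc_sum :: "(nat \<Rightarrow> nat) \<Rightarrow> int"
  where "arc_sum x = (\<Sum>q\<in>x ` exc x. int q) - (\<Sum>q\<in>exc x. int q)"

text \<open>A lexicographic order: at most \<open>n\<close> points are ascents, so the first summand dominates.\<close>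

definition nc_key :: "nat \<Rightarrow> (nat \<Rightarrow> nat) \<Rightarrow> int"
  where "nc_key n x = (int n + 1) * arc_sum x - int (card (exc x))"

text \<open>Cutting off a vertex shortens the edges by one and loses one ascent; the weight
  \<open>n + 1\<close> of the former outweighs the latter.\<close>

lemma nc_key_drop:
  assumes "A' = A - 1" "C' = C - 1" "n \<ge> 1"
  shows "(int n + 1) * A' - C' < (int n + 1) * A - C"
  unfolding assms(1,2) using assms(3) by (simp add: algebra_simps)

lemma card_image_exc: "nc_perm x \<Longrightarrow> card (x ` exc x) = card (exc x)"
  by (metis nc_permD(1) bij_is_inj card_image inj_on_subset subset_UNIV)

text \<open>Insertion keeps the arc sum and adds an ascent, removal lowers the arc sum; both lower
  the key.\<close>

lemma nc_key_left_toggle: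
  assumes x: "nc_perm x" "x permutes {1..n+1}" and n: "n \<ge> 1" and i: "Suc i \<in> x ` exc x" "i \<notin> x ` exc x"
  shows "nc_key n (transpose i (Suc i) \<circ> x) < nc_key n x"
proof -
  let ?y = "transpose i (Suc i) \<circ> x"
  have fin: "finite (exc x)" using finite_exc[OF x(2)] .
  note t = nc_perm_left_toggle[OF x(1) i]
  from t(2) show ?thesis
  proof (elim disjE conjE)
    assume a: "i \<notin> exc x" "exc ?y = insert i (exc x)" "?y ` exc ?y = insert i (x ` exc x)"
    have "arc_sum ?y = arc_sum x" unfolding arc_sum_def a(3) unfolding a(2) using a(1) i fin by simp
    then show ?thesis unfolding nc_key_def a(2) using a(1) fin by simp
  next
    assume a: "i \<in> exc x" "exc ?y = exc x - {i}" "?y ` exc ?y = x ` exc x - {Suc i}"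
    have c: "card (exc x) > 0" using a(1) fin by (auto simp: card_gt_0_iff)
    have "arc_sum ?y = arc_sum x - 1"
      unfolding arc_sum_def a(3) unfolding a(2) using a(1) i fin by (simp add: sum_diff1)
    moreover have "int (card (exc x - {i})) = int (card (exc x)) - 1" using a(1) fin c by (simp add: of_nat_diff)
    ultimately show ?thesis unfolding nc_key_def a(2) using n by (intro nc_key_drop)
  qed
qed

lemma nc_key_right_toggle:
  assumes x: "nc_perm x" "x permutes {1..n+1}" and n: "n \<ge> 1" and j: "j \<in> exc x" "Suc j \<notin> exc x"
  shows "nc_key n (x \<circ> transpose j (Suc j)) < nc_key n x"
proof -
  let ?y = "x \<circ> transpose j (Suc j)"
  have fin: "finite (exc x)" using finite_exc[OF x(2)] .
  note t = nc_perm_right_toggle[OF x(1) j]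
  from t(2) show ?thesis
  proof (elim disjE conjE)
    assume a: "Suc j \<notin> x ` exc x" "exc ?y = insert (Suc j) (exc x)" "?y ` exc ?y = insert (Suc j) (x ` exc x)"
    have "arc_sum ?y = arc_sum x" unfolding arc_sum_def a(3) unfolding a(2) using a(1) j fin by simp
    then show ?thesis unfolding nc_key_def a(2) using j fin by simp
  next
    assume a: "Suc j \<in> x ` exc x" "exc ?y = exc x - {j}" "?y ` exc ?y = x ` exc x - {Suc j}"
    have c: "card (exc x) > 0" using j(1) fin by (auto simp: card_gt_0_iff)
    have "arc_sum ?y = arc_sum x - 1"
      unfolding arc_sum_def a(3) unfolding a(2) using a(1) j fin by (simp add: sum_diff1)
    moreover have "int (card (exc x - {j})) = int (card (exc x)) - 1" using j(1) fin c by (simp add: of_nat_diff)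
    ultimately show ?thesis unfolding nc_key_def a(2) using n by (intro nc_key_drop)
  qed
qed

section \<open>Evaluation of \<open>psi\<close>\<close>

lemma psi_eqI:
  assumes "nc_perm x" "x permutes {1..n+1}" "exc x = J_set n w" "x ` exc x = (\<lambda>i. i + 1) ` I_set n w"
  shows "psi n w = x"
  unfolding psi_def
proof (rule the_equality)
  show "x \<in> noncrossing n \<and> D_vert x = J_set n w \<and> U_vert x = (\<lambda>i. i + 1) ` I_set n w"
    using nc_perm_imp_noncrossing[OF assms(1,2)] assms(3,4)
    unfolding D_vert_nc_perm[OF assms(1,2)] U_vert_nc_perm[OF assms(1,2)] by blast
next
  fix y assume y: "y \<in> noncrossing n \<and> D_vert y = J_set n w \<and> U_vert y = (\<lambda>i. i + 1) ` I_set n w"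
  then have nc: "nc_perm y" "y permutes {1..n+1}" using noncrossing_imp_nc_perm by blast+
  show "y = x"
    using y assms(3,4) unfolding D_vert_nc_perm[OF nc] U_vert_nc_perm[OF nc]
    by (intro nc_perm_unique nc assms) auto
qed

section \<open>Fully commutative permutations\<close>

definition invs :: "(nat \<Rightarrow> nat) \<Rightarrow> (nat \<times> nat) set"
  where "invs w = {(p, q). p < q \<and> w q < w p}"

lemma finite_invs:
  assumes "w permutes {1..N}"
  shows "finite (invs w)"
proof (rule finite_subset)
  show "invs w \<subseteq> {1..N} \<times> {1..N}"
  proof clarify
    fix p q assume "(p, q) \<in> invs w"
    then have *: "p < q" "w q < w p" by (auto simp: invs_def)
    have "p \<in> {1..N}"
      using * permutes_not_in[OF assms, of p] permutes_not_in[OF assms, of q] permutes_in_image[OF assms, of q]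
      by (cases "q \<in> {1..N}") auto
    moreover have "q \<in> {1..N}"
      using * permutes_not_in[OF assms, of q] permutes_in_image[OF assms, of p] calculation
      by (cases "q \<in> {1..N}") auto
    ultimately show "p \<in> {1..N} \<and> q \<in> {1..N}" ..
  qed
qed simp

lemma invs_simple_refl_comp:
  assumes "inj w" "w p = i" "w q = Suc i" "p < q"
  shows "invs (simple_refl i \<circ> w) = insert (p, q) (invs w)" "(p, q) \<notin> invs w"
proof -
  have ne: "r = p" if "w r = i" for r using injD[OF assms(1), of r p] that assms by simp
  have nq: "r = q" if "w r = Suc i" for r using injD[OF assms(1), of r q] that assms by simp
  have "(a, b) \<in> invs (simple_refl i \<circ> w) \<longleftrightarrow> (a, b) \<in> insert (p, q) (invs w)" for a b
    using ne[of a] ne[of b] nq[of a] nq[of b] assms(2-4)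
    unfolding invs_def simple_refl_def
    by (cases "w a = i"; cases "w b = i"; cases "w a = Suc i"; cases "w b = Suc i") (auto simp: transpose_def)
  then show "invs (simple_refl i \<circ> w) = insert (p, q) (invs w)" by auto
  show "(p, q) \<notin> invs w" using assms by (simp add: invs_def)
qed

lemma simple_refl_comp_simple_refl: "simple_refl i \<circ> (simple_refl i \<circ> w) = w"
  by (simp add: simple_refl_def fun_eq_iff)

lemma invs_simple_refl_comp':
  assumes "inj w" "w p = i" "w q = Suc i" "q < p"
  shows "invs (simple_refl i \<circ> w) = invs w - {(q, p)}" "(q, p) \<in> invs w"
proof -
  let ?v = "simple_refl i \<circ> w"
  have "inj ?v" using assms(1) by (simp add: simple_refl_def inj_compose)
  moreover have "?v q = i" "?v p = Suc i" using assms by (simp_all add: simple_refl_def)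
  ultimately have "invs w = insert (q, p) (invs ?v)" "(q, p) \<notin> invs ?v"
    using invs_simple_refl_comp[of ?v q i p] assms(4) unfolding simple_refl_comp_simple_refl by blast+
  then show "invs ?v = invs w - {(q, p)}" "(q, p) \<in> invs w" by auto
qed

lemma permutes_simple_refl: "i \<in> {1..n} \<Longrightarrow> simple_refl i permutes {1..n+1}"
  unfolding simple_refl_def by (rule permutes_swap_id) auto

lemma permutes_simple_refl_comp:
  "i \<in> {1..n} \<Longrightarrow> w permutes {1..n+1} \<Longrightarrow> simple_refl i \<circ> w permutes {1..n+1}"
  using permutes_simple_refl permutes_compose by blast

lemma card_invs_simple_refl_comp:
  assumes w: "w permutes {1..n+1}"
  shows "perm_inv w i < perm_inv w (Suc i) \<Longrightarrow> card (invs (simple_refl i \<circ> w)) = Suc (card (invs w))"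
    "perm_inv w (Suc i) < perm_inv w i \<Longrightarrow> Suc (card (invs (simple_refl i \<circ> w))) = card (invs w)"
    "card (invs (simple_refl i \<circ> w)) \<le> Suc (card (invs w))"
proof -
  have inj: "inj w" using permutes_inj[OF w] .
  note pw = permutes_inverses(1)[OF w]
  note fin = finite_invs[OF w]
  show 1: "card (invs (simple_refl i \<circ> w)) = Suc (card (invs w))"
    if "perm_inv w i < perm_inv w (Suc i)"
    using invs_simple_refl_comp[OF inj pw pw that] fin by simp
  show 2: "Suc (card (invs (simple_refl i \<circ> w))) = card (invs w)"
    if "perm_inv w (Suc i) < perm_inv w i"
    using invs_simple_refl_comp'[OF inj pw pw that] fin by (metis card.remove)
  have "perm_inv w i \<noteq> perm_inv w (Suc i)" using pw by (metis n_not_Suc_n)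
  then show "card (invs (simple_refl i \<circ> w)) \<le> Suc (card (invs w))"
    using 1 2 by linarith
qed

abbreviation simple_word :: "nat list \<Rightarrow> nat \<Rightarrow> nat"
  where "simple_word is \<equiv> word_prod (map simple_refl is)"

lemma permutes_simple_word: "set is \<subseteq> {1..n} \<Longrightarrow> simple_word is permutes {1..n+1}"
proof (induct "is")
  case (Cons i "is")
  have 1: "i \<in> {1..n}" and 2: "simple_word is permutes {1..n+1}" using Cons by auto
  show ?case unfolding list.map word_prod_Cons by (rule permutes_simple_refl_comp[OF 1 2])
qed (simp add: word_prod_Nil permutes_id)

lemma card_invs_simple_word_le: "set is \<subseteq> {1..n} \<Longrightarrow> card (invs (simple_word is)) \<le> length is"
proof (induct "is")
  case Nil
  have "invs id = {}" by (auto simp: invs_def)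
  then show ?case by (simp only: list.map word_prod_Nil) simp
next
  case (Cons i "is")
  have 1: "card (invs (simple_word is)) \<le> length is" using Cons by auto
  have "simple_word is permutes {1..n+1}" using Cons(2) by (intro permutes_simple_word) auto
  from card_invs_simple_refl_comp(3)[OF this, of i] 1 show ?case
    unfolding list.map word_prod_Cons list.size by linarith
qed

lemma exists_descent_between:
  assumes "inj f" "(a::nat) < b" "(f b :: nat) < f a"
  obtains i where "a \<le> i" "i < b" "f (Suc i) < f i"
proof -
  have "\<exists>i. a \<le> i \<and> i < b \<and> f (Suc i) < f i"
  proof (rule ccontr)
    assume *: "\<not> ?thesis"
    have "a \<le> c \<Longrightarrow> c \<le> b \<Longrightarrow> f a \<le> f c" for c
    proof (induct c rule: dec_induct)
      case (step m)
      then show ?case using * by (metis Suc_leD Suc_le_eq le_trans not_less)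
    qed simp
    from this[of b] assms show False by simp
  qed
  then show thesis using that by blast
qed

text \<open>Unless \<open>w\<close> is the identity, its inverse is not increasing and so has a
  descent at some \<open>i\<close>; multiplying by that simple reflection on the left removes
  exactly one inversion.\<close>

lemma exists_simple_word:
  assumes "w permutes {1..n+1}"
  shows "\<exists>is. set is \<subseteq> {1..n} \<and> simple_word is = w \<and> length is = card (invs w)"
  using assms
proof (induct "card (invs w)" arbitrary: w rule: less_induct)
  case less
  note w = less(2)
  show ?case
  proof (cases "w = id")
    case True
    then have "invs w = {}" by (auto simp: invs_def)
    then show ?thesis using True by (intro exI[of _ "[]"]) (simp add: word_prod_Nil)
  next
    case False
    have "\<exists>a b. a < b \<and> perm_inv w b < perm_inv w a"
    proof (rule ccontr)
      assume *: "\<not> ?thesis"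
      have inj: "inj (perm_inv w)" using permutes_inj[OF permutes_inv[OF w]] .
      then have "strict_mono (perm_inv w)"
        using * by (intro strict_monoI) (metis injD linorder_neqE_nat nat_less_le)
      then have "\<forall>i\<in>{1..n+1}. i \<le> perm_inv w i" by (simp add: strict_mono_imp_increasing)
      from permutes_natset_ge[OF permutes_inv[OF w] this] have "perm_inv w = id" .
      then show False using False permutes_inverses(1)[OF w] by (auto simp: fun_eq_iff)
    qed
    then obtain a b where ab: "a < b" "perm_inv w b < perm_inv w a" by blast
    obtain i where i: "perm_inv w (Suc i) < perm_inv w i"
      using exists_descent_between[OF permutes_inj[OF permutes_inv[OF w]] ab] by metis
    have i1: "i \<in> {1..n}"
    proof (rule ccontr)
      assume *: "i \<notin> {1..n}"
      note pi = permutes_inv[OF w]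
      show False
      proof (cases "i = 0")
        case True
        then show False using permutes_not_in[OF pi, of 0] i by simp
      next
        case False
        then have "perm_inv w (Suc i) = Suc i" using * permutes_not_in[OF pi, of "Suc i"] by simp
        moreover have "perm_inv w i \<le> i"
          using permutes_in_image[OF pi, of i] permutes_not_in[OF pi, of i] * False by (cases "i = n+1") auto
        ultimately show False using i by simp
      qed
    qed
    note c = card_invs_simple_refl_comp(2)[OF w i]
    note p = permutes_simple_refl_comp[OF i1 w]
    obtain "is" where "is": "set is \<subseteq> {1..n}" "simple_word is = simple_refl i \<circ> w"
      "length is = card (invs (simple_refl i \<circ> w))"
      using less(1)[OF _ p] c by auto
    have "simple_word (i # is) = w"
      unfolding list.map word_prod_Cons "is"(2) by (rule simple_refl_comp_simple_refl)
    then show ?thesis using "is"(1,3) i1 c by (intro exI[of _ "i # is"]) simp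
  qed
qed

lemma set_simple_refls: "set ws \<subseteq> simple_refls n \<longleftrightarrow> (\<exists>is. ws = map simple_refl is \<and> set is \<subseteq> {1..n})"
proof
  assume "set ws \<subseteq> simple_refls n"
  then show "\<exists>is. ws = map simple_refl is \<and> set is \<subseteq> {1..n}"
  proof (induct ws)
    case (Cons s ws)
    then obtain "is" i where "ws = map simple_refl is" "set is \<subseteq> {1..n}" "s = simple_refl i" "i \<in> {1..n}"
      by (auto simp: simple_refls_def)
    then show ?case by (intro exI[of _ "i # is"]) simp
  qed simp
qed (auto simp: simple_refls_def intro!: imageI)

lemma len_S_eq:
  assumes w: "w permutes {1..n+1}"
  shows "len_S n w = card (invs w)"
proof -
  obtain "is" where "is": "set is \<subseteq> {1..n}" "simple_word is = w" "length is = card (invs w)"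
    using exists_simple_word[OF w] by blast
  have m: "set (map simple_refl is) \<subseteq> simple_refls n" using "is" set_simple_refls by blast
  obtain us where "us \<in> reduced_words (simple_refls n) w"
    using reduced_word_exists[OF m] "is" by blast
  then have us: "set us \<subseteq> simple_refls n" "word_prod us = w" "length us = len_S n w"
    unfolding reduced_words_def by auto
  then obtain js where js: "us = map simple_refl js" "set js \<subseteq> {1..n}" using set_simple_refls by blast
  have "card (invs w) \<le> len_S n w" using card_invs_simple_word_le[OF js(2)] us js by simp
  moreover have "len_S n w \<le> card (invs w)" using word_length_le[OF m] "is" by simp
  ultimately show ?thesis by simp
qed

lemma reduced_words_simple_iff:
  assumes w: "w permutes {1..n+1}"
  shows "ws \<in> reduced_words (simple_refls n) w \<longleftrightarrow>
    (\<exists>is. ws = map simple_refl is \<and> set is \<subseteq> {1..n} \<and> simple_word is = w \<and> length is = card (invs w))"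
  unfolding reduced_words_def len_S_eq[OF w] mem_Collect_eq set_simple_refls by auto

lemma invs_perm_inv:
  assumes w: "w permutes {1..n+1}"
  shows "card (invs (perm_inv w)) = card (invs w)"
proof -
  note pw [simp] = permutes_inverses[OF w]
  have "bij_betw (\<lambda>(p, q). (w q, w p)) (invs w) (invs (perm_inv w))"
    by (rule bij_betw_byWitness[where f' = "\<lambda>(a, b). (perm_inv w b, perm_inv w a)"])
      (auto simp: invs_def)
  then show ?thesis by (metis bij_betw_same_card)
qed

lemma card_invs_comp_simple_refl:
  assumes w: "w permutes {1..n+1}" and i: "i \<in> {1..n}" and lt: "w i < w (Suc i)"
  shows "card (invs (w \<circ> simple_refl i)) = Suc (card (invs w))"
proof -
  let ?v = "w \<circ> simple_refl i"
  have v: "?v permutes {1..n+1}" using permutes_compose[OF permutes_simple_refl[OF i] w] .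
  have bw: "bij w" using permutes_bij[OF w] .
  have "perm_inv ?v = simple_refl i \<circ> perm_inv w"
    by (rule inv_unique_comp) (auto simp: fun_eq_iff permutes_inverses[OF w] simple_refl_def)
  moreover have "perm_inv (perm_inv w) = w" using bw by (simp add: inv_inv_eq)
  ultimately have "card (invs (perm_inv ?v)) = Suc (card (invs (perm_inv w)))"
    using card_invs_simple_refl_comp(1)[OF permutes_inv[OF w], of i] lt by simp
  then show ?thesis using invs_perm_inv[OF v] invs_perm_inv[OF w] by simp
qed

lemma left_descents_imp:
  assumes w: "w permutes {1..n+1}" and s: "s \<in> left_descents n w"
  obtains i where "i \<in> {1..n}" "s = simple_refl i" "perm_inv w (Suc i) < perm_inv w i"
proof -
  from s obtain i where i: "i \<in> {1..n}" "s = simple_refl i" "len_S n (simple_refl i \<circ> w) < len_S n w"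
    unfolding left_descents_def simple_refls_def by auto
  then have "card (invs (simple_refl i \<circ> w)) < card (invs w)"
    using len_S_eq[OF w] len_S_eq[OF permutes_simple_refl_comp[OF i(1) w]] by simp
  then have "\<not> perm_inv w i < perm_inv w (Suc i)" using card_invs_simple_refl_comp(1)[OF w] by fastforce
  moreover have "perm_inv w i \<noteq> perm_inv w (Suc i)"
    using permutes_inverses(1)[OF w] by (metis n_not_Suc_n)
  ultimately show thesis using that i by force
qed

lemma right_descents_imp:
  assumes w: "w permutes {1..n+1}" and s: "s \<in> right_descents n w"
  obtains i where "i \<in> {1..n}" "s = simple_refl i" "w (Suc i) < w i"
proof -
  from s obtain i where i: "i \<in> {1..n}" "s = simple_refl i" "len_S n (w \<circ> simple_refl i) < len_S n w"
    unfolding right_descents_def simple_refls_def by auto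
  have "w \<circ> simple_refl i permutes {1..n+1}" using permutes_compose[OF permutes_simple_refl[OF i(1)] w] .
  then have "card (invs (w \<circ> simple_refl i)) < card (invs w)"
    using i(3) len_S_eq[OF w] len_S_eq by simp
  then have "\<not> w i < w (Suc i)" using card_invs_comp_simple_refl[OF w i(1)] by fastforce
  moreover have "w i \<noteq> w (Suc i)" using injD[OF permutes_inj[OF w], of i "Suc i"] by auto
  ultimately show thesis using that i by force
qed

section \<open>Full commutativity and avoidance of 321\<close>

text \<open>Two inversions that share the middle position form a decreasing subsequence of length
  three. Phrasing the pattern by inversions lets it be followed while single inversions are
  removed.\<close>

definition avoids_321 :: "(nat \<Rightarrow> nat) \<Rightarrow> bool"
  where "avoids_321 w \<longleftrightarrow> \<not> (\<exists>p q r. (p, q) \<in> invs w \<and> (q, r) \<in> invs w)"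

lemma simple_refl_commute:
  assumes "Suc i < j \<or> Suc j < i \<or> i = j"
  shows "simple_refl i \<circ> simple_refl j = simple_refl j \<circ> simple_refl i"
  using assms by (auto simp: simple_refl_def fun_eq_iff transpose_def)

lemma simple_refl_not_commute: "simple_refl i \<circ> simple_refl (Suc i) \<noteq> simple_refl (Suc i) \<circ> simple_refl i"
proof
  assume "simple_refl i \<circ> simple_refl (Suc i) = simple_refl (Suc i) \<circ> simple_refl i"
  then have "simple_refl i (simple_refl (Suc i) i) = simple_refl (Suc i) (simple_refl i i)"
    by (metis comp_apply)
  then show False by (simp add: simple_refl_def transpose_def)
qed

lemma simple_refl_eq_iff [simp]: "simple_refl i = simple_refl j \<longleftrightarrow> i = j"
proof
  assume "simple_refl i = simple_refl j"
  then have "simple_refl i i = simple_refl j i" "simple_refl i j = simple_refl j j" by simp_all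
  then show "i = j" by (auto simp: simple_refl_def transpose_def split: if_splits)
qed simp

lemma commutation_moves_Cons:
  "(commutation_move n)\<^sup>*\<^sup>* xs ys \<Longrightarrow> (commutation_move n)\<^sup>*\<^sup>* (s # xs) (s # ys)"
proof (induct rule: rtranclp_induct)
  case (step ys zs)
  from step(2) have "commutation_move n (s # ys) (s # zs)"
  proof cases
    case (1 a b us vs)
    then show ?thesis using commutation_move.intros[of a n b "s # us" vs] by simp
  qed
  with step(3) show ?case by simp
qed simp

lemma avoids_321_simple_refl_comp:
  assumes "w permutes {1..n+1}" "avoids_321 w" "perm_inv w (Suc i) < perm_inv w i"
  shows "avoids_321 (simple_refl i \<circ> w)"
  using invs_simple_refl_comp'(1)[OF permutes_inj[OF assms(1)] permutes_inverses(1)[OF assms(1)]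
      permutes_inverses(1)[OF assms(1)] assms(3)] assms(2)
  unfolding avoids_321_def by auto

lemma reduced_simple_word_Cons:
  assumes w: "w permutes {1..n+1}"
    and "is": "set (i # is) \<subseteq> {1..n}" "simple_word (i # is) = w" "length (i # is) = card (invs w)"
  shows "simple_word is = simple_refl i \<circ> w" "perm_inv w (Suc i) < perm_inv w i"
    "length is = card (invs (simple_refl i \<circ> w))"
proof -
  have "simple_refl i \<circ> simple_word is = w" using "is"(2) by (simp only: list.map word_prod_Cons)
  then show eq: "simple_word is = simple_refl i \<circ> w" using simple_refl_comp_simple_refl by metis
  have le: "card (invs (simple_refl i \<circ> w)) \<le> length is"
    using card_invs_simple_word_le[of "is" n] "is"(1) eq by simp
  have "perm_inv w i \<noteq> perm_inv w (Suc i)" using permutes_inverses(1)[OF w] by (metis n_not_Suc_n)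
  moreover have "\<not> perm_inv w i < perm_inv w (Suc i)"
    using card_invs_simple_refl_comp(1)[OF w, of i] le "is"(3) by auto
  ultimately show d: "perm_inv w (Suc i) < perm_inv w i" by simp
  show "length is = card (invs (simple_refl i \<circ> w))"
    using card_invs_simple_refl_comp(2)[OF w d] "is"(3) by simp
qed

lemma perm_inv_simple_refl_comp:
  assumes w: "w permutes {1..n+1}"
  shows "perm_inv (simple_refl i \<circ> w) a = perm_inv w (simple_refl i a)"
proof -
  have "perm_inv (simple_refl i \<circ> w) = perm_inv w \<circ> simple_refl i"
    by (rule inv_unique_comp) (auto simp: fun_eq_iff permutes_inverses[OF w] simple_refl_def)
  then show ?thesis by simp
qed

text \<open>The first letters of both words are left descents. Adjacent ones would produce a 321
  pattern, so they coincide or commute. In the commuting case a reduced word \<open>zs\<close> of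
  the common remainder links both words through \<open>i # j # zs\<close> and
  \<open>j # i # zs\<close>.\<close>

lemma avoids_321_commutation_moves:
  assumes "w permutes {1..n+1}" "avoids_321 w"
    and "set is \<subseteq> {1..n}" "simple_word is = w" "length is = card (invs w)"
    and "set js \<subseteq> {1..n}" "simple_word js = w" "length js = card (invs w)"
  shows "(commutation_move n)\<^sup>*\<^sup>* (map simple_refl is) (map simple_refl js)"
  using assms
proof (induct "length is" arbitrary: w "is" js rule: less_induct)
  case less
  note w = less(2)
  show ?case
  proof (cases "is")
    case Nil
    then show ?thesis using less by simp
  next
    case (Cons i is')
    then obtain j js' where js: "js = j # js'" using less by (cases js) auto
    note I = reduced_simple_word_Cons[OF w less(4-6)[unfolded Cons]]
    note J = reduced_simple_word_Cons[OF w less(7-9)[unfolded js]]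
    have ij: "i \<in> {1..n}" "j \<in> {1..n}" "set is' \<subseteq> {1..n}" "set js' \<subseteq> {1..n}" using less Cons js by auto
    have len: "length is' < length is" "length js' < length is" using Cons js less by auto
    have wi: "simple_refl i \<circ> w permutes {1..n+1}" "simple_refl j \<circ> w permutes {1..n+1}"
      using permutes_simple_refl_comp w ij by blast+
    note av = avoids_321_simple_refl_comp[OF w less(3)]
    have "i = j \<or> Suc i < j \<or> Suc j < i"
    proof (rule ccontr)
      assume "\<not> ?thesis"
      then have "j = Suc i \<or> i = Suc j" by auto
      then obtain k where k: "perm_inv w (Suc k) < perm_inv w k" "perm_inv w (Suc (Suc k)) < perm_inv w (Suc k)"
        using I(2) J(2) by auto
      then have "(perm_inv w (Suc (Suc k)), perm_inv w (Suc k)) \<in> invs w" "(perm_inv w (Suc k), perm_inv w k) \<in> invs w"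
        by (auto simp: invs_def permutes_inverses[OF w])
      then show False using less(3) unfolding avoids_321_def by blast
    qed
    then consider "i = j" | "Suc i < j \<or> Suc j < i" by blast
    then show ?thesis
    proof cases
      case 1
      from less(1)[OF len(1) wi(1) av[OF I(2)] ij(3) I(1,3) ij(4)] J(1,3) 1
      have "(commutation_move n)\<^sup>*\<^sup>* (map simple_refl is') (map simple_refl js')" by simp
      then show ?thesis unfolding Cons js using 1 commutation_moves_Cons by simp
    next
      case 2
      have d: "perm_inv (simple_refl i \<circ> w) (Suc j) < perm_inv (simple_refl i \<circ> w) j"
        "perm_inv (simple_refl j \<circ> w) (Suc i) < perm_inv (simple_refl j \<circ> w) i"
        unfolding perm_inv_simple_refl_comp[OF w] using 2 I(2) J(2)
        by (auto simp: simple_refl_def transpose_def)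
      have comm: "simple_refl i \<circ> simple_refl j = simple_refl j \<circ> simple_refl i"
        using simple_refl_commute 2 by blast
      then have comm': "simple_refl j \<circ> (simple_refl i \<circ> w) = simple_refl i \<circ> (simple_refl j \<circ> w)"
        by (metis comp_assoc)
      have "simple_refl j \<circ> (simple_refl i \<circ> w) permutes {1..n+1}"
        using permutes_simple_refl_comp ij wi by blast
      then obtain zs where zs: "set zs \<subseteq> {1..n}" "simple_word zs = simple_refl j \<circ> (simple_refl i \<circ> w)"
        "length zs = card (invs (simple_refl j \<circ> (simple_refl i \<circ> w)))"
        using exists_simple_word by blast
      have jz: "simple_word (j # zs) = simple_refl i \<circ> w" "simple_word (i # zs) = simple_refl j \<circ> w"
        unfolding list.map word_prod_Cons zs(2) using simple_refl_comp_simple_refl comm' by metis+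
      have lz: "length (j # zs) = card (invs (simple_refl i \<circ> w))" "length (i # zs) = card (invs (simple_refl j \<circ> w))"
        using card_invs_simple_refl_comp(2)[OF wi(1) d(1)] card_invs_simple_refl_comp(2)[OF wi(2) d(2)] zs(3) comm'
        by simp_all
      have sz: "set (j # zs) \<subseteq> {1..n}" "set (i # zs) \<subseteq> {1..n}" using ij zs by auto
      have a: "(commutation_move n)\<^sup>*\<^sup>* (map simple_refl is') (map simple_refl (j # zs))"
        using less(1)[OF len(1) wi(1) av[OF I(2)] ij(3) I(1,3) sz(1) jz(1) lz(1)] .
      have b: "(commutation_move n)\<^sup>*\<^sup>* (map simple_refl (i # zs)) (map simple_refl js')"
        using less(1)[of "i # zs", OF _ wi(2) av[OF J(2)] sz(2) jz(2) lz(2) ij(4) J(1,3)] lz J(3) len by simp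
      have "commutation_move n (simple_refl i # simple_refl j # map simple_refl zs)
          (simple_refl j # simple_refl i # map simple_refl zs)"
        using commutation_move.intros[of "simple_refl i" n "simple_refl j" "[]"] comm ij
        by (simp add: simple_refls_def)
      then show ?thesis unfolding Cons js
        using commutation_moves_Cons[OF a, of "simple_refl i"] commutation_moves_Cons[OF b, of "simple_refl j"]
        by simp
    qed
  qed
qed

lemma fully_commutative_if_avoids_321:
  assumes w: "w permutes {1..n+1}" and "avoids_321 w"
  shows "w \<in> fully_commutative n"
  unfolding fully_commutative_def Wgrp_iff mem_Collect_eq
proof (intro conjI ballI w)
  fix xs ys
  assume "xs \<in> reduced_words (simple_refls n) w" "ys \<in> reduced_words (simple_refls n) w"
  then show "(commutation_move n)\<^sup>*\<^sup>* xs ys"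
    unfolding reduced_words_simple_iff[OF w] using avoids_321_commutation_moves[OF assms] by blast
qed

text \<open>A left descent whose inversion is not part of the given 321 pattern is stripped off by
  induction. If there is none, the descents found between the values of the pattern must be its own
  two inversions; the three values are then consecutive, and \<open>w\<close> has a reduced word
  starting with \<open>[j, Suc j, j]\<close>.\<close>

lemma exists_braid_word:
  assumes "w permutes {1..n+1}" "\<not> avoids_321 w"
  shows "\<exists>us i vs. set us \<subseteq> {1..n} \<and> set vs \<subseteq> {1..n} \<and> i \<in> {1..n} \<and> Suc i \<in> {1..n} \<and>
    simple_word (us @ [i, Suc i, i] @ vs) = w \<and> length (us @ [i, Suc i, i] @ vs) = card (invs w)"
  using assms
proof (induct "card (invs w)" arbitrary: w rule: less_induct)
  case less
  note w = less(2)
  note pw = permutes_inverses[OF w]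
  have injw: "inj w" using permutes_inj[OF w] .
  have inji: "inj (perm_inv w)" using permutes_inj[OF permutes_inv[OF w]] .
  obtain p q r where pqr: "(p, q) \<in> invs w" "(q, r) \<in> invs w" using less(3) unfolding avoids_321_def by blast
  have rng: "i \<in> {1..n}" if "perm_inv w (Suc i) < perm_inv w i" for i
  proof (rule ccontr)
    assume *: "i \<notin> {1..n}"
    note pi = permutes_inv[OF w]
    show False
    proof (cases "i = 0")
      case True
      then show False using permutes_not_in[OF pi, of 0] that by simp
    next
      case False
      then have "perm_inv w (Suc i) = Suc i" using * permutes_not_in[OF pi, of "Suc i"] by simp
      moreover have "perm_inv w i \<le> i"
        using permutes_in_image[OF pi, of i] permutes_not_in[OF pi, of i] * False by (cases "i = n+1") auto
      ultimately show False using that by simp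
    qed
  qed
  show ?case
  proof (cases "\<exists>i. perm_inv w (Suc i) < perm_inv w i \<and>
      (p, q) \<noteq> (perm_inv w (Suc i), perm_inv w i) \<and> (q, r) \<noteq> (perm_inv w (Suc i), perm_inv w i)")
    case True
    then obtain i where i: "perm_inv w (Suc i) < perm_inv w i"
      "(p, q) \<noteq> (perm_inv w (Suc i), perm_inv w i)" "(q, r) \<noteq> (perm_inv w (Suc i), perm_inv w i)" by blast
    let ?v = "simple_refl i \<circ> w"
    have v: "?v permutes {1..n+1}" using permutes_simple_refl_comp[OF rng[OF i(1)] w] .
    have "invs ?v = invs w - {(perm_inv w (Suc i), perm_inv w i)}"
      using invs_simple_refl_comp'(1)[OF injw pw(1) pw(1) i(1)] .
    then have "\<not> avoids_321 ?v" using pqr i(2,3) unfolding avoids_321_def by blast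
    moreover note c = card_invs_simple_refl_comp(2)[OF w i(1)]
    ultimately obtain us k vs where k: "set us \<subseteq> {1..n}" "set vs \<subseteq> {1..n}" "k \<in> {1..n}" "Suc k \<in> {1..n}"
      "simple_word (us @ [k, Suc k, k] @ vs) = ?v" "length (us @ [k, Suc k, k] @ vs) = card (invs ?v)"
      using less(1)[OF _ v] by auto
    have "simple_word ((i # us) @ [k, Suc k, k] @ vs) = simple_refl i \<circ> simple_word (us @ [k, Suc k, k] @ vs)"
      by (simp only: append_Cons list.map word_prod_Cons)
    also have "\<dots> = w" unfolding k(5) by (rule simple_refl_comp_simple_refl)
    finally show ?thesis
      using k c rng[OF i(1)] by - (rule exI[of _ "i # us"], rule exI[of _ k], rule exI[of _ vs], simp)
  next
    case False
    have pq: "p < q" "w q < w p" "q < r" "w r < w q" using pqr by (auto simp: invs_def)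
    obtain i where i: "w q \<le> i" "i < w p" "perm_inv w (Suc i) < perm_inv w i"
      using exists_descent_between[OF inji, of "w q" "w p"] pq pw by auto
    obtain j where j: "w r \<le> j" "j < w q" "perm_inv w (Suc j) < perm_inv w j"
      using exists_descent_between[OF inji, of "w r" "w q"] pq pw by auto
    have "(p, q) = (perm_inv w (Suc i), perm_inv w i) \<or> (q, r) = (perm_inv w (Suc i), perm_inv w i)"
      using False i(3) by blast
    then have wi: "w p = Suc i" "w q = i" using i(1) pq pw by auto
    have "(p, q) = (perm_inv w (Suc j), perm_inv w j) \<or> (q, r) = (perm_inv w (Suc j), perm_inv w j)"
      using False j(3) by blast
    then have wj: "w q = Suc j" "w r = j" using j(2) pq pw by auto
    have jn: "j \<in> {1..n}" "Suc j \<in> {1..n}" using rng[OF i(3)] rng[OF j(3)] wi wj by auto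
    let ?v1 = "simple_refl j \<circ> w" and ?v2 = "simple_refl (Suc j) \<circ> (simple_refl j \<circ> w)"
    let ?v3 = "simple_refl j \<circ> (simple_refl (Suc j) \<circ> (simple_refl j \<circ> w))"
    have v1: "?v1 permutes {1..n+1}" using permutes_simple_refl_comp[OF jn(1) w] .
    have v2: "?v2 permutes {1..n+1}" using permutes_simple_refl_comp[OF jn(2) v1] .
    have v3: "?v3 permutes {1..n+1}" using permutes_simple_refl_comp[OF jn(1) v2] .
    have p: "perm_inv w j = r" "perm_inv w (Suc j) = q" "perm_inv w (Suc (Suc j)) = p"
      using wi wj pw(2) by (metis, metis, metis)
    have d2: "perm_inv ?v1 (Suc (Suc j)) < perm_inv ?v1 (Suc j)"
      unfolding perm_inv_simple_refl_comp[OF w] using p pq by (simp add: simple_refl_def transpose_def)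
    have d3: "perm_inv ?v2 (Suc j) < perm_inv ?v2 j"
      unfolding perm_inv_simple_refl_comp[OF v1] perm_inv_simple_refl_comp[OF w]
      using p pq by (simp add: simple_refl_def transpose_def)
    obtain zs where zs: "set zs \<subseteq> {1..n}" "simple_word zs = ?v3" "length zs = card (invs ?v3)"
      using exists_simple_word[OF v3] by blast
    have "simple_word ([] @ [j, Suc j, j] @ zs) = w"
      unfolding append_Nil append_Cons list.map word_prod_Cons zs(2) simple_refl_comp_simple_refl ..
    moreover have "length ([] @ [j, Suc j, j] @ zs) = card (invs w)"
      using zs(3) card_invs_simple_refl_comp(2)[OF w j(3)] card_invs_simple_refl_comp(2)[OF v1 d2]
        card_invs_simple_refl_comp(2)[OF v2 d3] by simp
    ultimately show ?thesis using jn zs(1)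
      by - (rule exI[of _ "[]"], rule exI[of _ j], rule exI[of _ zs], simp)
  qed
qed

text \<open>The reflections at \<open>i\<close> and \<open>Suc i\<close> do not commute, so
  commutations never change the order of their occurrences. This invariant separates the two sides
  of a braid relation.\<close>

lemma commutation_moves_filter:
  assumes "(commutation_move n)\<^sup>*\<^sup>* xs ys"
  shows "filter (\<lambda>s. s = simple_refl i \<or> s = simple_refl (Suc i)) xs =
    filter (\<lambda>s. s = simple_refl i \<or> s = simple_refl (Suc i)) ys"
  using assms
proof (induct rule: rtranclp_induct)
  case (step ys zs)
  from step(2) have "filter (\<lambda>s. s = simple_refl i \<or> s = simple_refl (Suc i)) ys =
      filter (\<lambda>s. s = simple_refl i \<or> s = simple_refl (Suc i)) zs"
    by cases (use simple_refl_not_commute[of i] in auto)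
  with step(3) show ?case by simp
qed simp

lemma fully_commutative_avoids_321:
  assumes "w \<in> fully_commutative n"
  shows "avoids_321 w"
proof (rule ccontr)
  assume n: "\<not> avoids_321 w"
  have w: "w permutes {1..n+1}" using assms unfolding fully_commutative_def Wgrp_iff by blast
  obtain us i vs where i: "set us \<subseteq> {1..n}" "set vs \<subseteq> {1..n}" "i \<in> {1..n}" "Suc i \<in> {1..n}"
    "simple_word (us @ [i, Suc i, i] @ vs) = w" "length (us @ [i, Suc i, i] @ vs) = card (invs w)"
    using exists_braid_word[OF w n] by blast
  have "simple_refl i (simple_refl (Suc i) (simple_refl i q)) =
      simple_refl (Suc i) (simple_refl i (simple_refl (Suc i) q))" for q
    by (auto simp: simple_refl_def transpose_def)
  then have "simple_word (us @ [Suc i, i, Suc i] @ vs) = w"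
    unfolding i(5)[symmetric] by (simp add: fun_eq_iff)
  then have r: "map simple_refl (us @ [Suc i, i, Suc i] @ vs) \<in> reduced_words (simple_refls n) w"
    unfolding reduced_words_simple_iff[OF w] using i
    by (intro exI[of _ "us @ [Suc i, i, Suc i] @ vs"]) simp
  have "map simple_refl (us @ [i, Suc i, i] @ vs) \<in> reduced_words (simple_refls n) w"
    unfolding reduced_words_simple_iff[OF w] using i
    by (intro exI[of _ "us @ [i, Suc i, i] @ vs"]) simp
  with r assms have "(commutation_move n)\<^sup>*\<^sup>* (map simple_refl (us @ [i, Suc i, i] @ vs))
      (map simple_refl (us @ [Suc i, i, Suc i] @ vs))"
    unfolding fully_commutative_def by blast
  from commutation_moves_filter[OF this, of i] show False by simp
qed

section \<open>Normal forms of fully commutative elements\<close>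

abbreviation bracket :: "nat \<Rightarrow> nat \<Rightarrow> nat list"
  where "bracket i j \<equiv> rev [j..<i+1]"

definition nf_word :: "(nat \<times> nat) list \<Rightarrow> nat list"
  where "nf_word ps = concat (map (\<lambda>(i, j). bracket i j) ps)"

definition nf_seq :: "nat \<Rightarrow> (nat \<times> nat) list \<Rightarrow> bool"
  where "nf_seq n ps \<longleftrightarrow> (\<forall>(i, j)\<in>set ps. 1 \<le> j \<and> j \<le> i \<and> i \<le> n) \<and>
    sorted_wrt (<) (map fst ps) \<and> sorted_wrt (<) (map snd ps)"

lemma nf_word_snoc: "nf_word (ps @ [(i, j)]) = nf_word ps @ bracket i j"
  by (simp add: nf_word_def)

lemma nf_word_Nil [simp]: "nf_word [] = []"
  by (simp add: nf_word_def)

lemma nf_seq_Nil [simp]: "nf_seq n []"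
  by (simp add: nf_seq_def)

lemma nf_seq_snoc:
  "nf_seq n (ps @ [(i, j)]) \<longleftrightarrow> nf_seq n ps \<and> 1 \<le> j \<and> j \<le> i \<and> i \<le> n \<and>
    (\<forall>(i', j')\<in>set ps. i' < i \<and> j' < j)"
  by (auto simp: nf_seq_def sorted_wrt_append)

lemma nf_seq_mono: "nf_seq m ps \<Longrightarrow> m \<le> n \<Longrightarrow> nf_seq n ps"
  by (auto simp: nf_seq_def)

lemma nf_seq_snocD:
  assumes "nf_seq n (ps @ [(i, j)])" shows "nf_seq (i - 1) ps"
proof -
  have s: "nf_seq n ps" "\<And>a b. (a, b) \<in> set ps \<Longrightarrow> a < i" using assms unfolding nf_seq_snoc by auto
  have "1 \<le> b \<and> b \<le> a \<and> a \<le> i - 1" if "(a, b) \<in> set ps" for a b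
    using s(1) s(2)[OF that] that unfolding nf_seq_def by auto
  then show ?thesis using s(1) unfolding nf_seq_def by auto
qed

lemma set_nf_word: "nf_seq n ps \<Longrightarrow> set (nf_word ps) \<subseteq> {1..n}"
  by (fastforce simp: nf_word_def nf_seq_def)

lemma is_normal_form_iff:
  assumes w: "w permutes {1..n+1}"
  shows "is_normal_form n w ps \<longleftrightarrow>
    nf_seq n ps \<and> simple_word (nf_word ps) = w \<and> length (nf_word ps) = card (invs w)"
proof -
  have e: "concat (map (\<lambda>(i, j). map simple_refl (rev [j..<i + 1])) ps) = map simple_refl (nf_word ps)"
    unfolding nf_word_def by (induct ps) auto
  have i: "map simple_refl us = map simple_refl vs \<longleftrightarrow> us = vs" for us vs
    by (rule inj_map_eq_map) (simp add: inj_def)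
  show ?thesis
    unfolding is_normal_form_def e reduced_words_simple_iff[OF w] i nf_seq_def[symmetric]
    using set_nf_word[of n ps] unfolding nf_seq_def by auto
qed

lemma simple_word_bracket:
  assumes "j \<le> i"
  shows "simple_word (bracket i j) p = (if p = j then i + 1 else if j < p \<and> p \<le> i + 1 then p - 1 else p)"
  using assms
proof (induct "i - j" arbitrary: j p)
  case 0
  then have "i = j" by simp
  then show ?case by (auto simp: simple_refl_def transpose_def)
next
  case (Suc k)
  then have j: "j < i" "k = i - Suc j" by auto
  have "bracket i j = bracket i (Suc j) @ [j]" using j by (simp add: upt_conv_Cons)
  then have "simple_word (bracket i j) p = simple_word (bracket i (Suc j)) (simple_refl j p)" by simp
  also have "\<dots> = (if p = j then i + 1 else if j < p \<and> p \<le> i + 1 then p - 1 else p)"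
    using Suc(1)[OF j(2), of "simple_refl j p"] j by (auto simp: simple_refl_def transpose_def)
  finally show ?case .
qed

text \<open>The value \<open>i + 1\<close> is fixed by \<open>w\<close> and exceeds all values
  before it. The letters of the bracket carry it one position at a time from \<open>i + 1\<close>
  down to \<open>j\<close>, and each step creates one inversion.\<close>

lemma card_invs_comp_bracket:
  assumes w: "w permutes {1..i}" and j: "1 \<le> j" "j \<le> i"
  shows "card (invs (w \<circ> simple_word (bracket i j))) = card (invs w) + (i + 1 - j)"
  using j
proof (induct "i - j" arbitrary: j)
  case 0
  then have ij: "i = j" by simp
  then have "bracket i j = [i]" by simp
  then have e: "w \<circ> simple_word (bracket i j) = w \<circ> simple_refl i" by (simp add: fun_eq_iff)
  have w': "w permutes {1..i+1}" using w by (rule permutes_subset) auto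
  have "w i \<in> {1..i}" using permutes_in_image[OF w, of i] 0 ij by simp
  then have "w i < w (Suc i)" using permutes_not_in[OF w, of "Suc i"] by simp
  then have "card (invs (w \<circ> simple_refl i)) = Suc (card (invs w))"
    using card_invs_comp_simple_refl[OF w', of i] ij 0 by simp
  then show ?case unfolding e using ij by linarith
next
  case (Suc k)
  then have j: "j < i" "k = i - Suc j" by auto
  let ?u = "w \<circ> simple_word (bracket i (Suc j))"
  have "bracket i j = bracket i (Suc j) @ [j]" using j by (simp add: upt_conv_Cons)
  then have e: "w \<circ> simple_word (bracket i j) = ?u \<circ> simple_refl j" by (simp add: fun_eq_iff)
  have w': "w permutes {1..i+1}" using w by (rule permutes_subset) auto
  have "simple_word (bracket i (Suc j)) permutes {1..i+1}" by (rule permutes_simple_word) auto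
  then have u: "?u permutes {1..i+1}" using permutes_compose w' by blast
  have "w j \<in> {1..i}" using permutes_in_image[OF w, of j] Suc j by simp
  then have "?u j < ?u (Suc j)"
    using simple_word_bracket[of "Suc j" i] j permutes_not_in[OF w, of "Suc i"] by simp
  then have "card (invs (?u \<circ> simple_refl j)) = Suc (card (invs ?u))"
    using card_invs_comp_simple_refl[OF u, of j] Suc(3) j by simp
  moreover have "card (invs ?u) = card (invs w) + (i + 1 - Suc j)" using Suc(1)[OF j(2)] j by linarith
  ultimately show ?case unfolding e using j by linarith
qed

text \<open>Such a permutation is a union of two increasing sequences, which rules out 321; moreover
  each inversion then leads from an ascent to a non-ascent.\<close>

definition bi_increasing :: "(nat \<Rightarrow> nat) \<Rightarrow> bool"
  where "bi_increasing w \<longleftrightarrow> (\<forall>p q. p < q \<longrightarrow> (p \<in> exc w \<longleftrightarrow> q \<in> exc w) \<longrightarrow> w p < w q)"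

lemma bi_increasing_avoids_321:
  assumes "bi_increasing w" shows "avoids_321 w"
  unfolding avoids_321_def
proof clarify
  fix p q r assume "(p, q) \<in> invs w" "(q, r) \<in> invs w"
  then have "p < q" "q < r" "w q < w p" "w r < w q" by (auto simp: invs_def)
  then show False using assms unfolding bi_increasing_def by (meson less_trans not_less_iff_gr_or_eq)
qed

text \<open>Induction over the brackets. All earlier ascents lie below \<open>j\<close>; the last
  bracket adds the ascent from \<open>j\<close> to \<open>i + 1\<close> and shifts the values from
  \<open>j\<close> on, which belong to non-ascents, one position to the right.\<close>

lemma nf_word_properties:
  assumes "nf_seq n ps"
  shows "exc (simple_word (nf_word ps)) = snd ` set ps"
    and "\<And>i j. (i, j) \<in> set ps \<Longrightarrow> simple_word (nf_word ps) j = Suc i"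
    and "bi_increasing (simple_word (nf_word ps))"
    and "card (invs (simple_word (nf_word ps))) = length (nf_word ps)"
proof -
  have "exc (simple_word (nf_word ps)) = snd ` set ps \<and>
    (\<forall>(i, j)\<in>set ps. simple_word (nf_word ps) j = Suc i) \<and>
    bi_increasing (simple_word (nf_word ps)) \<and>
    card (invs (simple_word (nf_word ps))) = length (nf_word ps)"
    using assms
  proof (induct ps arbitrary: n rule: rev_induct)
    case Nil
    have "invs id = {}" "exc id = {}" "bi_increasing id" by (auto simp: invs_def exc_def bi_increasing_def)
    moreover have "simple_word (nf_word []) = id" by (simp add: word_prod_Nil)
    ultimately show ?case by (simp only:) simp
  next
    case (snoc ij ps)
    obtain i j where ij: "ij = (i, j)" by (cases ij)
    have s: "nf_seq (i - 1) ps" "1 \<le> j" "j \<le> i" "\<And>a b. (a, b) \<in> set ps \<Longrightarrow> a < i \<and> b < j"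
      using nf_seq_snocD[of n ps i j] snoc(2) unfolding ij nf_seq_snoc by auto
    define w1 where "w1 = simple_word (nf_word ps)"
    define w where "w = simple_word (nf_word (ps @ [(i, j)]))"
    have IH: "exc w1 = snd ` set ps" "\<forall>(i, j)\<in>set ps. w1 j = Suc i" "bi_increasing w1"
      "card (invs w1) = length (nf_word ps)"
      using snoc(1)[OF s(1)] unfolding w1_def by blast+
    have per: "w1 permutes {1..i}"
      using permutes_simple_word[OF set_nf_word[OF s(1)]] s by (simp add: w1_def)
    have w: "w = w1 \<circ> simple_word (bracket i j)"
      unfolding w_def w1_def nf_word_snoc map_append word_prod_append ..
    have wp: "w p = (if p = j then i + 1 else if j < p \<and> p \<le> i + 1 then w1 (p - 1) else w1 p)" for p
      using simple_word_bracket[OF s(3), of p] permutes_not_in[OF per, of "i + 1"] by (simp add: w)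
    have e1: "p < j" if "p \<in> exc w1" for p using that s(4) unfolding IH(1) by auto
    have ne1: "w1 p \<le> p" if "j \<le> p" for p using e1[of p] that unfolding exc_def mem_Collect_eq by linarith
    have ne2: "w1 (p - 1) \<le> p" if "j < p" for p using ne1[of "p - 1"] that by linarith
    have ex: "p \<in> exc w \<longleftrightarrow> p = j \<or> p \<in> exc w1" for p
      using wp[of p] ne2[of p] ne1[of p] s(3) e1[of p]
      by (cases "p = j"; cases "p < j"; cases "p \<le> i + 1") (auto simp: exc_def)
    have "exc w = snd ` set (ps @ [(i, j)])" using ex IH(1) by auto
    moreover have "\<forall>(a, b)\<in>set (ps @ [(i, j)]). w b = Suc a"
      using wp s(4) IH(2) by fastforce
    moreover have "bi_increasing w"
      unfolding bi_increasing_def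
    proof (intro allI impI)
      fix p q assume pq: "p < q" "p \<in> exc w \<longleftrightarrow> q \<in> exc w"
      have inc: "w1 a < w1 b" if "a < b" "a \<in> exc w1 \<longleftrightarrow> b \<in> exc w1" for a b
        using IH(3) that unfolding bi_increasing_def by blast
      show "w p < w q"
      proof (cases "p \<in> exc w")
        case True
        then have *: "p = j \<or> p \<in> exc w1" "q = j \<or> q \<in> exc w1" using ex pq by auto
        then have "p \<in> exc w1" "p < j" using pq(1) e1[of q] e1[of p] by auto
        then have "w p = w1 p" using wp by simp
        show ?thesis
        proof (cases "q = j")
          case True
          have "w1 p \<in> {1..i}" using permutes_in_image[OF per, of p] permutes_exc_subset(1)[OF per] \<open>p \<in> exc w1\<close> by blast
          then show ?thesis using True wp[of q] \<open>w p = w1 p\<close> by simp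
        next
          case False
          then have "q \<in> exc w1" using * by simp
          then show ?thesis using inc[OF pq(1)] \<open>p \<in> exc w1\<close> \<open>w p = w1 p\<close> wp[of q] e1[of q] by simp
        qed
      next
        case False
        \<comment> \<open>The effect of the bracket on positions other than \<open>j\<close>; it is
          increasing there and keeps non-ascents among the non-ascents of \<open>w1\<close>.\<close>
        define f where "f r = (if j < r \<and> r \<le> i + 1 then r - 1 else r)" for r
        have n: "p \<noteq> j" "q \<noteq> j" "p \<notin> exc w1" "q \<notin> exc w1" using False pq ex by auto
        have "w p = w1 (f p)" "w q = w1 (f q)" using n wp by (auto simp: f_def)
        moreover have "f p < f q" using pq(1) n by (auto simp: f_def)
        moreover have "f p \<notin> exc w1" "f q \<notin> exc w1" using n e1[of "f p"] e1[of "f q"] by (auto simp: f_def split: if_splits)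
        ultimately show ?thesis using inc by simp
      qed
    qed
    moreover have "card (invs w) = length (nf_word (ps @ [(i, j)]))"
      using card_invs_comp_bracket[OF per s(2,3)] IH(4) s(3) unfolding w nf_word_snoc by simp
    ultimately show ?case unfolding ij w_def by blast
  qed
  then show "exc (simple_word (nf_word ps)) = snd ` set ps"
    "\<And>i j. (i, j) \<in> set ps \<Longrightarrow> simple_word (nf_word ps) j = Suc i"
    "bi_increasing (simple_word (nf_word ps))"
    "card (invs (simple_word (nf_word ps))) = length (nf_word ps)" by auto
qed

lemma nf_seq_eqI:
  assumes "nf_seq n ps" "nf_seq m qs" "fst ` set ps = fst ` set qs" "snd ` set ps = snd ` set qs"
  shows "ps = qs"
proof -
  have "map fst ps = map fst qs"
    by (rule strict_sorted_equal) (use assms in \<open>auto simp: nf_seq_def\<close>)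
  moreover have "map snd ps = map snd qs"
    by (rule strict_sorted_equal) (use assms in \<open>auto simp: nf_seq_def\<close>)
  ultimately show ?thesis by (metis zip_map_fst_snd)
qed

lemma nf_word_image_exc:
  assumes "nf_seq n ps"
  shows "simple_word (nf_word ps) ` exc (simple_word (nf_word ps)) = (\<lambda>i. i + 1) ` fst ` set ps"
  unfolding nf_word_properties(1)[OF assms] image_image
  using nf_word_properties(2)[OF assms] by (intro image_cong refl) auto

lemma nf_word_eqD:
  assumes "nf_seq n ps" "nf_seq n qs" "exc (simple_word (nf_word ps)) = exc (simple_word (nf_word qs))"
    "simple_word (nf_word ps) ` exc (simple_word (nf_word ps)) =
     simple_word (nf_word qs) ` exc (simple_word (nf_word qs))"
  shows "ps = qs"
proof (rule nf_seq_eqI[OF assms(1,2)])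
  show "snd ` set ps = snd ` set qs" using assms(3) nf_word_properties(1) assms(1,2) by metis
  have "(\<lambda>i. i + 1) ` fst ` set ps = (\<lambda>i. i + 1) ` fst ` set qs"
    using assms(4) nf_word_image_exc assms(1,2) by metis
  moreover have "inj (\<lambda>i. i + 1 :: nat)" by (simp add: inj_def)
  ultimately show "fst ` set ps = fst ` set qs" by (simp add: inj_image_eq_iff)
qed

text \<open>The last bracket is read off from the position \<open>j\<close> of the greatest value.
  Behind this position the values increase, for otherwise the greatest value would complete a 321
  pattern. Hence the ascents of the remaining permutation, which are the lower ends of the earlier
  brackets, all lie before \<open>j\<close>.\<close>

lemma avoids_321_nf_exists:
  assumes "w permutes {1..n+1}" "avoids_321 w"
  shows "\<exists>ps. nf_seq n ps \<and> simple_word (nf_word ps) = w"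
  using assms
proof (induct n arbitrary: w)
  case 0
  then have "w permutes {1}" by simp
  then have "w = id" by (simp add: permutes_sing)
  then show ?case by (intro exI[of _ "[]"]) (simp add: word_prod_Nil)
next
  case (Suc n)
  note w = Suc(2)
  have inj: "inj w" using permutes_inj[OF w] .
  let ?M = "n + 2"
  define j where "j = perm_inv w ?M"
  have wj: "w j = ?M" by (simp add: j_def permutes_inverses[OF w])
  have j: "1 \<le> j" "j \<le> ?M" using permutes_in_image[OF w, of j] wj by auto
  show ?case
  proof (cases "j = ?M")
    case True
    then have "w permutes {1..n+1}"
      using wj by (intro permutes_superset[OF w]) (auto simp: le_Suc_eq)
    from Suc(1)[OF this Suc(3)] show ?thesis using nf_seq_mono by (metis le_SucI order_refl)
  next
    case False
    then have jn: "j \<le> n + 1" using j by simp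
    let ?C = "simple_word (bracket (n+1) j)"
    \<comment> \<open>The greatest value is deleted and the later values move up one position to the
      left.\<close>
    define w1 where "w1 = (\<lambda>p. if p < j then w p else if p \<le> n + 1 then w (p + 1) else p)"
    have wC: "w = w1 \<circ> ?C"
    proof
      fix p
      show "w p = (w1 \<circ> ?C) p"
        using simple_word_bracket[OF jn, of p] wj jn permutes_not_in[OF w, of p] by (auto simp: w1_def)
    qed
    have C: "?C permutes {1..Suc n+1}" using j by (intro permutes_simple_word) auto
    have "w1 \<circ> ?C \<circ> perm_inv ?C = w1" using permutes_inv_o(1)[OF C] by (metis comp_assoc comp_id)
    then have "w1 = w \<circ> perm_inv ?C" unfolding wC by (rule sym)
    then have "w1 permutes {1..Suc n+1}" using permutes_compose[OF permutes_inv[OF C] w] by simp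
    then have p1: "w1 permutes {1..n+1}"
      by (rule permutes_superset) (use jn in \<open>auto simp: w1_def\<close>)
    have av: "avoids_321 w1"
      unfolding avoids_321_def
    proof clarify
      fix p q r assume "(p, q) \<in> invs w1" "(q, r) \<in> invs w1"
      then have pqr: "p < q" "q < r" "w1 q < w1 p" "w1 r < w1 q" by (auto simp: invs_def)
      have "r \<le> n + 1"
      proof (rule ccontr)
        assume *: "\<not> r \<le> n + 1"
        then have "w1 r = r" using jn by (simp add: w1_def)
        then have "r < w1 q" using pqr by simp
        moreover have "w1 q \<le> n + 1 \<or> w1 q = q" using permutes_in_image[OF p1, of q] permutes_not_in[OF p1, of q] by auto
        ultimately show False using * pqr by auto
      qed
      define f where "f s = (if s < j then s else s + 1)" for s
      have f: "w1 s = w (f s)" if "s \<le> n + 1" for s using that by (simp add: w1_def f_def)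
      have "f p < f q" "f q < f r" using pqr by (auto simp: f_def)
      then have "(f p, f q) \<in> invs w" "(f q, f r) \<in> invs w"
        using f[of p] f[of q] f[of r] pqr \<open>r \<le> n + 1\<close> by (auto simp: invs_def)
      then show False using Suc(3) unfolding avoids_321_def by blast
    qed
    obtain ps where ps: "nf_seq n ps" "simple_word (nf_word ps) = w1" using Suc(1)[OF p1 av] by blast
    have inc: "w1 p < w1 (Suc p)" if "j \<le> p" "p < n + 1" for p
    proof (rule ccontr)
      assume *: "\<not> w1 p < w1 (Suc p)"
      have e: "w1 p = w (Suc p)" "w1 (Suc p) = w (Suc (Suc p))" using that by (auto simp: w1_def)
      moreover have "w (Suc p) \<noteq> w (Suc (Suc p))" using injD[OF inj, of "Suc p" "Suc (Suc p)"] by auto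
      ultimately have "(Suc p, Suc (Suc p)) \<in> invs w" using * by (auto simp: invs_def)
      moreover have "w (Suc p) < ?M"
      proof -
        have "w (Suc p) \<in> {1..Suc n+1}" using permutes_in_image[OF w, of "Suc p"] that j by auto
        moreover have "w (Suc p) \<noteq> ?M" using injD[OF inj, of "Suc p" j] wj that by auto
        ultimately show ?thesis by auto
      qed
      then have "(j, Suc p) \<in> invs w" using wj that by (auto simp: invs_def)
      ultimately show False using Suc(3) unfolding avoids_321_def by blast
    qed
    \<comment> \<open>From \<open>j\<close> up to \<open>n + 1\<close> the values increase and never
      exceed \<open>n + 1\<close>, so descending induction from \<open>n + 1\<close> bounds each
      value by its position.\<close>
    have le: "w1 p \<le> p" if "j \<le> p" for p
    proof (cases "p \<le> n + 1")
      case True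
      from True that show ?thesis
      proof (induct p rule: inc_induct)
        case base
        then show ?case using permutes_in_image[OF p1, of "n+1"] by auto
      next
        case (step m)
        then show ?case using inc[of m] by simp
      qed
    next
      case False
      then show ?thesis using that by (simp add: w1_def)
    qed
    have "b < j \<and> a < n + 1" if "(a, b) \<in> set ps" for a b
    proof
      have "b \<in> exc w1" using nf_word_properties(1)[OF ps(1)] that ps(2) by force
      then show "b < j" using le[of b] by (force simp: exc_def)
      show "a < n + 1" using that ps(1) by (auto simp: nf_seq_def)
    qed
    then have "nf_seq (Suc n) (ps @ [(n+1, j)])"
      using nf_seq_mono[OF ps(1), of "Suc n"] j jn unfolding nf_seq_snoc by auto
    moreover have "simple_word (nf_word (ps @ [(n+1, j)])) = w"
      unfolding nf_word_snoc map_append word_prod_append ps(2) wC[symmetric] ..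
    ultimately show ?thesis by blast
  qed
qed

lemma normal_form_nf_word:
  assumes ps: "nf_seq n ps"
  shows "simple_word (nf_word ps) \<in> fully_commutative n"
    "normal_form n (simple_word (nf_word ps)) = ps"
proof -
  let ?w = "simple_word (nf_word ps)"
  have w: "?w permutes {1..n+1}" using permutes_simple_word[OF set_nf_word[OF ps]] .
  show "?w \<in> fully_commutative n"
    using fully_commutative_if_avoids_321[OF w] bi_increasing_avoids_321 nf_word_properties(3)[OF ps] by blast
  show "normal_form n ?w = ps"
    unfolding normal_form_def
  proof (rule the_equality)
    show "is_normal_form n ?w ps"
      unfolding is_normal_form_iff[OF w] using ps nf_word_properties(4)[OF ps] by simp
  next
    fix qs assume "is_normal_form n ?w qs"
    then have q: "nf_seq n qs" "simple_word (nf_word qs) = ?w" unfolding is_normal_form_iff[OF w] by auto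
    show "qs = ps" by (rule nf_word_eqD[OF q(1) ps]) (simp_all only: q(2))
  qed
qed

lemma fully_commutative_nf:
  assumes "w \<in> fully_commutative n"
  shows "nf_seq n (normal_form n w)" "simple_word (nf_word (normal_form n w)) = w"
proof -
  have w: "w permutes {1..n+1}" using assms unfolding fully_commutative_def Wgrp_iff by blast
  obtain ps where ps: "nf_seq n ps" "simple_word (nf_word ps) = w"
    using avoids_321_nf_exists[OF w fully_commutative_avoids_321[OF assms]] by blast
  then show "nf_seq n (normal_form n w)" "simple_word (nf_word (normal_form n w)) = w"
    using normal_form_nf_word(2)[OF ps(1)] by auto
qed

section \<open>Fully commutative elements and their noncrossing partners\<close>

lemma fully_commutative_permutes: "w \<in> fully_commutative n \<Longrightarrow> w permutes {1..n+1}"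
  unfolding fully_commutative_def Wgrp_iff by blast

lemma finite_fully_commutative: "finite (fully_commutative n)"
  by (rule finite_subset[OF _ finite_permutations[of "{1..n+1}"]]) (auto dest: fully_commutative_permutes)

lemma exc_ballot:
  assumes "w permutes {1..N}"
  shows "card (w ` exc w \<inter> {..m}) \<le> card (exc w \<inter> {..<m})"
proof -
  have "w ` exc w \<inter> {..m} \<subseteq> w ` (exc w \<inter> {..<m})" by (auto simp: exc_def)
  then have "card (w ` exc w \<inter> {..m}) \<le> card (w ` (exc w \<inter> {..<m}))" by (intro card_mono) auto
  also have "\<dots> \<le> card (exc w \<inter> {..<m})" by (rule card_image_le) simp
  finally show ?thesis .
qed

text \<open>The ascents of any permutation satisfy the ballot condition, so a noncrossing
  permutation with the same two sets exists; the normal form identifies these sets with J_w and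
  I_w[1].\<close>

lemma psi_fully_commutative:
  assumes w: "w \<in> fully_commutative n"
  shows "nc_perm (psi n w)" "psi n w permutes {1..n+1}" "exc (psi n w) = exc w"
    "psi n w ` exc (psi n w) = w ` exc w"
proof -
  note p = fully_commutative_permutes[OF w]
  have card: "card (exc w) = card (w ` exc w)"
    using card_image[of w "exc w"] permutes_inj_on[OF p] by metis
  obtain x where x: "nc_perm x" "x permutes {1..n+1}" "exc x = exc w" "x ` exc x = w ` exc w"
    using nc_perm_exists[OF permutes_exc_subset[OF p] card exc_ballot[OF p]] by blast
  note nf = fully_commutative_nf[OF w]
  have "exc x = J_set n w" unfolding x(3) J_set_def using nf_word_properties(1)[OF nf(1)] nf(2) by metis
  moreover have "x ` exc x = (\<lambda>i. i + 1) ` I_set n w"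
    unfolding x(4) I_set_def using nf_word_image_exc[OF nf(1)] nf(2) by metis
  ultimately have "psi n w = x" using psi_eqI[OF x(1,2)] by blast
  then show "nc_perm (psi n w)" "psi n w permutes {1..n+1}" "exc (psi n w) = exc w"
    "psi n w ` exc (psi n w) = w ` exc w" using x by auto
qed

lemma psi_inj:
  assumes "u \<in> fully_commutative n" "w \<in> fully_commutative n" "psi n u = psi n w"
  shows "u = w"
proof -
  note nu = fully_commutative_nf[OF assms(1)] and nw = fully_commutative_nf[OF assms(2)]
  have "u ` exc u = psi n w ` exc (psi n w)"
    using psi_fully_commutative(4)[OF assms(1)] unfolding assms(3) by (rule sym)
  also have "\<dots> = w ` exc w" by (rule psi_fully_commutative(4)[OF assms(2)])
  finally have e1: "u ` exc u = w ` exc w" .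
  have e2: "exc u = exc w"
    using psi_fully_commutative(3)[OF assms(1)] psi_fully_commutative(3)[OF assms(2)]
    unfolding assms(3) by metis
  have "normal_form n u = normal_form n w"
    by (rule nf_word_eqD[OF nu(1) nw(1)]; unfold nu(2) nw(2)) (rule e2 e1)+
  then show ?thesis using nu(2) nw(2) by metis
qed

lemma fully_commutative_bi_increasing:
  "w \<in> fully_commutative n \<Longrightarrow> bi_increasing w"
  using fully_commutative_nf nf_word_properties(3) by metis

lemma bi_increasing_inversion:
  assumes "bi_increasing w" "p < q" "w q < w p"
  shows "p \<in> exc w" "q \<notin> exc w"
  using assms unfolding bi_increasing_def exc_def by force+

text \<open>A left descent is an inversion between the positions of \<open>i\<close> and
  \<open>Suc i\<close>, hence leads from an ascent to a non-ascent. The conclusion is the hypothesis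
  of the left toggle, and it passes to \<open>psi n w\<close> because only the ascent values occur
  in it.\<close>

lemma left_descents_fully_commutative:
  assumes w: "w \<in> fully_commutative n" and s: "s \<in> left_descents n w"
  obtains i where "i \<in> {1..n}" "s = simple_refl i" "Suc i \<in> w ` exc w" "i \<notin> w ` exc w"
proof -
  note p = fully_commutative_permutes[OF w]
  note pw = permutes_inverses[OF p]
  obtain i where i: "i \<in> {1..n}" "s = simple_refl i" "perm_inv w (Suc i) < perm_inv w i"
    using left_descents_imp[OF p s] by blast
  note b = bi_increasing_inversion[OF fully_commutative_bi_increasing[OF w] i(3)]
  have e: "perm_inv w (Suc i) \<in> exc w" "perm_inv w i \<notin> exc w" using b pw by simp_all
  then have "Suc i \<in> w ` exc w" using pw by (metis imageI)
  moreover have "i \<notin> w ` exc w" using e(2) pw by auto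
  ultimately show thesis using that i by blast
qed

lemma right_descents_fully_commutative:
  assumes w: "w \<in> fully_commutative n" and s: "s \<in> right_descents n w"
  obtains i where "i \<in> {1..n}" "s = simple_refl i" "i \<in> exc w" "Suc i \<notin> exc w"
proof -
  note p = fully_commutative_permutes[OF w]
  obtain i where i: "i \<in> {1..n}" "s = simple_refl i" "w (Suc i) < w i"
    using right_descents_imp[OF p s] by blast
  then show thesis
    using that bi_increasing_inversion[OF fully_commutative_bi_increasing[OF w], of i "Suc i"] by simp
qed

section \<open>The Temperley-Lieb algebra\<close>

lemma poly_mapping_sum_single:
  fixes p :: "'a \<Rightarrow>\<^sub>0 'b::comm_monoid_add"
  shows "(\<Sum>w\<in>Poly_Mapping.keys p. Poly_Mapping.single w (Poly_Mapping.lookup p w)) = p"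
proof (rule poly_mapping_eqI)
  fix w
  have "(\<Sum>u\<in>Poly_Mapping.keys p. Poly_Mapping.lookup p u when u = w) = Poly_Mapping.lookup p w"
    by (simp add: when_def in_keys_iff)
  then show "Poly_Mapping.lookup (\<Sum>u\<in>Poly_Mapping.keys p. Poly_Mapping.single u (Poly_Mapping.lookup p u)) w =
      Poly_Mapping.lookup p w"
    by (simp add: lookup_sum lookup_single)
qed

lemma poly_mapping_single_add_induct:
  fixes p :: "'a \<Rightarrow>\<^sub>0 'b::comm_monoid_add"
  assumes "\<And>w c. P (Poly_Mapping.single w c)" "\<And>p q. P p \<Longrightarrow> P q \<Longrightarrow> P (p + q)" "P 0"
  shows "P p"
proof -
  have "P (\<Sum>w\<in>A. Poly_Mapping.single w (Poly_Mapping.lookup p w))" for A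
    by (induct A rule: infinite_finite_induct) (use assms in auto)
  then show ?thesis using poly_mapping_sum_single[of p] by metis
qed

lemma scal_simps:
  "scal 0 = 0" "scal 1 = 1" "scal (a + b) = scal a + scal b" "scal (a * b) = scal a * scal b"
  "scal (- a) = - scal a" "scal (a - b) = scal a - scal b"
  by (simp_all add: scal_def single_add mult_single single_diff single_uminus)

lemma scal_commute: "p * scal a = scal a * (p :: free_elt)"
proof (induct p rule: poly_mapping_single_add_induct)
  case (1 w c)
  show ?case by (simp add: scal_def mult_single mult.commute)
qed (simp_all add: distrib_left distrib_right)

lemma v_pow_add: "v_pow (a + b) = v_pow a * v_pow b"
  by (simp add: v_pow_def mult_single)

lemma v_pow_0: "v_pow 0 = 1"
  by (simp add: v_pow_def)

lemma v_pow_inverse: "v_pow 1 * v_pow (- 1) = 1" "v_pow (- 1) * v_pow 1 = 1"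
  by (simp_all add: v_pow_0 flip: v_pow_add)

section \<open>Congruence modulo the Temperley-Lieb ideal\<close>

text \<open>Calculations use representatives, where ordinary ring arithmetic is available; they are
  transferred to cosets only at the end.\<close>

definition tl_eq :: "nat \<Rightarrow> free_elt \<Rightarrow> free_elt \<Rightarrow> bool"
  where "tl_eq n p q \<longleftrightarrow> p - q \<in> TL_ideal n"

lemma TL_ideal_closed:
  assumes "p \<in> TL_ideal n"
  shows "p \<in> carrier (free_alg n)" "q \<in> TL_ideal n \<Longrightarrow> p + q \<in> TL_ideal n" "- p \<in> TL_ideal n"
    "q \<in> carrier (free_alg n) \<Longrightarrow> q * p \<in> TL_ideal n" "q \<in> carrier (free_alg n) \<Longrightarrow> p * q \<in> TL_ideal n"
proof -
  interpret I: ideal "TL_ideal n" "free_alg n" by (rule ideal_TL)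
  show pc: "p \<in> carrier (free_alg n)" using I.Icarr[OF assms] .
  show "q \<in> TL_ideal n \<Longrightarrow> p + q \<in> TL_ideal n" using additive_subgroup.a_closed[OF I.additive_subgroup_axioms assms] by simp
  show "q \<in> carrier (free_alg n) \<Longrightarrow> q * p \<in> TL_ideal n" using I.I_l_closed[OF assms] by simp
  show "q \<in> carrier (free_alg n) \<Longrightarrow> p * q \<in> TL_ideal n" using I.I_r_closed[OF assms] by simp
  have "- 1 \<in> carrier (free_alg n)"
    using scal_closed[of "- 1" n] by (simp add: scal_simps)
  from I.I_l_closed[OF assms this] show "- p \<in> TL_ideal n" by simp
qed

lemma zero_in_TL_ideal: "0 \<in> TL_ideal n"
proof -
  interpret I: ideal "TL_ideal n" "free_alg n" by (rule ideal_TL)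
  show ?thesis using additive_subgroup.zero_closed[OF I.additive_subgroup_axioms] by simp
qed

lemma tl_eq_refl [simp]: "tl_eq n p p"
  by (simp add: tl_eq_def zero_in_TL_ideal)

lemma tl_eq_sym: "tl_eq n p q \<Longrightarrow> tl_eq n q p"
  using TL_ideal_closed(3) unfolding tl_eq_def by fastforce

lemma tl_eq_trans: "tl_eq n p q \<Longrightarrow> tl_eq n q r \<Longrightarrow> tl_eq n p r"
  using TL_ideal_closed(2)[of "p - q" n "q - r"] unfolding tl_eq_def by simp

lemma tl_eq_mult:
  assumes "tl_eq n p q" "u \<in> carrier (free_alg n)" "z \<in> carrier (free_alg n)"
  shows "tl_eq n (u * p * z) (u * q * z)"
proof -
  have "u * (p - q) * z \<in> TL_ideal n"
    using TL_ideal_closed(5)[OF TL_ideal_closed(4)[OF _ assms(2)] assms(3)] assms(1)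
    unfolding tl_eq_def by blast
  then show ?thesis unfolding tl_eq_def by (simp add: algebra_simps)
qed

lemma tl_eq_scal:
  assumes "tl_eq n p q"
  shows "tl_eq n (scal a * p) (scal a * q)"
  using tl_eq_mult[OF assms scal_closed[of a] scal_closed[of 1]] by (simp add: scal_simps)

lemma TL_relations:
  "i \<in> {1..n} \<Longrightarrow> j \<in> {1..n} \<Longrightarrow> \<bar>int i - int j\<bar> = 1 \<Longrightarrow>
    free_gen j * free_gen i * free_gen j - free_gen j \<in> TL_ideal n"
  "i \<in> {1..n} \<Longrightarrow> j \<in> {1..n} \<Longrightarrow> \<bar>int i - int j\<bar> > 1 \<Longrightarrow>
    free_gen i * free_gen j - free_gen j * free_gen i \<in> TL_ideal n"
  "i \<in> {1..n} \<Longrightarrow>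
    free_gen i * free_gen i - scal (v_pow 1 + v_pow (- 1)) * free_gen i \<in> TL_ideal n"
proof -
  have sub: "TL_relators n \<subseteq> TL_ideal n"
    unfolding TL_ideal_def by (rule ring.genideal_self[OF ring_free_alg TL_relators_subset])
  show "i \<in> {1..n} \<Longrightarrow> j \<in> {1..n} \<Longrightarrow> \<bar>int i - int j\<bar> = 1 \<Longrightarrow>
      free_gen j * free_gen i * free_gen j - free_gen j \<in> TL_ideal n"
    by (rule subsetD[OF sub]) (unfold TL_relators_def, blast)
  show "i \<in> {1..n} \<Longrightarrow> j \<in> {1..n} \<Longrightarrow> \<bar>int i - int j\<bar> > 1 \<Longrightarrow>
      free_gen i * free_gen j - free_gen j * free_gen i \<in> TL_ideal n"
    by (rule subsetD[OF sub]) (unfold TL_relators_def, blast)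
  show "i \<in> {1..n} \<Longrightarrow>
      free_gen i * free_gen i - scal (v_pow 1 + v_pow (- 1)) * free_gen i \<in> TL_ideal n"
    by (rule subsetD[OF sub]) (unfold TL_relators_def, blast)
qed

definition tl_class :: "nat \<Rightarrow> free_elt \<Rightarrow> free_elt set"
  where "tl_class n p = TL_ideal n +>\<^bsub>free_alg n\<^esub> p"

lemma tl_class_hom:
  assumes "p \<in> carrier (free_alg n)" "q \<in> carrier (free_alg n)"
  shows "tl_class n p \<in> carrier (TL n)"
    "tl_class n (p + q) = tl_class n p \<oplus>\<^bsub>TL n\<^esub> tl_class n q"
    "tl_class n (p * q) = tl_class n p \<otimes>\<^bsub>TL n\<^esub> tl_class n q"
    "tl_class n (p - q) = tl_class n p \<ominus>\<^bsub>TL n\<^esub> tl_class n q"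
    "tl_class n (scal a * p) = a \<odot>\<^bsub>TL n\<^esub> tl_class n p"
proof -
  interpret h: ring_hom_ring "free_alg n" "free_alg n Quot TL_ideal n" "(+>\<^bsub>free_alg n\<^esub>) (TL_ideal n)"
    by (rule ideal.rcos_ring_hom_ring[OF ideal_TL])
  interpret T: ring "TL n" by (rule ring_TL)
  show cl: "tl_class n p \<in> carrier (TL n)" using h.hom_closed[OF assms(1)] by (simp add: tl_class_def)
  show "tl_class n (p + q) = tl_class n p \<oplus>\<^bsub>TL n\<^esub> tl_class n q"
    using h.hom_add[OF assms] by (simp add: tl_class_def)
  show "tl_class n (p * q) = tl_class n p \<otimes>\<^bsub>TL n\<^esub> tl_class n q"
    using h.hom_mult[OF assms] by (simp add: tl_class_def)
  have add: "tl_class n (p + r) = tl_class n p \<oplus>\<^bsub>TL n\<^esub> tl_class n r" 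
    if "p \<in> carrier (free_alg n)" "r \<in> carrier (free_alg n)" for p r
    using h.hom_add[OF that] by (simp add: tl_class_def)
  have clo: "tl_class n r \<in> carrier (TL n)" if "r \<in> carrier (free_alg n)" for r
    using h.hom_closed[OF that] by (simp add: tl_class_def)
  have zero: "tl_class n 0 = \<zero>\<^bsub>TL n\<^esub>" using h.hom_zero by (simp add: tl_class_def)
  have "tl_class n (- q) \<oplus>\<^bsub>TL n\<^esub> tl_class n q = \<zero>\<^bsub>TL n\<^esub>"
    using add[OF free_alg_closed(3)[OF assms(2,2)] assms(2)] zero by (simp del: TL_sel)
  then have "\<ominus>\<^bsub>TL n\<^esub> tl_class n q = tl_class n (- q)"
    using T.minus_equality clo[OF free_alg_closed(3)[OF assms(2,2)]] clo[OF assms(2)] by blast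
  then show "tl_class n (p - q) = tl_class n p \<ominus>\<^bsub>TL n\<^esub> tl_class n q"
    using add[OF assms(1) free_alg_closed(3)[OF assms(2,2)]] by (simp add: a_minus_def del: TL_sel)
  show "tl_class n (scal a * p) = a \<odot>\<^bsub>TL n\<^esub> tl_class n p"
    using h.hom_mult[OF scal_closed assms(1), of a] by (simp add: tl_class_def)
qed

lemma tl_class_one: "tl_class n 1 = \<one>\<^bsub>TL n\<^esub>"
  and tl_class_zero: "tl_class n 0 = \<zero>\<^bsub>TL n\<^esub>"
proof -
  interpret h: ring_hom_ring "free_alg n" "free_alg n Quot TL_ideal n" "(+>\<^bsub>free_alg n\<^esub>) (TL_ideal n)"
    by (rule ideal.rcos_ring_hom_ring[OF ideal_TL])
  show "tl_class n 1 = \<one>\<^bsub>TL n\<^esub>" "tl_class n 0 = \<zero>\<^bsub>TL n\<^esub>"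
    using h.hom_one h.hom_zero by (simp_all add: tl_class_def)
qed

lemma tl_class_eqI:
  assumes "tl_eq n p q" "p \<in> carrier (free_alg n)" "q \<in> carrier (free_alg n)"
  shows "tl_class n p = tl_class n q"
proof -
  interpret I: ideal "TL_ideal n" "free_alg n" by (rule ideal_TL)
  interpret R: ring "free_alg n" by (rule ring_free_alg)
  have "p \<in> TL_ideal n +>\<^bsub>free_alg n\<^esub> q"
    using assms unfolding tl_eq_def a_r_coset_def' by (auto intro!: bexI[of _ "p - q"])
  then show ?thesis unfolding tl_class_def using I.a_repr_independence'[OF _ assms(3)] by simp
qed

lemma mem_tl_class: "q \<in> tl_class n p \<longleftrightarrow> tl_eq n q p"
  unfolding tl_class_def tl_eq_def a_r_coset_def' by force

lemma carrier_TL_eq: "carrier (TL n) = tl_class n ` carrier (free_alg n)"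
  by (auto simp: tl_class_def FactRing_def A_RCOSETS_def')

lemma carrier_free_alg_sum:
  "(\<And>i. i \<in> A \<Longrightarrow> f i \<in> carrier (free_alg n)) \<Longrightarrow> sum f A \<in> carrier (free_alg n)"
proof (induct A rule: infinite_finite_induct)
  case (insert x F)
  then show ?case using free_alg_closed(1) by simp
qed (use zero_in_TL_ideal TL_ideal_closed(1) in auto)

lemma finsum_tl_class:
  assumes "finite A" "\<And>i. i \<in> A \<Longrightarrow> f i \<in> carrier (free_alg n)"
  shows "finsum (TL n) (\<lambda>i. tl_class n (f i)) A = tl_class n (sum f A)"
  using assms
proof (induct A)
  case empty
  interpret T: ring "TL n" by (rule ring_TL)
  show ?case using tl_class_zero by (simp del: TL_sel)
next
  case (insert x F)
  interpret T: ring "TL n" by (rule ring_TL)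
  have s: "sum f F \<in> carrier (free_alg n)" using insert by (intro carrier_free_alg_sum) auto
  have x: "f x \<in> carrier (free_alg n)" using insert by auto
  have "finsum (TL n) (\<lambda>i. tl_class n (f i)) (insert x F) =
      tl_class n (f x) \<oplus>\<^bsub>TL n\<^esub> finsum (TL n) (\<lambda>i. tl_class n (f i)) F"
    using insert by (intro T.finsum_insert) (auto intro!: tl_class_hom(1) simp del: TL_sel)
  also have "\<dots> = tl_class n (f x) \<oplus>\<^bsub>TL n\<^esub> tl_class n (sum f F)"
    using insert by (simp del: TL_sel)
  also have "\<dots> = tl_class n (f x + sum f F)" using tl_class_hom(2)[OF x s] by simp
  finally show ?case using insert by (simp del: TL_sel)
qed

section \<open>Braid words in the Temperley-Lieb algebra\<close>

definition braid_letter :: "nat \<times> bool \<Rightarrow> free_elt"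
  where "braid_letter = (\<lambda>(i, e). scal (v_pow (if e then - 1 else 1)) - free_gen i)"

definition braid_image :: "braid_word \<Rightarrow> free_elt"
  where "braid_image w = prod_list (map braid_letter w)"

lemma braid_image_simps [simp]:
  "braid_image [] = 1" "braid_image (l # w) = braid_letter l * braid_image w"
  "braid_image (u @ w) = braid_image u * braid_image w"
  by (simp_all add: braid_image_def)

lemma carrier_free_alg_diff:
  "p \<in> carrier (free_alg n) \<Longrightarrow> q \<in> carrier (free_alg n) \<Longrightarrow> p - q \<in> carrier (free_alg n)"
  using free_alg_closed(1)[OF _ free_alg_closed(3)] by (metis diff_conv_add_uminus)

lemma braid_letter_closed: "fst l \<in> {1..n} \<Longrightarrow> braid_letter l \<in> carrier (free_alg n)"
  by (cases l) (auto simp: braid_letter_def intro!: carrier_free_alg_diff scal_closed free_gen_closed)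

lemma one_free_alg: "1 \<in> carrier (free_alg n)"
  using scal_closed[of 1 n] by (simp add: scal_simps)

lemma braid_words_simps:
  "[] \<in> braid_words n" "l # w \<in> braid_words n \<longleftrightarrow> fst l \<in> {1..n} \<and> w \<in> braid_words n"
  "u @ w \<in> braid_words n \<longleftrightarrow> u \<in> braid_words n \<and> w \<in> braid_words n"
  by (auto simp: braid_words_def)

lemma braid_image_closed: "w \<in> braid_words n \<Longrightarrow> braid_image w \<in> carrier (free_alg n)"
proof (induct w)
  case (Cons l w)
  then show ?case using braid_letter_closed[of l n] free_alg_closed(2) by (simp add: braid_words_simps)
qed (simp add: one_free_alg)

lemma omega_word_eq: "w \<in> braid_words n \<Longrightarrow> omega_word n w = tl_class n (braid_image w)"
proof (induct w)
  case Nil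
  then show ?case by (simp add: omega_word_def tl_class_one del: TL_sel)
next
  case (Cons l w)
  obtain i e where l: "l = (i, e)" by (cases l)
  have w: "fst l \<in> {1..n}" "w \<in> braid_words n" using Cons by (auto simp: braid_words_simps)
  then have g: "free_gen i \<in> carrier (free_alg n)" using free_gen_closed l by simp
  let ?a = "v_pow (if e then - 1 else 1)"
  have "omega_letter n l = tl_class n (scal ?a * 1) \<ominus>\<^bsub>TL n\<^esub> tl_class n (free_gen i)"
    unfolding omega_letter_def l prod.case tl_class_hom(5)[OF one_free_alg one_free_alg] tl_class_one
    by (simp add: TL_gen_def tl_class_def del: TL_sel)
  also have "\<dots> = tl_class n (braid_letter l)"
    using tl_class_hom(4)[OF free_alg_closed(2)[OF scal_closed one_free_alg] g]
    by (simp add: braid_letter_def l del: TL_sel)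
  finally have "omega_letter n l = tl_class n (braid_letter l)" .
  moreover have "omega_word n (l # w) = omega_letter n l \<otimes>\<^bsub>TL n\<^esub> omega_word n w"
    by (simp add: omega_word_def del: TL_sel)
  ultimately show ?case
    using Cons(1)[OF w(2)] tl_class_hom(3)[OF braid_letter_closed[OF w(1)] braid_image_closed[OF w(2)]]
    by (simp del: TL_sel)
qed

lemma braid_move_tl_eq:
  assumes "braid_move n x y"
  shows "x \<in> braid_words n \<longleftrightarrow> y \<in> braid_words n"
    "x \<in> braid_words n \<Longrightarrow> tl_eq n (braid_image x) (braid_image y)"
proof -
  let ?v = "scal (v_pow 1)" and ?w = "scal (v_pow (- 1))"
  have vw: "?v * ?w = 1" "?w * ?v = 1" using v_pow_inverse scal_simps(2,4) by metis+
  define d where "d = scal (v_pow 1 + v_pow (- 1))"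
  have d: "d = ?v + ?w" by (simp add: d_def scal_simps)
  have "(x \<in> braid_words n \<longleftrightarrow> y \<in> braid_words n) \<and>
    (x \<in> braid_words n \<longrightarrow> tl_eq n (braid_image x) (braid_image y))"
    using assms
  proof cases
    case (cancel i us e vs)
    let ?b = "free_gen i"
    have q: "?b * ?b - d * ?b \<in> TL_ideal n" unfolding d_def by (rule TL_relations(3)[OF cancel(3)])
    have "braid_image [(i, e), (i, \<not> e)] = 1 + (?b * ?b - d * ?b)"
      using vw scal_commute[of ?b "v_pow 1"] scal_commute[of ?b "v_pow (- 1)"]
      by (cases e) (simp_all add: braid_letter_def d algebra_simps)
    then have e: "tl_eq n (braid_image [(i, e), (i, \<not> e)]) 1" using q by (simp add: tl_eq_def)
    have "tl_eq n (braid_image us * braid_image [(i, e), (i, \<not> e)] * braid_image vs)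
        (braid_image us * 1 * braid_image vs)" if "us @ vs \<in> braid_words n"
      using that by (intro tl_eq_mult e braid_image_closed) (auto simp: braid_words_simps)
    then show ?thesis using cancel by (auto simp: braid_words_simps mult.assoc)
  next
    case (commute i j us vs)
    let ?b = "free_gen i" and ?c = "free_gen j"
    have q: "?b * ?c - ?c * ?b \<in> TL_ideal n" by (rule TL_relations(2)[OF commute(3-5)])
    have "braid_image [(i, True), (j, True)] - braid_image [(j, True), (i, True)] = ?b * ?c - ?c * ?b"
      using scal_commute[of ?b "v_pow (- 1)"] scal_commute[of ?c "v_pow (- 1)"]
      by (simp add: braid_letter_def algebra_simps)
    then have e: "tl_eq n (braid_image [(i, True), (j, True)]) (braid_image [(j, True), (i, True)])"
      using q by (simp add: tl_eq_def)
    have "tl_eq n (braid_image us * braid_image [(i, True), (j, True)] * braid_image vs)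
        (braid_image us * braid_image [(j, True), (i, True)] * braid_image vs)" if "us @ vs \<in> braid_words n"
      using that by (intro tl_eq_mult e braid_image_closed) (auto simp: braid_words_simps)
    then show ?thesis using commute by (auto simp: braid_words_simps mult.assoc)
  next
    case (braid i j us vs)
    let ?b = "free_gen i" and ?c = "free_gen j"
    have ji: "\<bar>int j - int i\<bar> = 1" using braid(5) by simp
    have bb: "?b * ?b - d * ?b \<in> TL_ideal n" "?c * ?c - d * ?c \<in> TL_ideal n"
      unfolding d_def using TL_relations(3) braid(3,4) by blast+
    have bcb: "?b * ?c * ?b - ?b \<in> TL_ideal n" "?c * ?b * ?c - ?c \<in> TL_ideal n"
      using TL_relations(1)[OF braid(4,3) ji] TL_relations(1)[OF braid(3,4,5)] by blast+
    have "?w * (?b * ?b - d * ?b) \<in> TL_ideal n" "?w * (?c * ?c - d * ?c) \<in> TL_ideal n"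
      using TL_ideal_closed(4)[OF _ scal_closed] bb by blast+
    \<comment> \<open>This combination of relators is the difference of the two sides of the braid
      relation: expanding leaves \<open>v^-1\<close> times the difference of the squares, and since
      \<open>v^-1 (v + v^-1) = 1 + v^-2\<close>, reducing the squares cancels the terms with
      \<open>v^-2\<close> and produces the linear terms of the cubic relators.\<close>
    then have q: "?w * (?b * ?b - d * ?b) + - (?w * (?c * ?c - d * ?c)) + - (?b * ?c * ?b - ?b) +
        (?c * ?b * ?c - ?c) \<in> TL_ideal n"
      using bcb by (intro TL_ideal_closed(2,3))
    have sw: "?b * ?w = ?w * ?b" "?c * ?w = ?w * ?c" "?b * (?w * z) = ?w * (?b * z)"
      "?c * (?w * z) = ?w * (?c * z)" for z
      using scal_commute by (metis mult.assoc)+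
    have wd: "?w * (d * z) = z + ?w * (?w * z)" for z
      using vw(2) by (simp add: d distrib_right distrib_left flip: mult.assoc)
    have "braid_image [(i, True), (j, True), (i, True)] - braid_image [(j, True), (i, True), (j, True)] =
      ?w * (?b * ?b - d * ?b) + - (?w * (?c * ?c - d * ?c)) + - (?b * ?c * ?b - ?b) + (?c * ?b * ?c - ?c)"
      by (simp add: braid_letter_def algebra_simps sw wd)
    then have e: "tl_eq n (braid_image [(i, True), (j, True), (i, True)])
        (braid_image [(j, True), (i, True), (j, True)])"
      using q by (simp add: tl_eq_def)
    have "tl_eq n (braid_image us * braid_image [(i, True), (j, True), (i, True)] * braid_image vs)
        (braid_image us * braid_image [(j, True), (i, True), (j, True)] * braid_image vs)"
      if "us @ vs \<in> braid_words n"
      using that by (intro tl_eq_mult e braid_image_closed) (auto simp: braid_words_simps)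
    then show ?thesis using braid by (auto simp: braid_words_simps mult.assoc)
  qed
  then show "x \<in> braid_words n \<longleftrightarrow> y \<in> braid_words n"
    "x \<in> braid_words n \<Longrightarrow> tl_eq n (braid_image x) (braid_image y)" by blast+
qed

lemma equivclp_braid_move_tl_eq:
  assumes "equivclp (braid_move n) x y" "x \<in> braid_words n"
  shows "y \<in> braid_words n \<and> tl_eq n (braid_image x) (braid_image y)"
  using assms
proof (induct rule: equivclp_induct)
  case (step y z)
  then have y: "y \<in> braid_words n" "tl_eq n (braid_image x) (braid_image y)" by auto
  from step(2) show ?case
    using braid_move_tl_eq[of n y z] braid_move_tl_eq[of n z y] y tl_eq_trans tl_eq_sym by metis
qed simp

definition braid_class :: "nat \<Rightarrow> braid_word \<Rightarrow> braid_word set"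
  where "braid_class n w = braid_eq n `` {w}"

lemma mem_braid_class:
  "w \<in> braid_words n \<Longrightarrow> u \<in> braid_class n w \<longleftrightarrow> equivclp (braid_move n) w u"
  using equivclp_braid_move_tl_eq by (auto simp: braid_class_def braid_eq_def)

lemma braid_class_eqI:
  assumes "w \<in> braid_words n" "equivclp (braid_move n) w u"
  shows "braid_class n w = braid_class n u"
proof -
  have "u \<in> braid_words n" using equivclp_braid_move_tl_eq[OF assms(2,1)] by blast
  then show ?thesis
    using mem_braid_class[OF assms(1)] mem_braid_class assms(2) equivclp_sym equivclp_trans by (metis subsetI subset_antisym)
qed

lemma braid_move_append:
  "braid_move n x y \<Longrightarrow> braid_move n (us @ x @ vs) (us @ y @ vs)"
proof (induct rule: braid_move.induct)
  case (cancel i xs e ys)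
  then show ?case using braid_move.cancel[of i n "us @ xs" e "ys @ vs"] by simp
next
  case (commute i j xs ys)
  then show ?case using braid_move.commute[of i n j "us @ xs" "ys @ vs"] by simp
next
  case (braid i j xs ys)
  then show ?case using braid_move.braid[of i n j "us @ xs" "ys @ vs"] by simp
qed

lemma equivclp_braid_move_append:
  "equivclp (braid_move n) x y \<Longrightarrow> equivclp (braid_move n) (us @ x @ vs) (us @ y @ vs)"
proof (induct rule: equivclp_induct)
  case (step y z)
  from step(2) have "braid_move n (us @ y @ vs) (us @ z @ vs) \<or> braid_move n (us @ z @ vs) (us @ y @ vs)"
    using braid_move_append by blast
  with step(3) show ?case by (meson equivclp_into_equivclp)
qed simp

lemma braid_class_mult:
  assumes "a \<in> braid_words n" "b \<in> braid_words n"
  shows "braid_class n a \<otimes>\<^bsub>braid_group n\<^esub> braid_class n b = braid_class n (a @ b)"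
proof -
  have ab: "a @ b \<in> braid_words n" using assms by (simp add: braid_words_simps)
  have "braid_class n (a' @ b') = braid_class n (a @ b)"
    if "a' \<in> braid_class n a" "b' \<in> braid_class n b" for a' b'
  proof -
    have e: "equivclp (braid_move n) a a'" "equivclp (braid_move n) b b'"
      using that mem_braid_class assms by auto
    have "equivclp (braid_move n) (a @ b) (a' @ b')"
      using equivclp_braid_move_append[OF e(1), of "[]" b] equivclp_braid_move_append[OF e(2), of a' "[]"]
      by (auto intro: equivclp_trans)
    from braid_class_eqI[OF ab this] show ?thesis by simp
  qed
  then have "(\<Union>a'\<in>braid_class n a. \<Union>b'\<in>braid_class n b. braid_class n (a' @ b')) =
      (\<Union>a'\<in>braid_class n a. \<Union>b'\<in>braid_class n b. braid_class n (a @ b))"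
    by (intro SUP_cong refl)
  moreover have "a \<in> braid_class n a" "b \<in> braid_class n b"
    using assms mem_braid_class by auto
  then have "(\<Union>a'\<in>braid_class n a. \<Union>b'\<in>braid_class n b. braid_class n (a @ b)) = braid_class n (a @ b)"
    by blast
  ultimately show ?thesis unfolding braid_group_def monoid.simps braid_class_def by simp
qed

text \<open>Braid moves do not change the image, so the set inside \<open>the_elem\<close> is a
  singleton.\<close>

lemma omega_braid_class:
  assumes w: "w \<in> braid_words n"
  shows "omega n (braid_class n w) = tl_class n (braid_image w)"
proof -
  have "omega_word n u = tl_class n (braid_image w)" if "u \<in> braid_class n w" for u
  proof -
    have e: "equivclp (braid_move n) w u" using that mem_braid_class[OF w] by simp
    note u = equivclp_braid_move_tl_eq[OF e w]
    then show ?thesis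
      using omega_word_eq[of u n] tl_class_eqI[of n "braid_image w" "braid_image u"] braid_image_closed w by metis
  qed
  moreover have "w \<in> braid_class n w" using mem_braid_class[OF w] by simp
  ultimately have "omega_word n ` braid_class n w = {tl_class n (braid_image w)}" by force
  then show ?thesis by (simp add: omega_def)
qed

section \<open>The elements Z as words in the braid generators\<close>

definition transp_word :: "nat \<times> nat \<Rightarrow> braid_word"
  where "transp_word = (\<lambda>(a, b). map (\<lambda>i. (i, False)) (rev [a+1..<b]) @ [(a, True)] @ map (\<lambda>i. (i, True)) [a+1..<b])"

definition transp_pairs :: "nat \<Rightarrow> (nat \<times> nat) set"
  where "transp_pairs n = {(a, b). 1 \<le> a \<and> a < b \<and> b \<le> n + 1}"

abbreviation transp_prod :: "(nat \<times> nat) list \<Rightarrow> nat \<Rightarrow> nat"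
  where "transp_prod ps \<equiv> word_prod (map (\<lambda>(a, b). transpose a b) ps)"

abbreviation transp_image :: "(nat \<times> nat) list \<Rightarrow> free_elt"
  where "transp_image ps \<equiv> braid_image (concat (map transp_word ps))"

lemma transp_word_closed: "p \<in> transp_pairs n \<Longrightarrow> transp_word p \<in> braid_words n"
  by (auto simp: transp_pairs_def transp_word_def braid_words_def)

lemma concat_transp_word_closed:
  "set ps \<subseteq> transp_pairs n \<Longrightarrow> concat (map transp_word ps) \<in> braid_words n"
  by (induct ps) (auto simp: braid_words_simps transp_word_closed)

lemma ic_transp_eq:
  assumes "a < b"
  shows "ic_transp n (transpose a b) = braid_class n (transp_word (a, b))"
proof -
  have m: "{c. transpose a b c \<noteq> c} = {a, b}" using assms by (auto simp: transpose_def)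
  have "Min {a, b} = a" "Max {a, b} - 1 + 1 = b" using assms by auto
  then show ?thesis
    unfolding ic_transp_def m Let_def transp_word_def braid_class_def prod.case by simp
qed

lemma set_transpositions:
  "set ts \<subseteq> transpositions n \<Longrightarrow>
    \<exists>ps. ts = map (\<lambda>(a, b). transpose a b) ps \<and> set ps \<subseteq> transp_pairs n"
proof (induct ts)
  case (Cons t ts)
  then obtain ps where ps: "ts = map (\<lambda>(a, b). transpose a b) ps" "set ps \<subseteq> transp_pairs n" by auto
  have "t \<in> transpositions n" using Cons by simp
  then obtain a b where ab: "a < b" "a \<in> {1..n+1}" "b \<in> {1..n+1}" "t = transpose a b"
    by (rule transpositionsE)
  then show ?case using ps by (intro exI[of _ "(a, b) # ps"]) (simp add: transp_pairs_def)
qed simp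

text \<open>Of the word chosen in \<open>ic\<close> only reducedness is known; it is compared with
  other reduced words later, through its action.\<close>

lemma Z_elt_eq:
  assumes "x permutes {1..n+1}"
  obtains ps where "set ps \<subseteq> transp_pairs n" "transp_prod ps = x" "length ps = len_T n x"
    "Z_elt n x = tl_class n (transp_image ps)"
proof -
  define ts where "ts = (SOME ts. ts \<in> reduced_words (transpositions n) x)"
  have "\<exists>ts. ts \<in> reduced_words (transpositions n) x"
    using transposition_word_exists[OF assms] reduced_word_exists by blast
  then have "ts \<in> reduced_words (transpositions n) x" unfolding ts_def by (rule someI_ex)
  then have ts: "set ts \<subseteq> transpositions n" "word_prod ts = x" "length ts = len_T n x"
    unfolding reduced_words_def by auto
  obtain ps where ps: "ts = map (\<lambda>(a, b). transpose a b) ps" "set ps \<subseteq> transp_pairs n"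
    using set_transpositions[OF ts(1)] by blast
  have "foldr (\<lambda>t B. ic_transp n t \<otimes>\<^bsub>braid_group n\<^esub> B) (map (\<lambda>(a, b). transpose a b) ps)
      \<one>\<^bsub>braid_group n\<^esub> = braid_class n (concat (map transp_word ps))"
    using ps(2)
  proof (induct ps)
    case Nil
    show ?case by (simp add: braid_group_def braid_class_def)
  next
    case (Cons p ps)
    obtain a b where p: "p = (a, b)" "a < b" using Cons by (cases p) (auto simp: transp_pairs_def)
    have w: "transp_word p \<in> braid_words n" "concat (map transp_word ps) \<in> braid_words n"
      using Cons(2) transp_word_closed concat_transp_word_closed by auto
    from Cons show ?case
      using braid_class_mult[OF w] ic_transp_eq[OF p(2), of n] by (simp add: p(1))
  qed
  then have "ic n x = braid_class n (concat (map transp_word ps))"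
    unfolding ic_def ts_def[symmetric] ps(1) .
  then have "Z_elt n x = tl_class n (transp_image ps)"
    unfolding Z_elt_def using omega_braid_class[OF concat_transp_word_closed[OF ps(2)]] by simp
  then show thesis using that[of ps] ps ts by simp
qed

section \<open>Monomials of the normal forms span\<close>

definition tl_mono :: "nat list \<Rightarrow> free_elt"
  where "tl_mono u = Poly_Mapping.single (Word u) 1"

lemma tl_mono_append: "tl_mono (u @ w) = tl_mono u * tl_mono w"
  by (simp add: tl_mono_def mult_single plus_fmon_def)

lemma tl_mono_singleton: "tl_mono [i] = free_gen i"
  by (simp add: tl_mono_def free_gen_def)

lemma tl_mono_closed: "set u \<subseteq> {1..n} \<Longrightarrow> tl_mono u \<in> carrier (free_alg n)"
  by (auto simp: tl_mono_def free_alg_def)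

text \<open>Each defining relation equates two monomials up to a scalar, so rewriting never leaves
  the multiples of a single monomial.\<close>

definition tl_red :: "nat \<Rightarrow> nat list \<Rightarrow> nat list \<Rightarrow> bool"
  where "tl_red n u w \<longleftrightarrow> (\<exists>a. tl_eq n (tl_mono u) (scal a * tl_mono w))"

lemma tl_red_refl [simp]: "tl_red n u u"
  unfolding tl_red_def by (rule exI[of _ 1]) (simp add: scal_simps)

lemma tl_red_trans:
  assumes "tl_red n u w" "tl_red n w z" shows "tl_red n u z"
proof -
  obtain a b where a: "tl_eq n (tl_mono u) (scal a * tl_mono w)" "tl_eq n (tl_mono w) (scal b * tl_mono z)"
    using assms unfolding tl_red_def by blast
  then have "tl_eq n (tl_mono u) (scal (a * b) * tl_mono z)"
    using tl_eq_trans[OF a(1) tl_eq_scal[OF a(2)]] by (simp add: scal_simps mult.assoc)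
  then show ?thesis unfolding tl_red_def by blast
qed

lemma tl_red_append:
  assumes "tl_red n u w" "set x \<subseteq> {1..n}" "set y \<subseteq> {1..n}"
  shows "tl_red n (x @ u @ y) (x @ w @ y)"
proof -
  obtain a where a: "tl_eq n (tl_mono u) (scal a * tl_mono w)" using assms unfolding tl_red_def by blast
  have "tl_mono x * (scal a * tl_mono w) * tl_mono y = scal a * (tl_mono x * tl_mono w * tl_mono y)"
    using scal_commute by (metis mult.assoc)
  then have "tl_eq n (tl_mono (x @ u @ y)) (scal a * tl_mono (x @ w @ y))"
    using tl_eq_mult[OF a tl_mono_closed[OF assms(2)] tl_mono_closed[OF assms(3)]]
    by (simp add: tl_mono_append mult.assoc)
  then show ?thesis unfolding tl_red_def by blast
qed

lemma tl_red_gen_commute: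
  assumes "i \<in> {1..n}" "j \<in> {1..n}" "\<bar>int i - int j\<bar> > 1"
  shows "tl_red n [i, j] [j, i]"
proof -
  have "tl_mono [i, j] = free_gen i * free_gen j" for i j
    using tl_mono_append[of "[i]" "[j]"] by (simp add: tl_mono_singleton)
  then show ?thesis
    using TL_relations(2)[OF assms] unfolding tl_red_def tl_eq_def
    by (intro exI[of _ 1]) (simp add: scal_simps)
qed

lemma tl_red_gen_braid:
  assumes "i \<in> {1..n}" "j \<in> {1..n}" "\<bar>int i - int j\<bar> = 1"
  shows "tl_red n [j, i, j] [j]"
proof -
  have "tl_mono [j, i, j] = free_gen j * free_gen i * free_gen j"
    using tl_mono_append[of "[j]" "[i] @ [j]"] tl_mono_append[of "[i]" "[j]"]
    by (simp add: tl_mono_singleton mult.assoc)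
  then show ?thesis
    using TL_relations(1)[OF assms] unfolding tl_red_def tl_eq_def
    by (intro exI[of _ 1]) (simp add: scal_simps tl_mono_singleton)
qed

lemma tl_red_gen_square:
  assumes "i \<in> {1..n}"
  shows "tl_red n [i, i] [i]"
proof -
  have "tl_mono [i, i] = free_gen i * free_gen i"
    using tl_mono_append[of "[i]" "[i]"] by (simp add: tl_mono_singleton)
  then show ?thesis
    using TL_relations(3)[OF assms] unfolding tl_red_def tl_eq_def
    by (intro exI[of _ "v_pow 1 + v_pow (- 1)"]) (simp add: tl_mono_singleton)
qed

lemma tl_red_commute1:
  assumes "k \<in> {1..n}" "set u \<subseteq> {1..n}" "\<And>a. a \<in> set u \<Longrightarrow> \<bar>int a - int k\<bar> > 1"
  shows "tl_red n (u @ [k]) ([k] @ u)"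
  using assms(2,3)
proof (induct u)
  case (Cons a u)
  have "tl_red n ([a] @ (u @ [k]) @ []) ([a] @ ([k] @ u) @ [])"
    using Cons by (intro tl_red_append Cons) auto
  moreover have "tl_red n ([] @ [a, k] @ u) ([] @ [k, a] @ u)"
    using Cons assms(1) by (intro tl_red_append tl_red_gen_commute) auto
  ultimately show ?case using tl_red_trans by simp
qed simp

lemma tl_red_commute:
  assumes "set u \<subseteq> {1..n}" "set w \<subseteq> {1..n}" "\<And>a b. a \<in> set u \<Longrightarrow> b \<in> set w \<Longrightarrow> \<bar>int a - int b\<bar> > 1"
  shows "tl_red n (u @ w) (w @ u)"
  using assms(2,3)
proof (induct w)
  case (Cons k w)
  have "tl_red n ([] @ (u @ [k]) @ w) ([] @ ([k] @ u) @ w)"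
    using Cons assms(1) by (intro tl_red_append tl_red_commute1) auto
  moreover have "tl_red n ([k] @ (u @ w) @ []) ([k] @ (w @ u) @ [])"
    using Cons by (intro tl_red_append Cons) auto
  ultimately show ?case using tl_red_trans by simp
qed simp

lemma down_split: "j \<le> k \<Longrightarrow> k \<le> m \<Longrightarrow> rev [j..<m] = rev [k..<m] @ rev [j..<k]"
  using upt_add_eq_append[of j k "m - k"] by simp

lemma down_last: "j < m \<Longrightarrow> rev [j..<m] = rev [Suc j..<m] @ [j]"
  by (simp add: upt_conv_Cons)

text \<open>A bracket with \<open>j = m + 1\<close> is empty. Depending on its position, the letter
  \<open>k\<close> commutes past the bracket, extends it, or doubles its last letter. If it meets
  the interior, \<open>b_k b_(k-1) b_k\<close> collapses to \<open>b_k\<close>; the bracket is cut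
  there, and its detached lower piece commutes to the front.\<close>

lemma tl_red_bracket_gen:
  assumes m: "m \<le> N" and j: "1 \<le> j" "j \<le> m + 1" and k: "1 \<le> k" "k \<le> m"
  obtains u j' where "set u \<subseteq> {1..<m}" "1 \<le> j'" "j' \<le> m + 1"
    "tl_red N (bracket m j @ [k]) (u @ bracket m j')"
proof -
  consider "k + 1 < j" | "k + 1 = j" | "k = j" | "j < k" by linarith
  then show thesis
  proof cases
    case 1
    have "tl_red N (bracket m j @ [k]) ([k] @ bracket m j)"
      using 1 m k j by (intro tl_red_commute1) auto
    then show thesis using 1 k j by (intro that[of "[k]" j]) auto
  next
    case 2
    have "bracket m j @ [k] = bracket m k" using down_last[of k "m + 1"] 2 k by simp
    then show thesis using 2 k by (intro that[of "[]" k]) auto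
  next
    case 3
    have "bracket m j = rev [Suc j..<m+1] @ [j]" using down_last[of j "m + 1"] 3 k by simp
    moreover have "tl_red N (rev [Suc j..<m+1] @ [j, j] @ []) (rev [Suc j..<m+1] @ [j] @ [])"
      using m j 3 k by (intro tl_red_append tl_red_gen_square) auto
    ultimately show thesis using 3 j by (intro that[of "[]" j]) auto
  next
    case 4
    define k' where "k' = k - 1"
    have k': "k = Suc k'" "j \<le> k'" "1 \<le> k'" using 4 j by (auto simp: k'_def)
    have "bracket m j = rev [Suc k..<m+1] @ rev [j..<Suc k]" using down_split[of j "Suc k" "m+1"] 4 k by simp
    also have "rev [j..<Suc k] = [k, k'] @ rev [j..<k']" using k' by simp
    finally have b: "bracket m j @ [k] = (rev [Suc k..<m+1] @ [k, k']) @ (rev [j..<k'] @ [k]) @ []" by simp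
    have "tl_red N (bracket m j @ [k]) ((rev [Suc k..<m+1] @ [k, k']) @ ([k] @ rev [j..<k']) @ [])"
      unfolding b using m j k k' by (intro tl_red_append tl_red_commute1) auto
    moreover have "tl_red N (rev [Suc k..<m+1] @ [k, k', k] @ rev [j..<k']) (rev [Suc k..<m+1] @ [k] @ rev [j..<k'])"
      using m j k k' by (intro tl_red_append tl_red_gen_braid) auto
    moreover have "rev [Suc k..<m+1] @ [k] = bracket m k" using down_last[of k "m+1"] k by simp
    moreover have "tl_red N (bracket m k @ rev [j..<k']) (rev [j..<k'] @ bracket m k)"
      using m j k k' by (intro tl_red_commute) auto
    ultimately have "tl_red N (bracket m j @ [k]) (rev [j..<k'] @ bracket m k)"
      using tl_red_trans by (metis (no_types, lifting) append.assoc append_Cons append_Nil append_Nil2)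
    then show thesis using j k k' by (intro that[of "rev [j..<k']" k]) auto
  qed
qed

text \<open>The invariant while letters are appended: a word in letters below \<open>m\<close>,
  followed by one possibly empty bracket that starts at \<open>m\<close>.\<close>

lemma tl_red_last_bracket:
  assumes "m \<le> N" "1 \<le> m" "set u \<subseteq> {1..m}"
  shows "\<exists>u' j. set u' \<subseteq> {1..<m} \<and> 1 \<le> j \<and> j \<le> m + 1 \<and> tl_red N u (u' @ bracket m j)"
  using assms(3)
proof (induct u rule: rev_induct)
  case Nil
  show ?case using assms by (intro exI[of _ "[]"] exI[of _ "m + 1"]) simp
next
  case (snoc k u)
  then obtain u' j where u': "set u' \<subseteq> {1..<m}" "1 \<le> j" "j \<le> m + 1" "tl_red N u (u' @ bracket m j)" by auto
  obtain x j' where x: "set x \<subseteq> {1..<m}" "1 \<le> j'" "j' \<le> m + 1"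
    "tl_red N (bracket m j @ [k]) (x @ bracket m j')"
    using tl_red_bracket_gen[OF assms(1) u'(2,3), of k] snoc(2) by auto
  have "tl_red N ([] @ u @ [k]) ([] @ (u' @ bracket m j) @ [k])"
    using snoc(2) assms by (intro tl_red_append u') auto
  moreover have "tl_red N (u' @ (bracket m j @ [k]) @ []) (u' @ (x @ bracket m j') @ [])"
    using u' assms by (intro tl_red_append x) auto
  ultimately have "tl_red N (u @ [k]) ((u' @ x) @ bracket m j')"
    using tl_red_trans by (metis (no_types, lifting) append.assoc append_Nil append_Nil2)
  then show ?case using u' x by (intro exI[of _ "u' @ x"] exI[of _ j']) simp
qed

text \<open>Repairs two neighbouring brackets whose lower ends are out of order. The letter
  \<open>j'\<close> commutes to the pair \<open>[j'+1, j']\<close>, the triple collapses to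
  \<open>j'\<close>, and what remains below it joins the first bracket. The second bracket now ends
  at \<open>j' + 2\<close>, or is empty if \<open>j' + 1 = m\<close>.\<close>

lemma tl_red_bracket_bracket:
  assumes "m \<le> N" "1 \<le> j" "j \<le> j'" "j' \<le> i'" "i' < m"
  shows "tl_red N (bracket i' j' @ bracket m j) (bracket i' j @ bracket m (j' + 2))"
proof -
  have i: "bracket i' j' = rev [Suc j'..<i'+1] @ [j']" using down_last[of j' "i'+1"] assms by simp
  have "bracket m j = rev [j'+2..<m+1] @ rev [j..<j'+2]" using down_split[of j "j'+2" "m+1"] assms by simp
  also have "rev [j..<j'+2] = [j'+1, j'] @ rev [j..<j']" using assms by simp
  finally have m: "bracket m j = rev [j'+2..<m+1] @ [j'+1, j'] @ rev [j..<j']" .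
  have i2: "bracket i' j = rev [Suc j'..<i'+1] @ j' # rev [j..<j']"
    using down_split[of j "Suc j'" "i'+1"] assms by simp
  have 1: "tl_red N (rev [Suc j'..<i'+1] @ ([j'] @ rev [j'+2..<m+1]) @ ([j'+1, j'] @ rev [j..<j']))
      (rev [Suc j'..<i'+1] @ (rev [j'+2..<m+1] @ [j']) @ ([j'+1, j'] @ rev [j..<j']))"
    using assms by (intro tl_red_append tl_red_commute) auto
  have 2: "tl_red N ((rev [Suc j'..<i'+1] @ rev [j'+2..<m+1]) @ [j', j'+1, j'] @ rev [j..<j'])
      ((rev [Suc j'..<i'+1] @ rev [j'+2..<m+1]) @ [j'] @ rev [j..<j'])"
    using assms by (intro tl_red_append tl_red_gen_braid) auto
  have 3: "tl_red N (rev [Suc j'..<i'+1] @ (rev [j'+2..<m+1] @ (j' # rev [j..<j'])) @ [])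
      (rev [Suc j'..<i'+1] @ ((j' # rev [j..<j']) @ rev [j'+2..<m+1]) @ [])"
    using assms by (intro tl_red_append tl_red_commute) auto
  show ?thesis unfolding i m i2
    using tl_red_trans[OF 1] tl_red_trans[OF 2] 3 by simp
qed

text \<open>The letters equal to the greatest index are gathered in a last bracket, and the rest is
  reduced by induction. If the lower ends then fail to increase, the exchange of brackets raises the
  last one from \<open>j\<close> to \<open>j' + 2\<close>, so the inner induction on
  \<open>?m + 1 - j\<close> terminates.\<close>

lemma tl_red_nf:
  assumes "m \<le> N" "set u \<subseteq> {1..m}"
  shows "\<exists>ps. nf_seq m ps \<and> tl_red N u (nf_word ps)"
  using assms
proof (induct m arbitrary: u)
  case 0
  then show ?case by (intro exI[of _ "[]"]) simp
next
  case (Suc n)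
  let ?m = "Suc n"
  have n: "n \<le> N" "?m \<le> N" using Suc(2) by auto
  have key: "\<exists>qs. nf_seq ?m qs \<and> tl_red N (x @ bracket ?m j) (nf_word qs)"
    if "set x \<subseteq> {1..n}" "1 \<le> j" "j \<le> ?m + 1" for x j
    using that
  proof (induct "?m + 1 - j" arbitrary: x j rule: less_induct)
    case less
    obtain ps where ps: "nf_seq n ps" "tl_red N x (nf_word ps)" using Suc(1)[OF n(1) less(2)] by blast
    have 1: "tl_red N ([] @ x @ bracket ?m j) ([] @ nf_word ps @ bracket ?m j)"
      using n less by (intro tl_red_append ps) auto
    show ?case
    proof (cases "j = ?m + 1")
      case True
      then show ?thesis using 1 nf_seq_mono[OF ps(1), of ?m] by auto
    next
      case False
      then have jm: "j \<le> ?m" using less by simp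
      show ?thesis
      proof (cases "\<forall>(i', j')\<in>set ps. j' < j")
        case True
        have "nf_seq ?m (ps @ [(?m, j)])"
          unfolding nf_seq_snoc using True nf_seq_mono[OF ps(1), of ?m] less jm ps(1)
          by (auto simp: nf_seq_def)
        moreover have "tl_red N (x @ bracket ?m j) (nf_word (ps @ [(?m, j)]))"
          using 1 by (simp add: nf_word_snoc)
        ultimately show ?thesis by blast
      next
        case False
        then have "ps \<noteq> []" by auto
        then obtain ps' i' j' where p: "ps = ps' @ [(i', j')]" by (metis rev_exhaust prod.exhaust)
        have s: "nf_seq n ps'" "1 \<le> j'" "j' \<le> i'" "i' \<le> n" "\<And>a b. (a, b) \<in> set ps' \<Longrightarrow> b < j'"
          using ps(1) unfolding p nf_seq_snoc by auto
        have jj: "j \<le> j'" using False s(5) unfolding p by force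
        have w: "set (nf_word ps') \<subseteq> {1..n}" using set_nf_word[OF s(1)] .
        let ?x = "nf_word ps' @ bracket i' j"
        have "tl_red N (nf_word ps' @ (bracket i' j' @ bracket ?m j) @ [])
            (nf_word ps' @ (bracket i' j @ bracket ?m (j' + 2)) @ [])"
          using w n s less jj by (intro tl_red_append tl_red_bracket_bracket) auto
        then have 2: "tl_red N (x @ bracket ?m j) (?x @ bracket ?m (j' + 2))"
          using tl_red_trans[OF 1] by (simp add: p nf_word_snoc)
        have "set ?x \<subseteq> {1..n}" using w s less by auto
        moreover have lt: "?m + 1 - (j' + 2) < ?m + 1 - j" using jj jm by linarith
        ultimately obtain qs where "nf_seq ?m qs" "tl_red N (?x @ bracket ?m (j' + 2)) (nf_word qs)"
          using less(1)[OF lt, of ?x] s by auto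
        then show ?thesis using tl_red_trans[OF 2] by blast
      qed
    qed
  qed
  obtain u' j where u: "set u' \<subseteq> {1..<?m}" "1 \<le> j" "j \<le> ?m + 1" "tl_red N u (u' @ bracket ?m j)"
    using tl_red_last_bracket[OF n(2) _ Suc(3)] by auto
  obtain qs where "nf_seq ?m qs" "tl_red N (u' @ bracket ?m j) (nf_word qs)"
    using key[of u' j] u unfolding atLeastLessThanSuc_atLeastAtMost by blast
  then show ?case using tl_red_trans[OF u(4)] by blast
qed

lemma TL_spanned:
  assumes "p \<in> carrier (free_alg n)"
  shows "\<exists>c. tl_eq n p (\<Sum>w\<in>fully_commutative n. scal (c w) * tl_mono (nf_word (normal_form n w)))"
proof -
  let ?F = "fully_commutative n"
  let ?B = "\<lambda>w. tl_mono (nf_word (normal_form n w))"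
  have mono: "\<exists>w\<in>?F. \<exists>a. tl_eq n (tl_mono u) (scal a * ?B w)" if u: "set u \<subseteq> {1..n}" for u
  proof -
    obtain ps where ps: "nf_seq n ps" "tl_red n u (nf_word ps)" using tl_red_nf[OF _ u, of n] by auto
    then show ?thesis using normal_form_nf_word[OF ps(1)] unfolding tl_red_def by metis
  qed
  define G where "G = {p. \<exists>c. tl_eq n p (\<Sum>w\<in>?F. scal (c w) * ?B w)}"
  have add: "p + q \<in> G" if pq: "p \<in> G" "q \<in> G" for p q
  proof -
    obtain c d where c: "tl_eq n p (\<Sum>w\<in>?F. scal (c w) * ?B w)" and d: "tl_eq n q (\<Sum>w\<in>?F. scal (d w) * ?B w)"
      using pq unfolding G_def by blast
    have "tl_eq n (p + q) ((\<Sum>w\<in>?F. scal (c w) * ?B w) + (\<Sum>w\<in>?F. scal (d w) * ?B w))"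
      using TL_ideal_closed(2)[OF c[unfolded tl_eq_def] d[unfolded tl_eq_def]]
      unfolding tl_eq_def by (simp add: algebra_simps)
    also have "(\<Sum>w\<in>?F. scal (c w) * ?B w) + (\<Sum>w\<in>?F. scal (d w) * ?B w) = (\<Sum>w\<in>?F. scal (c w + d w) * ?B w)"
      by (simp add: sum.distrib scal_simps distrib_right)
    finally show ?thesis unfolding G_def mem_Collect_eq by (rule exI[of _ "\<lambda>w. c w + d w"])
  qed
  have zero: "0 \<in> G"
    unfolding G_def mem_Collect_eq by (rule exI[of _ "\<lambda>_. 0"]) (simp add: scal_simps)
  have single: "Poly_Mapping.single v a \<in> G" if v: "set (letters v) \<subseteq> {1..n}" for v a
  proof -
    obtain w b where w: "w \<in> ?F" "tl_eq n (tl_mono (letters v)) (scal b * ?B w)" using mono[OF v] by blast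
    have "Poly_Mapping.single v a = scal a * tl_mono (letters v)"
      by (simp add: scal_def tl_mono_def mult_single)
    then have e: "tl_eq n (Poly_Mapping.single v a) (scal a * (scal b * ?B w))"
      using tl_eq_scal[OF w(2), of a] by simp
    have "(\<Sum>u\<in>?F. scal (if u = w then a * b else 0) * ?B u) = (\<Sum>u\<in>?F. if u = w then scal (a * b) * ?B u else 0)"
      by (intro sum.cong refl) (simp add: scal_simps)
    also have "\<dots> = scal (a * b) * ?B w"
      using w(1) finite_fully_commutative[of n] by simp
    finally have "(\<Sum>u\<in>?F. scal (if u = w then a * b else 0) * ?B u) = scal a * (scal b * ?B w)"
      by (simp add: scal_simps mult.assoc)
    with e have "tl_eq n (Poly_Mapping.single v a) (\<Sum>u\<in>?F. scal (if u = w then a * b else 0) * ?B u)" by simp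
    then show ?thesis unfolding G_def mem_Collect_eq by (rule exI[of _ "\<lambda>u. if u = w then a * b else 0"])
  qed
  have "(\<Sum>w\<in>A. Poly_Mapping.single w (Poly_Mapping.lookup p w)) \<in> G" if "A \<subseteq> Poly_Mapping.keys p" for A
    using that
  proof (induct A rule: infinite_finite_induct)
    case (insert v A)
    then have "set (letters v) \<subseteq> {1..n}" using assms by (auto simp: free_alg_def)
    then show ?case using insert add single by simp
  qed (use zero in auto)
  from this[of "Poly_Mapping.keys p"] show ?thesis unfolding poly_mapping_sum_single G_def by simp
qed

section \<open>Actions of the braid group\<close>

definition commutes :: "('a \<Rightarrow> 'a) \<Rightarrow> ('a \<Rightarrow> 'a) \<Rightarrow> bool"
  where "commutes f g \<longleftrightarrow> f \<circ> g = g \<circ> f"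

lemma commutesD: "commutes f g \<Longrightarrow> f (g x) = g (f x)"
  unfolding commutes_def by (metis comp_apply)

lemma commutesI: "(\<And>x. f (g x) = g (f x)) \<Longrightarrow> commutes f g"
  unfolding commutes_def by (simp add: fun_eq_iff)

lemma commutes_sym: "commutes f g \<Longrightarrow> commutes g f"
  unfolding commutes_def by simp

text \<open>Records what the comparison of reduced words needs: mutually inverse operators with the
  braid relations, for all positive indices, so that no bound on the strands has to be carried
  along.\<close>

locale braid_action =
  fixes s t :: "nat \<Rightarrow> 'a \<Rightarrow> 'a"
  assumes st: "1 \<le> i \<Longrightarrow> s i (t i x) = x"
    and ts: "1 \<le> i \<Longrightarrow> t i (s i x) = x"
    and far: "1 \<le> i \<Longrightarrow> Suc i < j \<Longrightarrow> s i (s j x) = s j (s i x)"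
    and braid: "1 \<le> i \<Longrightarrow> s i (s (Suc i) (s i x)) = s (Suc i) (s i (s (Suc i) x))"
begin

lemma commutes_inverse: "1 \<le> i \<Longrightarrow> commutes f (s i) \<Longrightarrow> commutes f (t i)"
  by (rule commutesI) (metis commutesD st ts)

lemma commutes_s: "1 \<le> i \<Longrightarrow> 1 \<le> j \<Longrightarrow> Suc i < j \<or> Suc j < i \<Longrightarrow> commutes (s i) (s j)"
  by (rule commutesI) (metis far)

text \<open>For \<open>a < b\<close> this is the action of the generator \<open>i_c\<close> of the
  transposition of \<open>a\<close> and \<open>b\<close>, a band generator in the sense of Birman,
  Ko and Lee; other arguments are never of interest.\<close>

primrec band :: "nat \<Rightarrow> nat \<Rightarrow> 'a \<Rightarrow> 'a" where
  "band a 0 = id"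
| "band a (Suc b) = (if a = b then s b else t b \<circ> band a b \<circ> s b)"

lemma band_Suc: "a < b \<Longrightarrow> band a (Suc b) x = t b (band a b (s b x))" "band a (Suc a) = s a"
  by simp_all

lemma commutes_band_Suc:
  assumes "a < b" "1 \<le> b" "commutes f (band a b)" "commutes f (s b)"
  shows "commutes f (band a (Suc b))"
proof (rule commutesI)
  fix x
  show "f (band a (Suc b) x) = band a (Suc b) (f x)"
    unfolding band_Suc(1)[OF assms(1)]
    using commutesD[OF assms(3)] commutesD[OF assms(4)] commutesD[OF commutes_inverse[OF assms(2,4)]] by simp
qed

lemma commutes_band:
  assumes "1 \<le> c" "c < d" "\<And>k. c \<le> k \<Longrightarrow> k < d \<Longrightarrow> commutes f (s k)"
  shows "commutes f (band c d)"
  using assms(2,3)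
proof (induct d)
  case (Suc d)
  show ?case
  proof (cases "c = d")
    case False
    then have "commutes f (band c d)" "commutes f (s d)" "1 \<le> d" using Suc assms(1) by auto
    then show ?thesis using False Suc by (intro commutes_band_Suc) auto
  qed (use Suc in simp)
qed simp

lemma commutes_band_far:
  assumes "1 \<le> a" "a < b" "b < k \<or> Suc k < a" "1 \<le> k"
  shows "commutes (s k) (band a b)"
  using assms by (intro commutes_band commutes_s) auto

text \<open>The decisive case is \<open>b = Suc k\<close>, where the band of length one more ends in
  conjugation by the strands \<open>k\<close> and \<open>Suc k\<close>. The braid relation turns the
  incoming \<open>s k\<close> into \<open>s (Suc k)\<close>, which passes the inner band and is
  turned back on the other side.\<close>

lemma commutes_band_inner:
  assumes "1 \<le> a" "a < k" "Suc k < b"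
  shows "commutes (s k) (band a b)"
  using assms(3)
proof (induct b)
  case (Suc b)
  have kb: "Suc k \<le> b" using Suc by simp
  show ?case
  proof (cases "Suc k = b")
    case False
    then have "commutes (s k) (band a b)" "commutes (s k) (s b)" using Suc assms by (auto intro: commutes_s)
    then show ?thesis using assms kb by (intro commutes_band_Suc) auto
  next
    case True
    have z: "band a k (s (Suc k) x) = s (Suc k) (band a k x)" for x
      using commutesD[OF commutes_band_far[of a k "Suc k"]] assms by simp
    have k: "1 \<le> k" "1 \<le> Suc k" using assms by auto
    have b: "band a (Suc b) x = t (Suc k) (t k (band a k (s k (s (Suc k) x))))" for x
      using True assms by (auto simp flip: True)
    have c: "t (Suc k) (t k (s (Suc k) x)) = s k (t (Suc k) (t k x))" for x
    proof -
      have "s (Suc k) x = s (Suc k) (s k (s (Suc k) (t (Suc k) (t k x))))" using st k by simp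
      also have "\<dots> = s k (s (Suc k) (s k (t (Suc k) (t k x))))" using braid k by simp
      finally show ?thesis using ts k by simp
    qed
    show ?thesis
    proof (rule commutesI)
      fix x
      have "band a (Suc b) (s k x) = t (Suc k) (t k (band a k (s (Suc k) (s k (s (Suc k) x)))))"
        unfolding b using braid k by simp
      also have "\<dots> = s k (band a (Suc b) x)" unfolding b z c ..
      finally show "s k (band a (Suc b) x) = band a (Suc b) (s k x)" by simp
    qed
  qed
qed simp

lemma commutes_bands:
  assumes "1 \<le> a" "a < b" "1 \<le> c" "c < d" "b < c \<or> a < c \<and> d < b"
  shows "commutes (band a b) (band c d)"
proof (rule commutes_band[OF assms(3,4)])
  fix k assume "c \<le> k" "k < d"
  then show "commutes (band a b) (s k)"
    using assms commutes_band_far[of a b k] commutes_band_inner[of a k b]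
    by (intro commutes_sym[of "s k"]) auto
qed

text \<open>A band ending at \<open>b\<close> behaves towards \<open>s b\<close> like an adjacent
  generator, which is what the first step of the triangle relation needs.\<close>

lemma band_braid:
  assumes "1 \<le> a" "a < b"
  shows "band a b (s b (band a b x)) = s b (band a b (s b x))"
  using assms(2)
proof (induct b arbitrary: x)
  case (Suc b)
  show ?case
  proof (cases "a = b")
    case True
    then show ?thesis using braid[of b] assms by simp
  next
    case False
    then have ab: "a < b" "1 \<le> b" using Suc assms by auto
    have z: "band a b (s (Suc b) x) = s (Suc b) (band a b x)" for x
      using commutesD[OF commutes_band_far[of a b "Suc b"]] assms ab by simp
    have zt: "band a b (t (Suc b) x) = t (Suc b) (band a b x)" for x
      using commutesD[OF commutes_inverse[OF _ commutes_sym[OF commutes_band_far[of a b "Suc b"]]]] assms ab by simp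
    have e: "s b (s (Suc b) (t b x)) = t (Suc b) (s b (s (Suc b) x))" for x
      using braid[of b "t b x"] st ts ab by (metis le_SucI)
    have e2: "t b (t (Suc b) x) = s (Suc b) (t b (t (Suc b) (t b x)))" for x
      using braid[of b] st ts ab by (metis le_SucI)
    note IH = Suc(1)[OF ab(1)]
    have "band a (Suc b) (s (Suc b) (band a (Suc b) x)) =
        t b (band a b (s b (s (Suc b) (t b (band a b (s b x))))))" using ab by simp
    also have "\<dots> = t b (t (Suc b) (band a b (s b (band a b (s (Suc b) (s b x))))))" unfolding e z zt ..
    also have "\<dots> = t b (t (Suc b) (s b (band a b (s b (s (Suc b) (s b x))))))" unfolding IH ..
    also have "\<dots> = t b (t (Suc b) (s b (s (Suc b) (band a b (s b (s (Suc b) x))))))"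
      using braid[of b x] ab z by simp
    also have "\<dots> = s (Suc b) (t b (band a b (s b (s (Suc b) x))))"
      using e2[of "s b (s (Suc b) (band a b (s b (s (Suc b) x))))"] ts ab by simp
    finally show ?thesis using ab by simp
  qed
qed simp

text \<open>The three ways to write the product of two sides of a triangle, lifting the three
  factorisations of a 3-cycle into transpositions. For \<open>c = Suc b\<close> this reduces to
  \<open>band_braid\<close>; further conjugation by strands beyond \<open>b\<close> preserves
  it.\<close>

lemma band_triangle:
  assumes "1 \<le> a" "a < b" "b < c"
  shows "band a b (band b c x) = band b c (band a c x)" "band b c (band a c x) = band a c (band a b x)"
proof -
  have "band a b (band b c x) = band b c (band a c x) \<and> band b c (band a c x) = band a c (band a b x)"
    using assms(3)
  proof (induct c arbitrary: x)
    case (Suc c)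
    show ?case
    proof (cases "b = c")
      case True
      have b: "1 \<le> b" using assms by simp
      have "band b (Suc c) (band a (Suc c) x) = band a b (s b x)" using True assms st b by simp
      moreover have "band a (Suc c) (band a b x) = band a b (s b x)"
        using True assms band_braid[OF assms(1,2)] ts b by simp
      ultimately show ?thesis using True assms by simp
    next
      case False
      then have bc: "b < c" "a < c" "1 \<le> c" using Suc assms by auto
      note IH = Suc(1)[OF bc(1)]
      have z: "band a b (s c x) = s c (band a b x)" for x
        using commutesD[OF commutes_band_far[of a b c]] assms bc by simp
      have zt: "band a b (t c x) = t c (band a b x)" for x
        using commutesD[OF commutes_inverse[OF _ commutes_sym[OF commutes_band_far[of a b c]]]] assms bc by simp
      show ?thesis using bc IH st z zt by simp
    qed
  qed simp
  then show "band a b (band b c x) = band b c (band a c x)" "band b c (band a c x) = band a c (band a b x)"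
    by blast+
qed

definition bands :: "(nat \<times> nat) list \<Rightarrow> 'a \<Rightarrow> 'a"
  where "bands ps = foldr (\<lambda>(a, b) f. band a b \<circ> f) ps id"

lemma bands_simps [simp]: "bands [] x = x" "bands ((a, b) # ps) x = band a b (bands ps x)"
  by (simp_all add: bands_def)

text \<open>Every reduced word is compared with a word that starts with \<open>(p, x p)\<close> for the least moved point \<open>p\<close>;
  the first two letters are exchanged by a dual braid relation.\<close>

lemma bands_reduced_eq:
  assumes "nc_perm x" "x permutes {1..n+1}"
    and "set ps \<subseteq> transp_pairs n" "transp_prod ps = x" "length ps = card (exc x)"
    and "set qs \<subseteq> transp_pairs n" "transp_prod qs = x" "length qs = card (exc x)"
  shows "bands ps y = bands qs y"
  using assms
proof (induct "card (exc x)" arbitrary: x ps qs y rule: less_induct)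
  case less
  note x = less(2,3)
  have T: "set (map (\<lambda>(a, b). transpose a b) rs) \<subseteq> transpositions n" if "set rs \<subseteq> transp_pairs n" for rs
    using that by (auto simp: transp_pairs_def intro!: transpositionsI)
  show ?case
  proof (cases "x = id")
    case True
    then show ?thesis using less by (simp add: exc_def)
  next
    case False
    then obtain p where p: "p < x p" "\<And>q. q < p \<Longrightarrow> x q = q"
      using exists_least_moved nc_permD(1)[OF x(1)] bij_is_inj by metis
    have pin: "(p, x p) \<in> transp_pairs n" "p \<in> {1..n+1}" "x p \<in> {1..n+1}"
      using permutes_exc_subset[OF x(2)] p(1) by (auto simp: exc_def transp_pairs_def)
    have exists_word: "\<exists>rs. set rs \<subseteq> transp_pairs n \<and> transp_prod rs = z \<and> length rs = card (exc z)"
      if "nc_perm z" "z permutes {1..n+1}" for z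
    proof -
      obtain ts where ts: "set ts \<subseteq> transpositions n" "word_prod ts = z" "length ts = card (exc z)"
        using nc_perm_word_exists[OF \<open>nc_perm z\<close> \<open>z permutes {1..n+1}\<close>] by blast
      then show ?thesis using set_transpositions[OF ts(1)] by auto
    qed
    define x1 where "x1 = transpose p (x p) \<circ> x"
    note pl = nc_perm_peel[OF x(1) p, folded x1_def]
    have p1: "x1 permutes {1..n+1}" unfolding x1_def using permutes_transpose_comp[OF x(2) pin(2,3)] .
    have c1: "card (exc x) = Suc (card (exc x1))" using pl(4,5) finite_exc[OF p1] by simp
    obtain us where us: "set us \<subseteq> transp_pairs n" "transp_prod us = x1" "length us = card (exc x1)"
      using exists_word[OF pl(1) p1] by blast
    have main: "bands rs y = band p (x p) (bands us y)"
      if rs: "set rs \<subseteq> transp_pairs n" "transp_prod rs = x" "length rs = card (exc x)" for rs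
    proof -
      obtain a b vs where rsd: "rs = (a, b) # vs" using rs(3) c1 by (cases rs) auto
      have ab: "a < b" "a \<in> {1..n+1}" "b \<in> {1..n+1}" using rs(1) unfolding rsd by (auto simp: transp_pairs_def)
      have vs: "set vs \<subseteq> transp_pairs n" using rs(1) unfolding rsd by simp
      have xe: "transpose a b \<circ> transp_prod vs = x" using rs(2) unfolding rsd by (simp only: list.map prod.case word_prod_Cons)
      have "Suc (length (map (\<lambda>(a, b). transpose a b) vs)) = card (exc x)" using rs(3) unfolding rsd by simp
      note tl = nc_perm_word_tail[OF x ab T[OF vs] xe this]
      define z where "z = transp_prod vs"
      have z: "z = transpose a b \<circ> x" unfolding z_def xe[symmetric] by (simp add: fun_eq_iff)
      have zp: "z permutes {1..n+1}" unfolding z using permutes_transpose_comp[OF x(2) ab(2,3)] .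
      have zn: "nc_perm z" and zl: "length vs = card (exc z)" using tl unfolding z_def by auto
      have less_z: "card (exc z) < card (exc x)" using zl rs(3) unfolding rsd by simp
      have less_1: "card (exc x1) < card (exc x)" using c1 by simp
      have IHz: "bands vs y = bands ws y"
        if "set ws \<subseteq> transp_pairs n" "transp_prod ws = z" "length ws = card (exc z)" for ws
        using less(1)[OF less_z zn zp vs z_def[symmetric] zl that] .
      have IH1: "bands ws y = bands us y"
        if "set ws \<subseteq> transp_pairs n" "transp_prod ws = x1" "length ws = card (exc x1)" for ws
        using less(1)[OF less_1 pl(1) p1 that us] .
      have pa: "p \<le> a"
      proof (rule ccontr)
        assume "\<not> p \<le> a"
        then have "stable_set x {a}" using p(2)[of a] permutes_inj[OF x(2)] by (intro stable_set_fixed) auto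
        from cycle_of_cong[OF tl(1) this] show False using ab by simp
      qed
      define u where "u = x p"
      have pu: "p < u" "1 \<le> p" using p pin by (auto simp: u_def)
      have int: "a \<in> {p<..<u} \<longleftrightarrow> b \<in> {p<..<u}"
        using cycle_of_cong[OF tl(1) nc_permD(2)[OF x(1) p(1)]] by (simp add: u_def)
      \<comment> \<open>Once the letter for \<open>a\<close> and \<open>b\<close> is removed, the
        rest \<open>z\<close> may by induction be rewritten to start with its own edge at
        \<open>p\<close>.\<close>
      have z_peel: "\<exists>ws. set ws \<subseteq> transp_pairs n \<and> transp_prod ws = transpose p (z p) \<circ> z \<and>
          length ws = card (exc (transpose p (z p) \<circ> z)) \<and> nc_perm (transpose p (z p) \<circ> z) \<and>
          Suc (length ws) = card (exc z) \<and> bands vs y = band p (z p) (bands ws y)"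
        if zpp: "p < z p" and zq: "\<And>q. q < p \<Longrightarrow> z q = q"
      proof -
        let ?z1 = "transpose p (z p) \<circ> z"
        note pz = nc_perm_peel[OF zn zpp zq]
        have pinz: "(p, z p) \<in> transp_pairs n" "p \<in> {1..n+1}" "z p \<in> {1..n+1}"
          using permutes_exc_subset[OF zp] zpp by (auto simp: exc_def transp_pairs_def)
        have z1p: "?z1 permutes {1..n+1}" using permutes_transpose_comp[OF zp pinz(2,3)] .
        have cz: "card (exc z) = Suc (card (exc ?z1))" using pz(4,5) finite_exc[OF z1p] by simp
        obtain ws where ws: "set ws \<subseteq> transp_pairs n" "transp_prod ws = ?z1" "length ws = card (exc ?z1)"
          using exists_word[OF pz(1) z1p] by blast
        have "transp_prod ((p, z p) # ws) = z"
          unfolding list.map prod.case word_prod_Cons ws(2) by (simp add: fun_eq_iff)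
        then have "bands vs y = bands ((p, z p) # ws) y"
          using ws pinz cz by (intro IHz) auto
        then show ?thesis using ws cz pz(1) by auto
      qed
      \<comment> \<open>A word for the remainder, preceded by the exchanged letter, is a reduced
        word of \<open>x1\<close>, where induction applies again.\<close>
      have lift: "band c d (bands ws y) = bands us y"
        if "set ws \<subseteq> transp_pairs n" "(c, d) \<in> transp_pairs n" "transpose c d \<circ> transp_prod ws = x1"
          "Suc (length ws) = card (exc x1)" for ws c d
      proof -
        have "transp_prod ((c, d) # ws) = x1" using that(3) by (simp only: list.map prod.case word_prod_Cons)
        then show ?thesis using IH1[of "(c, d) # ws"] that by simp
      qed
      have czx1: "card (exc z) = card (exc x1)" using zl rs(3) c1 unfolding rsd by simp
      \<comment> \<open>The first letter cannot cross the edge from \<open>p\<close> to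
        \<open>u\<close>: it is this edge, it shares an end with it and a triangle relation
        exchanges the two, or it is disjoint from or nested below it and the bands commute.\<close>
      consider "a = p" "b = u" | "a = p" "b \<noteq> u" | "p < a" "u = a" | "p < a" "u \<noteq> a" using pa by linarith
      then show ?thesis
      proof cases
        case 1
        then have "z = x1" unfolding z x1_def u_def by simp
        then show ?thesis using IHz[of us] us 1 unfolding rsd u_def by simp
      next
        case 2
        then have ub: "u < b" using int ab pu by auto
        have zpv: "z p = u" using 2 pu ub unfolding z u_def by (simp add: transpose_def)
        have zq: "z q = q" if "q < p" for q using p(2)[OF that] that 2 ab unfolding z by (simp add: transpose_def)
        obtain ws where ws: "set ws \<subseteq> transp_pairs n" "transp_prod ws = transpose p u \<circ> z"
          "Suc (length ws) = card (exc z)" "bands vs y = band p u (bands ws y)"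
          using z_peel zpv zq pu by auto
        have "transpose u b \<circ> (transpose p u \<circ> z) = x1"
          unfolding z x1_def u_def[symmetric] using 2 pu ub by (auto simp: fun_eq_iff transpose_def)
        then have "band u b (bands ws y) = bands us y"
          using ws czx1 ub ab pu by (intro lift) (auto simp: transp_pairs_def)
        then have "band p u (band u b (bands ws y)) = band p u (bands us y)" by simp
        moreover have "band p u (band u b w) = band p b (band p u w)" for w
          using band_triangle[OF pu(2,1) ub] by simp
        ultimately show ?thesis unfolding rsd using 2 ws(4) by (simp add: u_def)
      next
        case 3
        have zpv: "z p = b" using 3 unfolding z by (simp add: u_def)
        have pb: "p < b" using 3 ab by simp
        have zq: "z q = q" if "q < p" for q using p(2)[OF that] that 3 ab unfolding z by (simp add: transpose_def)
        obtain ws where ws: "set ws \<subseteq> transp_pairs n" "transp_prod ws = transpose p b \<circ> z"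
          "Suc (length ws) = card (exc z)" "bands vs y = band p b (bands ws y)"
          using z_peel zpv zq pb by auto
        have "transpose a b \<circ> (transpose p b \<circ> z) = x1"
          unfolding z x1_def u_def[symmetric] using 3 pb ab by (auto simp: fun_eq_iff transpose_def)
        then have "band a b (bands ws y) = bands us y"
          using ws czx1 ab by (intro lift) (auto simp: transp_pairs_def)
        then have "band p a (band a b (bands ws y)) = band p a (bands us y)" by simp
        moreover have "band p a (band a b w) = band a b (band p b w)" for w
          using band_triangle[OF pu(2) 3(1) ab(1)] by simp
        ultimately show ?thesis unfolding rsd using 3 ws(4) by (simp add: u_def)
      next
        case 4
        have ub: "u \<noteq> b" using int 4 ab by auto
        have zpv: "z p = u" using 4 ub unfolding z u_def[symmetric] by (simp add: u_def)
        have zq: "z q = q" if "q < p" for q using p(2)[OF that] that 4 ab unfolding z by (simp add: transpose_def)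
        obtain ws where ws: "set ws \<subseteq> transp_pairs n" "transp_prod ws = transpose p u \<circ> z"
          "Suc (length ws) = card (exc z)" "bands vs y = band p u (bands ws y)"
          using z_peel zpv zq pu by auto
        have "transpose a b \<circ> (transpose p u \<circ> z) = x1"
          unfolding z x1_def u_def[symmetric] using 4 pu ab ub by (auto simp: fun_eq_iff transpose_def)
        then have "band a b (bands ws y) = bands us y"
          using ws czx1 ab by (intro lift) (auto simp: transp_pairs_def)
        then have "band p u (band a b (bands ws y)) = band p u (bands us y)" by simp
        moreover have "band p u (band a b w) = band a b (band p u w)" for w
          using commutesD[OF commutes_bands[of p u a b]] int 4 ab pu ub by auto
        ultimately show ?thesis unfolding rsd using ws(4) by (simp add: u_def)
      qed
    qed
    show ?thesis using main[OF less(4-6)] main[OF less(7-9)] by simp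
  qed
qed

end

section \<open>The action on spin configurations\<close>

type_synonym tl_vec = "nat set \<Rightarrow> laurent"

definition swap_at :: "nat \<Rightarrow> nat set \<Rightarrow> nat set"
  where "swap_at i B = {q. transpose i (Suc i) q \<in> B}"

lemma mem_swap_at [simp]:
  "i \<in> swap_at i B \<longleftrightarrow> Suc i \<in> B" "Suc i \<in> swap_at i B \<longleftrightarrow> i \<in> B"
  "q \<noteq> i \<Longrightarrow> q \<noteq> Suc i \<Longrightarrow> q \<in> swap_at i B \<longleftrightarrow> q \<in> B"
  by (simp_all add: swap_at_def)

lemma swap_at_swap_at [simp]: "swap_at i (swap_at i B) = B"
  by (simp add: swap_at_def)

definition diag_coeff :: "nat \<Rightarrow> nat set \<Rightarrow> laurent"
  where "diag_coeff i B = v_pow (if i \<in> B then 1 else - 1)"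

text \<open>The usual action on a tensor power of a rank two module, in coordinates. Where exactly
  one of the sites \<open>i\<close>, \<open>Suc i\<close> is occupied, the matrix has diagonal
  \<open>v\<close>, \<open>v^-1\<close> and off-diagonal entries -1, so it has determinant 0 and
  trace \<open>v + v^-1\<close>; all other configurations are annihilated.\<close>

definition gen_action :: "nat \<Rightarrow> tl_vec \<Rightarrow> tl_vec"
  where "gen_action i f B =
    (if i \<in> B \<longleftrightarrow> Suc i \<in> B then 0 else diag_coeff i B * f B - f (swap_at i B))"

definition mono_action :: "nat list \<Rightarrow> tl_vec \<Rightarrow> tl_vec"
  where "mono_action u f = foldr gen_action u f"

lemma mono_action_simps [simp]:
  "mono_action [] f = f" "mono_action (i # u) f = gen_action i (mono_action u f)"
  "mono_action (u @ w) f = mono_action u (mono_action w f)"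
  by (simp_all add: mono_action_def)

definition tl_action :: "free_elt \<Rightarrow> tl_vec \<Rightarrow> tl_vec"
  where "tl_action p f B =
    (\<Sum>w\<in>Poly_Mapping.keys p. Poly_Mapping.lookup p w * mono_action (letters w) f B)"

lemma mono_action_linear:
  "mono_action u (\<lambda>B. f B + g B) B = mono_action u f B + mono_action u g B"
  "mono_action u (\<lambda>B. c * f B) B = c * mono_action u f B"
proof -
  show "mono_action u (\<lambda>B. f B + g B) B = mono_action u f B + mono_action u g B"
  proof (induct u arbitrary: B)
    case (Cons i u)
    then have "mono_action u (\<lambda>B. f B + g B) = (\<lambda>B. mono_action u f B + mono_action u g B)" by blast
    then show ?case by (simp add: gen_action_def algebra_simps)
  qed simp
  show "mono_action u (\<lambda>B. c * f B) B = c * mono_action u f B"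
  proof (induct u arbitrary: B)
    case (Cons i u)
    then have "mono_action u (\<lambda>B. c * f B) = (\<lambda>B. c * mono_action u f B)" by blast
    then show ?case by (simp add: gen_action_def algebra_simps)
  qed simp
qed

lemma tl_action_superset:
  assumes "finite A" "Poly_Mapping.keys p \<subseteq> A"
  shows "tl_action p f B = (\<Sum>w\<in>A. Poly_Mapping.lookup p w * mono_action (letters w) f B)"
  unfolding tl_action_def using assms
  by (intro sum.mono_neutral_left) (auto simp: in_keys_iff)

lemma tl_action_add: "tl_action (p + q) f B = tl_action p f B + tl_action q f B"
proof -
  let ?A = "Poly_Mapping.keys p \<union> Poly_Mapping.keys q"
  have "tl_action (p + q) f B = (\<Sum>w\<in>?A. Poly_Mapping.lookup (p + q) w * mono_action (letters w) f B)"
    using Poly_Mapping.keys_add[of p q] by (intro tl_action_superset) auto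
  also have "\<dots> = tl_action p f B + tl_action q f B"
    by (simp add: lookup_add distrib_right sum.distrib tl_action_superset[of ?A])
  finally show ?thesis .
qed

lemma tl_action_zero [simp]: "tl_action 0 f B = 0"
  by (simp add: tl_action_def)

lemma tl_action_single: "tl_action (Poly_Mapping.single w c) f B = c * mono_action (letters w) f B"
  by (subst tl_action_superset[of "{w}"]) auto

lemma tl_action_uminus: "tl_action (- p) f B = - tl_action p f B"
  using tl_action_add[of p "- p" f B] by (simp add: eq_neg_iff_add_eq_0 add.commute)

lemma tl_action_diff: "tl_action (p - q) f B = tl_action p f B - tl_action q f B"
  using tl_action_add[of p "- q" f B] by (simp add: tl_action_uminus)

lemma tl_action_mult: "tl_action (p * q) f = tl_action p (tl_action q f)"
proof
  fix B
  show "tl_action (p * q) f B = tl_action p (tl_action q f) B"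
  proof (induct p rule: poly_mapping_single_add_induct)
    case (1 w c)
    have *: "tl_action (Poly_Mapping.single w c * q) f B = c * mono_action (letters w) (tl_action q f) B"
    proof (induct q rule: poly_mapping_single_add_induct)
      case (1 u d)
      have "tl_action (Poly_Mapping.single u d) f = (\<lambda>B. d * mono_action (letters u) f B)"
        by (rule ext) (rule tl_action_single)
      then show ?case
        by (simp add: mult_single tl_action_single plus_fmon_def mono_action_linear(2) mult.assoc)
    next
      case (2 p q)
      have "tl_action (p + q) f = (\<lambda>B. tl_action p f B + tl_action q f B)"
        by (rule ext) (rule tl_action_add)
      then show ?case using 2 by (simp add: distrib_left tl_action_add mono_action_linear(1))
    next
      case 3
      have "tl_action 0 f = (\<lambda>B. 0 * f B)" by (rule ext) simp
      then show ?case unfolding mult_zero_right using mono_action_linear(2)[of "letters w" 0 f] by simp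
    qed
    then show ?case by (simp add: tl_action_single)
  next
    case (2 p q)
    then show ?case by (simp add: distrib_right tl_action_add)
  qed simp
qed

lemma tl_action_scal: "tl_action (scal a) f B = a * f B"
  by (simp add: scal_def tl_action_single zero_fmon_def)

lemma tl_action_one: "tl_action 1 f = f"
  using tl_action_scal[of 1 f] by (simp add: scal_simps fun_eq_iff)

lemma tl_action_gen: "tl_action (free_gen i) f = gen_action i f"
  by (rule ext) (simp add: free_gen_def tl_action_single)

lemma tl_action_sum: "tl_action (sum g A) f B = (\<Sum>i\<in>A. tl_action (g i) f B)"
  by (induct A rule: infinite_finite_induct) (simp_all add: tl_action_add)

lemma diag_coeff_square: "diag_coeff i B * diag_coeff i B + 1 = (v_pow 1 + v_pow (- 1)) * diag_coeff i B"
  using v_pow_inverse by (simp add: diag_coeff_def distrib_right add.commute)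

lemma gen_action_square:
  "gen_action i (gen_action i f) B = (v_pow 1 + v_pow (- 1)) * gen_action i f B"
proof (cases "i \<in> B \<longleftrightarrow> Suc i \<in> B")
  case False
  let ?d = "diag_coeff i B" and ?e = "diag_coeff i (swap_at i B)"
  have de: "?d + ?e = v_pow 1 + v_pow (- 1)" using False by (auto simp: diag_coeff_def)
  have "gen_action i (gen_action i f) B = ?d * (?d * f B - f (swap_at i B)) - (?e * f (swap_at i B) - f B)"
    using False by (auto simp: gen_action_def)
  also have "\<dots> = (?d * ?d + 1) * f B - (?d + ?e) * f (swap_at i B)" by (simp add: algebra_simps)
  also have "\<dots> = (v_pow 1 + v_pow (- 1)) * (?d * f B - f (swap_at i B))"
    unfolding diag_coeff_square de by (simp add: algebra_simps)
  finally show ?thesis using False by (simp add: gen_action_def)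
qed (simp add: gen_action_def)

lemma gen_action_far:
  assumes "Suc i < j"
  shows "gen_action i (gen_action j f) B = gen_action j (gen_action i f) B"
proof -
  have "swap_at i (swap_at j B) = swap_at j (swap_at i B)"
    using assms by (auto simp: swap_at_def transpose_def)
  then show ?thesis using assms by (simp add: gen_action_def diag_coeff_def algebra_simps)
qed

lemma swap_at_id: "(i \<in> B \<longleftrightarrow> Suc i \<in> B) \<Longrightarrow> swap_at i B = B"
  unfolding swap_at_def using transpose_mem_iff[of i B "Suc i"] by auto

lemma gen_action_braid:
  "gen_action i (gen_action (Suc i) (gen_action i f)) B = gen_action i f B"
  "gen_action (Suc i) (gen_action i (gen_action (Suc i) f)) B = gen_action (Suc i) f B"
proof -
  have vv: "v_pow 1 * (v_pow (- 1) * x) = x" "v_pow (- 1) * (v_pow 1 * x) = x" for x :: laurent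
    using v_pow_inverse by (simp_all flip: mult.assoc)
  show "gen_action i (gen_action (Suc i) (gen_action i f)) B = gen_action i f B"
    by (cases "i \<in> B"; cases "Suc i \<in> B"; cases "Suc (Suc i) \<in> B")
      (auto simp: gen_action_def diag_coeff_def algebra_simps vv v_pow_inverse swap_at_id)
  show "gen_action (Suc i) (gen_action i (gen_action (Suc i) f)) B = gen_action (Suc i) f B"
    by (cases "i \<in> B"; cases "Suc i \<in> B"; cases "Suc (Suc i) \<in> B")
      (auto simp: gen_action_def diag_coeff_def algebra_simps vv v_pow_inverse swap_at_id)
qed

lemma gen_action_adjacent:
  assumes "\<bar>int i - int j\<bar> = 1"
  shows "gen_action j (gen_action i (gen_action j f)) B = gen_action j f B"
proof -
  from assms consider "i = Suc j" | "j = Suc i" by linarith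
  then show ?thesis using gen_action_braid by cases auto
qed

lemma gen_action_distant:
  assumes "\<bar>int i - int j\<bar> > 1"
  shows "gen_action i (gen_action j f) B = gen_action j (gen_action i f) B"
proof -
  from assms consider "Suc i < j" | "Suc j < i" by linarith
  then show ?thesis using gen_action_far by cases auto
qed

text \<open>The elements that act by zero form an ideal, and the relators are among them; so the
  action descends to the quotient.\<close>

lemma tl_action_TL_ideal:
  assumes "p \<in> TL_ideal n"
  shows "tl_action p f B = 0"
proof -
  let ?K = "{p \<in> carrier (free_alg n). \<forall>f B. tl_action p f B = 0}"
  interpret R: ring "free_alg n" by (rule ring_free_alg)
  have "mono_action u (\<lambda>B. 0) B = 0" for u B using mono_action_linear(2)[of u 0 "\<lambda>B. 0" B] by simp
  then have zero: "tl_action q (\<lambda>B. 0) B = 0" for q B by (simp add: tl_action_def)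
  have "ideal ?K (free_alg n)"
  proof (rule idealI[OF ring_free_alg])
    show "subgroup ?K (add_monoid (free_alg n))"
    proof (rule subgroup.intro)
      show "?K \<subseteq> carrier (add_monoid (free_alg n))" by auto
      show "\<one>\<^bsub>add_monoid (free_alg n)\<^esub> \<in> ?K" using R.zero_closed by simp
      show "x \<otimes>\<^bsub>add_monoid (free_alg n)\<^esub> y \<in> ?K" if "x \<in> ?K" "y \<in> ?K" for x y
        using that free_alg_closed(1) by (simp add: tl_action_add)
      show "inv\<^bsub>add_monoid (free_alg n)\<^esub> x \<in> ?K" if "x \<in> ?K" for x
      proof -
        have x: "x \<in> carrier (free_alg n)" "- x \<in> carrier (free_alg n)" using that free_alg_closed(3) by auto
        have "\<ominus>\<^bsub>free_alg n\<^esub> x = - x" using R.minus_equality[of "- x" x] x by simp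
        then show ?thesis using that x unfolding a_inv_def by (simp add: tl_action_uminus)
      qed
    qed
  next
    fix a x assume ax: "a \<in> ?K" "x \<in> carrier (free_alg n)"
    then have "tl_action a f = (\<lambda>B. 0)" for f by (auto simp: fun_eq_iff)
    then show "x \<otimes>\<^bsub>free_alg n\<^esub> a \<in> ?K" "a \<otimes>\<^bsub>free_alg n\<^esub> x \<in> ?K"
      using ax free_alg_closed(2) zero by (auto simp: tl_action_mult)
  qed
  moreover have "TL_relators n \<subseteq> ?K"
  proof
    fix r assume r: "r \<in> TL_relators n"
    then have "tl_action r f B = 0" for f B
      unfolding TL_relators_def
      by (auto simp: tl_action_diff tl_action_mult tl_action_gen tl_action_scal
          gen_action_adjacent gen_action_distant gen_action_square)
    then show "r \<in> ?K" using r TL_relators_subset by blast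
  qed
  ultimately have "TL_ideal n \<subseteq> ?K" unfolding TL_ideal_def by (rule R.genideal_minimal)
  then show ?thesis using assms by blast
qed

lemma tl_action_eq: "tl_eq n p q \<Longrightarrow> tl_action p f B = tl_action q f B"
  using tl_action_TL_ideal[of "p - q" n f B] by (simp add: tl_eq_def tl_action_diff)

section \<open>The braid action on configurations\<close>

definition strand_action :: "bool \<Rightarrow> nat \<Rightarrow> tl_vec \<Rightarrow> tl_vec"
  where "strand_action e i = tl_action (braid_letter (i, e))"

lemma strand_action_apply:
  "strand_action e i f B =
    (if i \<in> B \<longleftrightarrow> Suc i \<in> B then v_pow (if e then - 1 else 1) * f B
     else (v_pow (if e then - 1 else 1) - diag_coeff i B) * f B + f (swap_at i B))"
  by (simp add: strand_action_def braid_letter_def tl_action_diff tl_action_scal tl_action_gen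
      gen_action_def algebra_simps)

lemma tl_action_braid_image:
  "tl_action (braid_image []) f = f"
  "tl_action (braid_image ((i, e) # w)) f = strand_action e i (tl_action (braid_image w) f)"
  by (simp_all add: tl_action_one tl_action_mult strand_action_def)

lemma braid_move_action:
  assumes "braid_move n x y" "x \<in> braid_words n"
  shows "tl_action (braid_image x) f = tl_action (braid_image y) f"
  using tl_action_eq[OF braid_move_tl_eq(2)[OF assms]] by (simp add: fun_eq_iff)

text \<open>The axioms are instances of the braid moves, which already hold modulo the ideal; each
  is used with just enough generators for its letters.\<close>

interpretation action: braid_action "strand_action True" "strand_action False"
proof
  fix i j :: nat and f :: tl_vec
  assume i: "1 \<le> i"
  have "braid_move i [(i, True), (i, False)] []" "braid_move i [(i, False), (i, True)] []"
    using braid_move.cancel[of i i "[]" True "[]"] braid_move.cancel[of i i "[]" False "[]"] i by simp_all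
  from this[THEN braid_move_action, of f]
  show "strand_action True i (strand_action False i f) = f" "strand_action False i (strand_action True i f) = f"
    using i by (simp_all only: tl_action_braid_image braid_words_simps) simp_all
  show "strand_action True i (strand_action True j f) = strand_action True j (strand_action True i f)" if "Suc i < j"
  proof -
    have "braid_move j [(i, True), (j, True)] [(j, True), (i, True)]"
      using braid_move.commute[of i j j "[]" "[]"] i that by simp
    from braid_move_action[OF this, of f] show ?thesis
      using i that by (simp only: tl_action_braid_image braid_words_simps) simp
  qed
  show "strand_action True i (strand_action True (Suc i) (strand_action True i f)) =
      strand_action True (Suc i) (strand_action True i (strand_action True (Suc i) f))"
  proof -
    have "braid_move (Suc i) [(i, True), (Suc i, True), (i, True)] [(Suc i, True), (i, True), (Suc i, True)]"
      using braid_move.braid[of i "Suc i" "Suc i" "[]" "[]"] i by simp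
    from braid_move_action[OF this, of f] show ?thesis
      using i by (simp only: tl_action_braid_image braid_words_simps) simp
  qed
qed

lemma tl_action_transp_word:
  assumes "a < b"
  shows "tl_action (braid_image (transp_word (a, b))) f = action.band a b f"
  using assms
proof (induct b arbitrary: f)
  case (Suc b)
  show ?case
  proof (cases "a = b")
    case True
    then have "transp_word (a, Suc b) = [(a, True)]" by (simp add: transp_word_def)
    then show ?thesis using True by (simp only: tl_action_braid_image) simp
  next
    case False
    then have "transp_word (a, Suc b) = (b, False) # transp_word (a, b) @ [(b, True)]"
      using Suc(2) by (simp add: transp_word_def)
    moreover have "tl_action (braid_image (transp_word (a, b) @ [(b, True)])) f =
        tl_action (braid_image (transp_word (a, b))) (strand_action True b f)"
      by (simp add: tl_action_mult strand_action_def)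
    ultimately show ?thesis using Suc False by (simp only: tl_action_braid_image) simp
  qed
qed simp

lemma tl_action_transp_image:
  assumes "set ps \<subseteq> transp_pairs n"
  shows "tl_action (transp_image ps) f = action.bands ps f"
  using assms
proof (induct ps)
  case (Cons p ps)
  obtain a b where p: "p = (a, b)" by (cases p)
  then have ab: "a < b" using Cons by (simp add: transp_pairs_def)
  then show ?case using Cons tl_action_transp_word[OF ab] by (simp add: p tl_action_mult)
qed (simp add: tl_action_one)

section \<open>Occupied sites and cuts\<close>

text \<open>Integer-valued because differences are formed: for an entry from \<open>A\<close> to
  \<open>B\<close>, the difference of the counts at \<open>m\<close> is the net number of sites
  carried to the right across the cut after \<open>m\<close>.\<close>

definition count_upto :: "nat set \<Rightarrow> nat \<Rightarrow> int"
  where "count_upto B m = (\<Sum>q\<le>m. if q \<in> B then 1 else 0)"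

lemma count_upto_Suc: "count_upto B (Suc m) = count_upto B m + (if Suc m \<in> B then 1 else 0)"
  by (simp add: count_upto_def)

lemma count_upto_swap_at:
  "count_upto (swap_at b B) m = count_upto B m +
    (if m = b then (if Suc b \<in> B then 1 else 0) - (if b \<in> B then 1 else 0) else 0)"
proof (induct m)
  case 0
  then show ?case by (cases "b = 0") (auto simp: count_upto_def)
next
  case (Suc m)
  consider "Suc m = b" | "m = b" | "Suc m \<noteq> b" "m \<noteq> b" by blast
  then show ?case using Suc by cases (auto simp: count_upto_Suc)
qed

lemma count_upto_insert:
  assumes "a \<notin> B"
  shows "count_upto (insert a B) m = count_upto B m + (if a \<le> m then 1 else 0)"
proof (induct m)
  case 0
  then show ?case using assms by (cases "a = 0") (auto simp: count_upto_def)
next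
  case (Suc m)
  then show ?case using assms by (auto simp: count_upto_Suc le_Suc_eq)
qed

lemma count_upto_move:
  assumes "a \<notin> B" "b \<in> B" "a < b"
  shows "count_upto (insert a (B - {b})) m = count_upto B m + (if a \<le> m \<and> m < b then 1 else 0)"
proof -
  have "count_upto B m = count_upto (B - {b}) m + (if b \<le> m then 1 else 0)"
    using count_upto_insert[of b "B - {b}" m] assms by (simp add: insert_absorb)
  then show ?thesis using count_upto_insert[of a "B - {b}" m] assms by auto
qed

lemma strand_action_nonzero:
  assumes "strand_action e i f B \<noteq> 0"
  shows "f B \<noteq> 0 \<or> f (swap_at i B) \<noteq> 0"
proof (rule ccontr)
  assume "\<not> ?thesis"
  then show False using assms by (simp add: strand_action_apply split: if_splits)
qed

text \<open>At most one occupied site crosses each cut, although each conjugating generator moves sites by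
  itself: a second site is blocked because the target of the last generator is already occupied.\<close>

lemma band_transport:
  assumes "a < b" "action.band a b f B \<noteq> 0"
  shows "\<exists>A. f A \<noteq> 0 \<and> (\<forall>m. count_upto A m - count_upto B m \<le> (if a \<le> m \<and> m < b then 1 else 0) \<and>
    (m < a \<or> b \<le> m \<longrightarrow> count_upto A m = count_upto B m))"
  using assms
proof (induct b arbitrary: f B)
  case (Suc b)
  show ?case
  proof (cases "a = b")
    case True
    then have "strand_action True a f B \<noteq> 0" using Suc by simp
    from strand_action_nonzero[OF this] consider "f B \<noteq> 0" | "f (swap_at a B) \<noteq> 0" by blast
    then show ?thesis
    proof cases
      case 1
      then show ?thesis by (intro exI[of _ B]) simp
    next
      case 2
      then show ?thesis using True by (intro exI[of _ "swap_at a B"]) (auto simp: count_upto_swap_at)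
    qed
  next
    case False
    then have ab: "a < b" using Suc by simp
    then have "strand_action False b (action.band a b (strand_action True b f)) B \<noteq> 0"
      using Suc(3) unfolding action.band_Suc(1)[OF ab] by blast
    then obtain E where E: "E = B \<or> E = swap_at b B" "action.band a b (strand_action True b f) E \<noteq> 0"
      using strand_action_nonzero by metis
    obtain E' where E': "strand_action True b f E' \<noteq> 0"
      "\<And>m. count_upto E' m - count_upto E m \<le> (if a \<le> m \<and> m < b then 1 else 0)"
      "\<And>m. m < a \<or> b \<le> m \<Longrightarrow> count_upto E' m = count_upto E m"
      using Suc(1)[OF ab E(2)] by blast
    obtain A where A: "A = E' \<or> A = swap_at b E'" "f A \<noteq> 0"
      using strand_action_nonzero[OF E'(1)] by blast
    \<comment> \<open>The inner band changes the counts neither at \<open>b\<close> nor at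
      \<open>Suc b\<close>, so it keeps the state of site \<open>Suc b\<close>.\<close>
    have same: "Suc b \<in> E' \<longleftrightarrow> Suc b \<in> E"
      using E'(3)[of b] E'(3)[of "Suc b"] ab by (auto simp: count_upto_Suc split: if_splits)
    have ne: "count_upto A m = count_upto E' m" "count_upto E m = count_upto B m" if "m \<noteq> b" for m
      using A(1) E(1) that by (auto simp: count_upto_swap_at)
    have eq: "count_upto A b - count_upto B b \<le> 1"
      using A(1) E(1) E'(3)[of b] same ab by (auto simp: count_upto_swap_at split: if_splits)
    show ?thesis
    proof (intro exI[of _ A] conjI allI A(2))
      fix m
      show "count_upto A m - count_upto B m \<le> (if a \<le> m \<and> m < Suc b then 1 else 0)"
        using eq ne[of m] E'(2)[of m] ab by (cases "m = b") (auto split: if_splits)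
      show "m < a \<or> Suc b \<le> m \<longrightarrow> count_upto A m = count_upto B m"
        using ne[of m] E'(3)[of m] ab by (cases "m = b") auto
    qed
  qed
qed simp

text \<open>By hypothesis every configuration in the support of \<open>f\<close> has, at each cut
  below the band, a site more on the left than \<open>B\<close>. All the crossings must then be made
  by the band, which leaves a single path: one site travels from \<open>a\<close> to
  \<open>b\<close>. Each site in between contributes \<open>v\<close> if occupied in
  \<open>B\<close> and \<open>v^-1\<close> if empty.\<close>

lemma band_saturated:
  assumes "a < b" "\<And>A m. f A \<noteq> 0 \<Longrightarrow> a \<le> m \<Longrightarrow> m < b \<Longrightarrow> count_upto B m < count_upto A m"
  shows "\<exists>e. action.band a b f B = (if a \<notin> B \<and> b \<in> B then v_pow e * f (insert a (B - {b})) else 0)"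
  using assms
proof (induct b arbitrary: f B)
  case (Suc b)
  show ?case
  proof (cases "a = b")
    case True
    have fB: "f B = 0" using Suc(3)[of B a] True by auto
    have fs: "f (swap_at a B) = 0" if "a \<in> B" using Suc(3)[of "swap_at a B" a] True that
      by (cases "Suc b \<in> B") (auto simp: count_upto_swap_at)
    have "swap_at a B = insert a (B - {Suc a})" if "a \<notin> B" "Suc a \<in> B"
      using that by (auto simp: swap_at_def transpose_def split: if_splits)
    then have "strand_action True a f B = (if a \<notin> B \<and> Suc a \<in> B then f (insert a (B - {Suc a})) else 0)"
      using fB fs by (auto simp: strand_action_apply)
    then show ?thesis using True by (intro exI[of _ 0]) (simp add: v_pow_0)
  next
    case False
    then have ab: "a < b" using Suc by simp
    let ?f = "strand_action True b f" and ?g = "action.band a b (strand_action True b f)"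
    have hyp: "count_upto E m < count_upto A m"
      if E: "E = B \<or> E = swap_at b B" and A: "?f A \<noteq> 0" and m: "a \<le> m" "m < b" for E A m
    proof -
      obtain A' where A': "A' = A \<or> A' = swap_at b A" "f A' \<noteq> 0" using strand_action_nonzero[OF A] by blast
      have "count_upto B m < count_upto A' m" using Suc(3)[OF A'(2), of m] m by simp
      moreover have "count_upto E m = count_upto B m" "count_upto A' m = count_upto A m"
        using E A'(1) m by (auto simp: count_upto_swap_at)
      ultimately show ?thesis by simp
    qed
    have IH: "\<exists>e. ?g E = (if a \<notin> E \<and> b \<in> E then v_pow e * ?f (insert a (E - {b})) else 0)"
      if "E = B \<or> E = swap_at b B" for E
      using Suc(1)[OF ab, of ?f E] hyp[OF that] by blast
    have g0: "?g E = 0" if "E = B \<or> E = swap_at b B" "b \<notin> E" for E using IH[OF that(1)] that(2) by auto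
    \<comment> \<open>Moving the site at \<open>b\<close> back to \<open>a\<close> does not change
      the count at the cut \<open>b\<close>, where the support of \<open>f\<close> requires a
      strictly larger one.\<close>
    have fm: "f (insert a (B - {b})) = 0" if "b \<in> B" "a \<notin> B"
      using Suc(3)[of "insert a (B - {b})" b] count_upto_move[of a B b b] that ab by auto
    have band: "action.band a (Suc b) f B = strand_action False b ?g B"
      by (simp only: action.band_Suc(1)[OF ab])
    consider "b \<in> B" "Suc b \<in> B" | "b \<notin> B" "Suc b \<notin> B" | "b \<in> B" "Suc b \<notin> B" | "b \<notin> B" "Suc b \<in> B" by blast
    then show ?thesis
    proof cases
      case 1
      obtain e where e: "?g B = (if a \<notin> B \<and> b \<in> B then v_pow e * ?f (insert a (B - {b})) else 0)" using IH by blast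
      have "swap_at b (insert a (B - {b})) = insert a (B - {Suc b})" 
        using 1 ab by (auto simp: swap_at_def transpose_def split: if_splits)
      then have "?f (insert a (B - {b})) = f (insert a (B - {Suc b}))" if "a \<notin> B"
        using 1 ab fm that by (simp add: strand_action_apply)
      then have "action.band a (Suc b) f B = (if a \<notin> B then v_pow 1 * (v_pow e * f (insert a (B - {Suc b}))) else 0)"
        unfolding band using 1 e by (simp add: strand_action_apply[of False])
      then show ?thesis using 1 by (intro exI[of _ "1 + e"]) (simp add: v_pow_add mult.assoc)
    next
      case 2
      then have "action.band a (Suc b) f B = 0" unfolding band using g0 by (simp add: strand_action_apply[of False])
      then show ?thesis using 2 by simp
    next
      case 3
      obtain e where e: "?g B = (if a \<notin> B \<and> b \<in> B then v_pow e * ?f (insert a (B - {b})) else 0)" using IH by blast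
      have "?f (insert a (B - {b})) = 0" if "a \<notin> B" using 3 ab fm that by (simp add: strand_action_apply)
      then have "?g B = 0" using e by simp
      moreover have "?g (swap_at b B) = 0" using g0[of "swap_at b B"] 3 by simp
      ultimately have "action.band a (Suc b) f B = 0" unfolding band using 3 by (simp add: strand_action_apply[of False])
      then show ?thesis using 3 by simp
    next
      case 4
      let ?E = "swap_at b B"
      obtain e where e: "?g ?E = (if a \<notin> ?E \<and> b \<in> ?E then v_pow e * ?f (insert a (?E - {b})) else 0)" using IH by blast
      have m: "a \<in> ?E \<longleftrightarrow> a \<in> B" using ab by simp
      have "insert a (?E - {b}) = insert a (B - {Suc b})"
        using 4 ab by (auto simp: swap_at_def transpose_def split: if_splits)
      then have "?f (insert a (?E - {b})) = v_pow (- 1) * f (insert a (B - {Suc b}))"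
        using 4 ab by (simp add: strand_action_apply)
      then have "?g ?E = (if a \<notin> B then v_pow e * (v_pow (- 1) * f (insert a (B - {Suc b}))) else 0)"
        using e m 4 by simp
      moreover have "?g B = 0" using g0 4 by simp
      ultimately have "action.band a (Suc b) f B = (if a \<notin> B then v_pow e * (v_pow (- 1) * f (insert a (B - {Suc b}))) else 0)"
        unfolding band using 4 by (simp add: strand_action_apply[of False])
      then show ?thesis using 4 by (intro exI[of _ "e + - 1"]) (simp only: v_pow_add mult.assoc, simp)
    qed
  qed
qed simp

section \<open>Entries of the elements Z\<close>

definition delta :: "nat set \<Rightarrow> tl_vec"
  where "delta A B = (if B = A then 1 else 0)"

lemma nc_perm_peel_image:
  assumes x: "nc_perm x" and p: "p < x p" "\<And>q. q < p \<Longrightarrow> x q = q"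
  defines "y \<equiv> transpose p (x p) \<circ> x"
  shows "x ` exc x = insert (x p) (y ` exc y)" "x p \<notin> y ` exc y" "p \<notin> y ` exc y" "p \<notin> x ` exc x"
proof -
  have inj: "inj x" using nc_permD(1)[OF x] bij_is_inj by blast
  have pl: "exc x = insert p (exc y)" "p \<notin> exc y" "\<And>q. q \<in> exc y \<Longrightarrow> y q = x q"
    unfolding y_def by (rule nc_perm_peel[OF x p]; assumption)+
  have im: "y ` exc y = x ` exc y" using pl(3) by (intro image_cong refl)
  show "x ` exc x = insert (x p) (y ` exc y)" unfolding im pl(1) by simp
  show "x p \<notin> y ` exc y" unfolding im using pl(2) inj by (metis image_iff injD)
  show np: "p \<notin> x ` exc x"
  proof
    assume "p \<in> x ` exc x"
    then obtain q where "q < p" "x q = p" by (auto simp: exc_def)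
    then show False using p(2)[of q] by simp
  qed
  then show "p \<notin> y ` exc y" unfolding im pl(1) by auto
qed

text \<open>The number of edges of \<open>x\<close> over the cut \<open>m\<close> is the difference
  of the counts of its two sets, and each band accounts for one edge. If the bound is attained at
  every cut, each band carries a site to its right end, and these ends stay occupied. The set
  \<open>F\<close> of occupied fixed points is there for the induction: after peeling,
  \<open>p\<close> is a fixed point of the rest and carries a site.\<close>

lemma bands_entries:
  assumes "nc_perm x" "x permutes {1..n+1}"
  shows "\<exists>ps. set ps \<subseteq> transp_pairs n \<and> transp_prod ps = x \<and> length ps = card (exc x) \<and>
    (\<forall>A B. action.bands ps (delta A) B \<noteq> 0 \<longrightarrow>
      (\<forall>m. count_upto A m - count_upto B m \<le> count_upto (exc x) m - count_upto (x ` exc x) m)) \<and>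
    (\<forall>A B. action.bands ps (delta A) B \<noteq> 0 \<longrightarrow>
      (\<forall>m. count_upto A m - count_upto B m = count_upto (exc x) m - count_upto (x ` exc x) m) \<longrightarrow>
      x ` exc x \<subseteq> B) \<and>
    (\<forall>F. F \<subseteq> {q. x q = q} \<longrightarrow>
      (\<exists>e. action.bands ps (delta (exc x \<union> F)) (x ` exc x \<union> F) = v_pow e))"
  using assms
proof (induct "card (exc x)" arbitrary: x rule: less_induct)
  case less
  note x = less(2,3)
  show ?case
  proof (cases "x = id")
    case True
    then have e: "exc x = {}" by (simp add: exc_def)
    have d: "action.bands [] (delta A) B = (if B = A then 1 else 0)" for A B by (simp add: delta_def)
    show ?thesis unfolding e
      by (rule exI[of _ "[]"]) (auto simp: d delta_def True word_prod_Nil v_pow_0 split: if_splits intro!: exI[of _ 0])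
  next
    case False
    then obtain p where p: "p < x p" "\<And>q. q < p \<Longrightarrow> x q = q"
      using exists_least_moved nc_permD(1)[OF x(1)] bij_is_inj by metis
    define u where "u = x p"
    define y where "y = transpose p u \<circ> x"
    have pl: "nc_perm y" "y p = p" "\<And>q. q < p \<Longrightarrow> y q = q" "p \<notin> exc y" "exc x = insert p (exc y)"
      unfolding y_def u_def by (rule nc_perm_peel[OF x(1) p]; assumption)+
    have pi: "x ` exc x = insert u (y ` exc y)" "u \<notin> y ` exc y" "p \<notin> y ` exc y" "p \<notin> x ` exc x"
      unfolding y_def u_def by (rule nc_perm_peel_image[OF x(1) p]; assumption)+
    have pin: "p \<in> {1..n+1}" "u \<in> {1..n+1}" "p < u"
      using permutes_exc_subset[OF x(2)] p(1) by (auto simp: exc_def u_def)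
    have yper: "y permutes {1..n+1}" unfolding y_def using permutes_transpose_comp[OF x(2) pin(1,2)] .
    have c: "card (exc x) = Suc (card (exc y))" using pl(4,5) finite_exc[OF yper] by simp
    obtain ps where ps: "set ps \<subseteq> transp_pairs n" "transp_prod ps = y" "length ps = card (exc y)"
      and b1: "\<And>A B m. action.bands ps (delta A) B \<noteq> 0 \<Longrightarrow>
        count_upto A m - count_upto B m \<le> count_upto (exc y) m - count_upto (y ` exc y) m"
      and b2: "\<And>A B. action.bands ps (delta A) B \<noteq> 0 \<Longrightarrow>
        (\<And>m. count_upto A m - count_upto B m = count_upto (exc y) m - count_upto (y ` exc y) m) \<Longrightarrow>
        y ` exc y \<subseteq> B"
      and b3: "\<And>F. F \<subseteq> {q. y q = q} \<Longrightarrow>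
        \<exists>e. action.bands ps (delta (exc y \<union> F)) (y ` exc y \<union> F) = v_pow e"
      using less(1)[of y] c pl(1) yper by auto
    have h: "count_upto (exc x) m - count_upto (x ` exc x) m =
        count_upto (exc y) m - count_upto (y ` exc y) m + (if p \<le> m \<and> m < u then 1 else 0)" for m
    proof -
      have "count_upto (x ` exc x) m = count_upto (y ` exc y) m + (if u \<le> m then 1 else 0)"
        unfolding pi(1) by (rule count_upto_insert[OF pi(2)])
      moreover have "count_upto (exc x) m = count_upto (exc y) m + (if p \<le> m then 1 else 0)"
        unfolding pl(5) by (rule count_upto_insert[OF pl(4)])
      ultimately show ?thesis using pin by simp
    qed
    \<comment> \<open>Attaining the bound for the whole word forces the outermost band to supply a
      crossing at each of its cuts, since the inner bands are bounded by the edges of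
      \<open>y\<close>.\<close>
    have sat: "\<exists>e. action.bands ((p, u) # ps) (delta A) B =
        (if p \<notin> B \<and> u \<in> B then v_pow e * action.bands ps (delta A) (insert p (B - {u})) else 0)"
      if eq: "\<And>m. count_upto A m - count_upto B m = count_upto (exc x) m - count_upto (x ` exc x) m" for A B
    proof -
      have "count_upto B m < count_upto E m" if "action.bands ps (delta A) E \<noteq> 0" "p \<le> m" "m < u" for E m
        using b1[OF that(1), of m] eq[of m] h[of m] that by simp
      from band_saturated[OF pin(3) this] show ?thesis by simp
    qed
    show ?thesis
    proof (intro exI[of _ "(p, u) # ps"] conjI allI impI)
      show "set ((p, u) # ps) \<subseteq> transp_pairs n" using ps pin by (auto simp: transp_pairs_def)
      show "transp_prod ((p, u) # ps) = x"
        unfolding list.map prod.case word_prod_Cons ps(2) y_def by (simp add: fun_eq_iff)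
      show "length ((p, u) # ps) = card (exc x)" using ps c by simp
    next
      fix A B m assume "action.bands ((p, u) # ps) (delta A) B \<noteq> 0"
      then have "action.band p u (action.bands ps (delta A)) B \<noteq> 0" by simp
      from band_transport[OF pin(3) this] obtain E where E: "action.bands ps (delta A) E \<noteq> 0"
        "\<And>m. count_upto E m - count_upto B m \<le> (if p \<le> m \<and> m < u then 1 else 0)" by blast
      show "count_upto A m - count_upto B m \<le> count_upto (exc x) m - count_upto (x ` exc x) m"
        using b1[OF E(1), of m] E(2)[of m] h[of m] by simp
    next
      fix A B
      assume nz: "action.bands ((p, u) # ps) (delta A) B \<noteq> 0"
        and eq: "\<forall>m. count_upto A m - count_upto B m = count_upto (exc x) m - count_upto (x ` exc x) m"
      have m: "p \<notin> B" "u \<in> B" and nz': "action.bands ps (delta A) (insert p (B - {u})) \<noteq> 0"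
        using sat[of A B] eq nz by (auto split: if_splits)
      have "y ` exc y \<subseteq> insert p (B - {u})"
      proof (rule b2[OF nz'])
        fix k
        show "count_upto A k - count_upto (insert p (B - {u})) k = count_upto (exc y) k - count_upto (y ` exc y) k"
          using count_upto_move[OF m pin(3), of k] eq[rule_format, of k] h[of k] by linarith
      qed
      then show "x ` exc x \<subseteq> B" unfolding pi(1) using m pi(3) by auto
    next
      fix F assume F: "F \<subseteq> {q. x q = q}"
      have inj: "inj x" using nc_permD(1)[OF x(1)] bij_is_inj by blast
      have ne: "p \<notin> F" "u \<notin> F" using F p(1) injD[OF inj, of u p] by (auto simp: u_def)
      have F': "insert p F \<subseteq> {q. y q = q}"
        using F ne pl(2) by (auto simp: y_def transpose_def)
      obtain e where e: "action.bands ps (delta (exc y \<union> insert p F)) (y ` exc y \<union> insert p F) = v_pow e"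
        using b3[OF F'] by blast
      have dis: "exc x \<inter> F = {}" "x ` exc x \<inter> F = {}"
        using F inj by (auto simp: exc_def dest: injD)
      have cu: "count_upto (S \<union> F) m = count_upto S m + count_upto F m" if "S \<inter> F = {}" for S m
        unfolding count_upto_def sum.distrib[symmetric] using that by (intro sum.cong) auto
      obtain d where d: "action.bands ((p, u) # ps) (delta (exc x \<union> F)) (x ` exc x \<union> F) =
          (if p \<notin> x ` exc x \<union> F \<and> u \<in> x ` exc x \<union> F then
            v_pow d * action.bands ps (delta (exc x \<union> F)) (insert p (x ` exc x \<union> F - {u})) else 0)"
        using sat[of "exc x \<union> F" "x ` exc x \<union> F"] cu[OF dis(1)] cu[OF dis(2)] by auto
      have "p \<notin> x ` exc x \<union> F" "u \<in> x ` exc x \<union> F" using pi(4) ne pi(1) by auto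
      moreover have "insert p (x ` exc x \<union> F - {u}) = y ` exc y \<union> insert p F" using pi(1,2) ne by auto
      moreover have "exc x \<union> F = exc y \<union> insert p F" using pl(5) by auto
      ultimately have "action.bands ((p, u) # ps) (delta (exc x \<union> F)) (x ` exc x \<union> F) = v_pow (d + e)"
        using d e by (simp add: v_pow_add)
      then show "\<exists>e. action.bands ((p, u) # ps) (delta (exc x \<union> F)) (x ` exc x \<union> F) = v_pow e" by blast
    qed
  qed
qed

lemma count_upto_eq_card: "B \<subseteq> {..m} \<Longrightarrow> count_upto B m = int (card B)"
  by (simp add: count_upto_def Int_absorb1 flip: sum.inter_restrict) 

lemma sum_count_upto:
  assumes "finite B" "B \<subseteq> {..M}"
  shows "(\<Sum>m\<le>M. count_upto B m) = (\<Sum>q\<in>B. int (M + 1) - int q)"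
  using assms
proof (induct B)
  case empty
  show ?case by (simp add: count_upto_def)
next
  case (insert q B)
  have "(\<Sum>m\<le>M. (if q \<le> m then 1 else 0 :: int)) = int (card {m\<in>{..M}. q \<le> m})"
    by (simp flip: sum.inter_filter)
  also have "{m\<in>{..M}. q \<le> m} = {q..M}" by auto
  finally have "(\<Sum>m\<le>M. (if q \<le> m then 1 else 0 :: int)) = int (M + 1) - int q" using insert by (simp add: of_nat_diff)
  then show ?case using insert count_upto_insert[OF insert(2)] by (simp add: sum.distrib)
qed

lemma count_upto_inj:
  assumes "\<And>m. count_upto A m = count_upto B m" "0 \<notin> A" "0 \<notin> B"
  shows "A = B"
proof -
  have "q \<in> A \<longleftrightarrow> q \<in> B" for q
  proof (cases q)
    case (Suc m)
    show ?thesis using assms(1)[of m] assms(1)[of "Suc m"] by (simp add: count_upto_Suc Suc split: if_splits)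
  qed (use assms in simp)
  then show ?thesis by blast
qed

text \<open>Comparing edges over all cuts compares the arc sums. If these agree, all cuts agree, and
  \<open>sub\<close> makes the ascent values of \<open>y\<close> ascent values of \<open>x\<close>.
  Then \<open>x\<close> has more ascents and a smaller key, or the ascent values coincide; in that
  case the cuts give equal ascents too, and \<open>x = y\<close>.\<close>

lemma nc_key_le:
  assumes x: "nc_perm x" "x permutes {1..n+1}" and y: "nc_perm y" "y permutes {1..n+1}"
    and le: "\<And>m. count_upto (exc x) m - count_upto (x ` exc x) m \<le> count_upto (exc y) m - count_upto (y ` exc y) m"
    and sub: "(\<And>m. count_upto (exc x) m - count_upto (x ` exc x) m = count_upto (exc y) m - count_upto (y ` exc y) m)
      \<Longrightarrow> y ` exc y \<subseteq> x ` exc x"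
  shows "x = y \<or> nc_key n x < nc_key n y"
proof -
  let ?H = "\<lambda>z m. count_upto (exc z) m - count_upto (z ` exc z) m"
  let ?M = "n + 1"
  \<comment> \<open>An edge lies over as many cuts as its length.\<close>
  have arc: "arc_sum z = (\<Sum>m\<le>?M. ?H z m)" if z: "nc_perm z" "z permutes {1..n+1}" for z
  proof -
    note s = permutes_exc_subset[OF z(2)]
    have f: "finite (exc z)" using finite_exc[OF z(2)] .
    have "(\<Sum>m\<le>?M. ?H z m) = (\<Sum>q\<in>exc z. int (?M + 1) - int q) - (\<Sum>q\<in>z ` exc z. int (?M + 1) - int q)"
      using sum_count_upto[of "exc z" ?M] sum_count_upto[of "z ` exc z" ?M] f s
      by (subst sum_subtractf) force
    also have "\<dots> = arc_sum z"
      by (simp add: sum_subtractf arc_sum_def card_image_exc[OF z(1)])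
    finally show ?thesis by simp
  qed
  have sub_n: "exc z \<subseteq> {1..n}" if z: "z permutes {1..n+1}" for z
  proof
    fix q assume "q \<in> exc z"
    then show "q \<in> {1..n}" using permutes_exc_subset[OF z] by (force simp: exc_def)
  qed
  have card_n: "card (exc z) \<le> n" if "z permutes {1..n+1}" for z
    using card_mono[OF _ sub_n[OF that]] by simp
  have al: "arc_sum x \<le> arc_sum y" unfolding arc[OF x] arc[OF y] using le by (intro sum_mono)
  show ?thesis
  proof (cases "arc_sum x = arc_sum y")
    case False
    then have "arc_sum x + 1 \<le> arc_sum y" using al by simp
    then have "(int n + 1) * (arc_sum x + 1) \<le> (int n + 1) * arc_sum y" by (intro mult_left_mono) auto
    then have "nc_key n x < nc_key n y"
      using card_n[OF y(2)] by (simp add: nc_key_def algebra_simps)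
    then show ?thesis ..
  next
    case True
    have "\<forall>m\<in>{..?M}. ?H x m = ?H y m"
    proof (rule ccontr)
      assume "\<not> ?thesis"
      then have "\<exists>m\<in>{..?M}. ?H x m < ?H y m" using le by (meson order_le_less)
      then have "(\<Sum>m\<le>?M. ?H x m) < (\<Sum>m\<le>?M. ?H y m)" using le by (intro sum_strict_mono_ex1) auto
      then show False using True arc[OF x] arc[OF y] by simp
    qed
    \<comment> \<open>Past the last strand both sets are counted in full and have equal size, so no
      edge is left.\<close>
    moreover have "?H z m = 0" if "\<not> m \<le> ?M" "nc_perm z" "z permutes {1..n+1}" for z m
    proof -
      have "exc z \<subseteq> {..m}" "z ` exc z \<subseteq> {..m}" using permutes_exc_subset[OF that(3)] that(1) by force+
      then show ?thesis using count_upto_eq_card card_image_exc[OF that(2)] by simp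
    qed
    ultimately have H: "?H x m = ?H y m" for m using x y by (cases "m \<le> ?M") auto
    have sb: "y ` exc y \<subseteq> x ` exc x" by (rule sub) (rule H)
    have fx: "finite (x ` exc x)" using finite_exc[OF x(2)] by simp
    have cards: "card (y ` exc y) \<le> card (x ` exc x)" using card_mono[OF fx sb] .
    show ?thesis
    proof (cases "card (exc y) = card (exc x)")
      case False
      then have "card (exc y) < card (exc x)" using cards card_image_exc x y by simp
      then show ?thesis using True by (simp add: nc_key_def)
    next
      case eqc: True
      then have U: "y ` exc y = x ` exc x" using card_subset_eq[OF fx sb] card_image_exc x y by simp
      have "exc x = exc y"
      proof (rule count_upto_inj)
        show "count_upto (exc x) m = count_upto (exc y) m" for m using H[of m] U by simp
        show "0 \<notin> exc x" "0 \<notin> exc y" using permutes_exc_subset(1)[OF x(2)] permutes_exc_subset(1)[OF y(2)] by auto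
      qed
      then show ?thesis using nc_perm_unique[OF x(1) y(1)] U by simp
    qed
  qed
qed

text \<open>The word behind \<open>Z_elt\<close> acts like the peeled word, for which bounds and the
  diagonal entry are known.\<close>

lemma Z_elt_representative:
  assumes y: "nc_perm y" "y permutes {1..n+1}"
  shows "\<exists>p\<in>carrier (free_alg n). Z_elt n y = tl_class n p \<and>
    (\<forall>x. nc_perm x \<longrightarrow> x permutes {1..n+1} \<longrightarrow> tl_action p (delta (exc x)) (x ` exc x) \<noteq> 0 \<longrightarrow>
      x = y \<or> nc_key n x < nc_key n y) \<and>
    (\<exists>e. tl_action p (delta (exc y)) (y ` exc y) = v_pow e)"
proof -
  obtain qs where qs: "set qs \<subseteq> transp_pairs n" "transp_prod qs = y" "length qs = len_T n y"
    "Z_elt n y = tl_class n (transp_image qs)"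
    using Z_elt_eq[OF y(2)] by blast
  obtain ps where ps: "set ps \<subseteq> transp_pairs n" "transp_prod ps = y" "length ps = card (exc y)"
    and b1: "\<And>A B m. action.bands ps (delta A) B \<noteq> 0 \<Longrightarrow>
      count_upto A m - count_upto B m \<le> count_upto (exc y) m - count_upto (y ` exc y) m"
    and b2: "\<And>A B. action.bands ps (delta A) B \<noteq> 0 \<Longrightarrow>
      (\<And>m. count_upto A m - count_upto B m = count_upto (exc y) m - count_upto (y ` exc y) m) \<Longrightarrow>
      y ` exc y \<subseteq> B"
    and b3: "\<And>F. F \<subseteq> {q. y q = q} \<Longrightarrow>
      \<exists>e. action.bands ps (delta (exc y \<union> F)) (y ` exc y \<union> F) = v_pow e"
    using bands_entries[OF y] by auto
  have len: "length qs = card (exc y)" using qs(3) len_T_nc_perm[OF y] by simp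
  have act: "tl_action (transp_image qs) f = action.bands ps f" for f
    by (rule trans[OF tl_action_transp_image[OF qs(1)] action.bands_reduced_eq[OF y qs(1,2) len ps]])
  show ?thesis
  proof (intro bexI[of _ "transp_image qs"] conjI allI impI)
    show "transp_image qs \<in> carrier (free_alg n)"
      by (rule braid_image_closed[OF concat_transp_word_closed[OF qs(1)]])
    show "Z_elt n y = tl_class n (transp_image qs)" by (rule qs(4))
    show "\<exists>e. tl_action (transp_image qs) (delta (exc y)) (y ` exc y) = v_pow e"
      using b3[of "{}"] by (simp add: act)
    fix x assume x: "nc_perm x" "x permutes {1..n+1}"
      and nz: "tl_action (transp_image qs) (delta (exc x)) (x ` exc x) \<noteq> 0"
    have nz': "action.bands ps (delta (exc x)) (x ` exc x) \<noteq> 0" using nz by (simp add: act)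
    show "x = y \<or> nc_key n x < nc_key n y"
      using nc_key_le[OF x y b1[OF nz'] b2[OF nz']] .
  qed
qed

section \<open>The elements of the sets Q\<close>

lemma comp_fun_commute_on_commuting:
  assumes "\<And>s t. s \<in> A \<Longrightarrow> t \<in> A \<Longrightarrow> s \<circ> t = t \<circ> s"
  shows "comp_fun_commute_on A (\<circ>)"
proof
  fix s t assume "s \<in> A" "t \<in> A"
  then have c: "t \<circ> s = s \<circ> t" using assms by blast
  show "(\<circ>) t \<circ> (\<circ>) s = (\<circ>) s \<circ> (\<circ>) t"
  proof
    fix h
    have "t \<circ> (s \<circ> h) = s \<circ> (t \<circ> h)" unfolding comp_assoc[symmetric] c ..
    then show "((\<circ>) t \<circ> (\<circ>) s) h = ((\<circ>) s \<circ> (\<circ>) t) h" by simp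
  qed
qed

text \<open>Composition is well behaved under the fold only on commuting families; there a factor
  can be split off on either side, as toggles from the left and from the right require.\<close>

lemma commuting_prod_insert:
  assumes "finite A" "s \<notin> A" "\<And>s' t. s' \<in> insert s A \<Longrightarrow> t \<in> insert s A \<Longrightarrow> s' \<circ> t = t \<circ> s'"
  shows "commuting_prod (insert s A) = s \<circ> commuting_prod A"
    "commuting_prod (insert s A) = commuting_prod A \<circ> s"
proof -
  have step: "commuting_prod (insert t B) = t \<circ> commuting_prod B"
    if "finite B" "t \<notin> B" "insert t B \<subseteq> insert s A" for t B
  proof -
    have "comp_fun_commute_on (insert s A) (\<circ>)" using assms(3) by (rule comp_fun_commute_on_commuting)
    from comp_fun_commute_on.fold_insert[OF this that(3,1,2)] show ?thesis by (simp add: commuting_prod_def)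
  qed
  show 1: "commuting_prod (insert s A) = s \<circ> commuting_prod A" using step assms(1,2) by blast
  have "s \<circ> commuting_prod B = commuting_prod B \<circ> s" if "B \<subseteq> A" for B
  proof -
    have "finite B" using that assms(1) finite_subset by blast
    then show ?thesis using that
    proof (induct B)
      case empty
      show ?case by (simp add: commuting_prod_def)
    next
      case (insert t B)
      have "insert t B \<subseteq> insert s A" using insert by auto
      note st = step[OF insert(1,2) this]
      have IH: "s \<circ> commuting_prod B = commuting_prod B \<circ> s" using insert by blast
      have "s \<circ> t = t \<circ> s" using assms(3) insert by blast
      then show ?case unfolding st using IH by (metis comp_assoc)
    qed
  qed
  then show "commuting_prod (insert s A) = commuting_prod A \<circ> s" using 1 by simp
qed

lemma commuting_prod_simple_refl_insert:
  assumes "finite K" "i \<notin> K" "\<And>k. k \<in> insert i K \<Longrightarrow> Suc k \<notin> insert i K"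
  shows "commuting_prod (simple_refl ` insert i K) = simple_refl i \<circ> commuting_prod (simple_refl ` K)"
    "commuting_prod (simple_refl ` insert i K) = commuting_prod (simple_refl ` K) \<circ> simple_refl i"
proof -
  have c: "s \<circ> t = t \<circ> s" if st: "s \<in> insert (simple_refl i) (simple_refl ` K)" "t \<in> insert (simple_refl i) (simple_refl ` K)" for s t
  proof -
    obtain a b where ab: "a \<in> insert i K" "b \<in> insert i K" "s = simple_refl a" "t = simple_refl b" using st by auto
    have "Suc a \<noteq> b" "Suc b \<noteq> a" using assms(3)[OF ab(1)] assms(3)[OF ab(2)] ab(1,2) by auto
    then have "Suc a < b \<or> Suc b < a \<or> a = b" by linarith
    then show ?thesis unfolding ab(3,4) by (rule simple_refl_commute)
  qed
  have "simple_refl i \<notin> simple_refl ` K" using assms(2) by auto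
  from commuting_prod_insert[OF _ this c] assms(1)
  show "commuting_prod (simple_refl ` insert i K) = simple_refl i \<circ> commuting_prod (simple_refl ` K)"
    "commuting_prod (simple_refl ` insert i K) = commuting_prod (simple_refl ` K) \<circ> simple_refl i" by simp_all
qed

text \<open>The condition for a left toggle at \<open>i\<close>; left descents of \<open>w\<close>
  satisfy it for \<open>psi n w\<close>. The analogous condition for right toggles follows.\<close>

definition left_ok :: "(nat \<Rightarrow> nat) \<Rightarrow> nat \<Rightarrow> bool"
  where "left_ok x i \<longleftrightarrow> Suc i \<in> x ` exc x \<and> i \<notin> x ` exc x"

definition right_ok :: "(nat \<Rightarrow> nat) \<Rightarrow> nat \<Rightarrow> bool"
  where "right_ok x j \<longleftrightarrow> j \<in> exc x \<and> Suc j \<notin> exc x"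

lemma toggle_mem:
  assumes "P \<and> D' = insert k D \<and> U' = insert k U \<or> Q \<and> D' = D - {a} \<and> U' = U - {b}"
  shows "Suc i \<in> U \<Longrightarrow> i \<notin> U \<Longrightarrow> i \<noteq> k \<Longrightarrow> Suc i \<noteq> b \<Longrightarrow> Suc i \<in> U' \<and> i \<notin> U'"
    "j \<in> D \<Longrightarrow> Suc j \<notin> D \<Longrightarrow> Suc j \<noteq> k \<Longrightarrow> j \<noteq> a \<Longrightarrow> j \<in> D' \<and> Suc j \<notin> D'"
  using assms by auto

text \<open>A right toggle at \<open>j\<close> alters the ascent values only at
  \<open>Suc j\<close>, so it can spoil the condition for a left toggle at \<open>i\<close> only if
  \<open>i = j\<close> or \<open>i = Suc j\<close>. These are the two conflicts that the removal
  process excludes, whence the hypotheses \<open>dis\<close>. Admissible right indices are never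
  adjacent, so their reflections commute.\<close>

lemma right_toggles:
  assumes n: "n \<ge> 1" and x: "nc_perm x" "x permutes {1..n+1}"
    and I: "\<And>i. i \<in> I \<Longrightarrow> i \<in> {1..n} \<and> left_ok x i" and J: "\<And>j. j \<in> J \<Longrightarrow> j \<in> {1..n} \<and> right_ok x j"
    and dis: "I \<inter> J = {}" "\<And>j. j \<in> J \<Longrightarrow> Suc j \<notin> I" and K: "finite K" "K \<subseteq> J"
  defines "y \<equiv> x \<circ> commuting_prod (simple_refl ` K)"
  shows "nc_perm y \<and> y permutes {1..n+1} \<and> (\<forall>i\<in>I. left_ok y i) \<and> (\<forall>j\<in>J - K. right_ok y j) \<and>
    nc_key n y \<le> nc_key n x \<and> (K \<noteq> {} \<longrightarrow> nc_key n y < nc_key n x)"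
  unfolding y_def using K
proof (induct K)
  case empty
  then show ?case using x I J by (simp add: commuting_prod_def)
next
  case (insert j K)
  have na: "Suc k \<notin> insert j K" if "k \<in> insert j K" for k
    using J that insert(4) unfolding right_ok_def by blast
  let ?y = "x \<circ> commuting_prod (simple_refl ` K)"
  have IH: "nc_perm ?y" "?y permutes {1..n+1}" "\<And>i. i \<in> I \<Longrightarrow> left_ok ?y i" "\<And>k. k \<in> J - K \<Longrightarrow> right_ok ?y k"
    "nc_key n ?y \<le> nc_key n x"
    using insert(3)[OF insert_subset[THEN iffD1, OF insert(4), THEN conjunct2]] by blast+
  have e: "x \<circ> commuting_prod (simple_refl ` insert j K) = ?y \<circ> transpose j (Suc j)"
    using commuting_prod_simple_refl_insert(2)[OF insert(1,2) na] by (simp only: comp_assoc simple_refl_def[of j, unfolded Suc_eq_plus1[symmetric]])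
  have j: "j \<in> {1..n}" "j \<in> exc ?y" "Suc j \<notin> exc ?y" "j \<in> J"
    using IH(4)[of j] J insert(2,4) by (auto simp: right_ok_def)
  let ?z = "?y \<circ> transpose j (Suc j)"
  note t = nc_perm_right_toggle[OF IH(1) j(2,3)]
  have zp: "?z permutes {1..n+1}"
    using permutes_compose[OF permutes_swap_id IH(2), of j "Suc j"] j(1) by simp
  have key: "nc_key n ?z < nc_key n x" using nc_key_right_toggle[OF IH(1,2) n j(2,3)] IH(5) by simp
  have L: "left_ok ?z i" if "i \<in> I" for i
  proof -
    have "i \<noteq> Suc j" "Suc i \<noteq> Suc j" using dis j(4) that by auto
    then show ?thesis using toggle_mem(1)[OF t(2)] IH(3)[OF that] unfolding left_ok_def by blast
  qed
  have R: "right_ok ?z k" if "k \<in> J - insert j K" for k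
  proof -
    have "Suc k \<noteq> Suc j" "k \<noteq> j" "k \<in> J - K" using that by auto
    then show ?thesis using toggle_mem(2)[OF t(2)] IH(4)[of k] unfolding right_ok_def by blast
  qed
  show ?case unfolding e using t(1) zp key order_less_imp_le[OF key] L R by blast
qed

lemma left_toggles:
  assumes n: "n \<ge> 1" and x: "nc_perm x" "x permutes {1..n+1}"
    and I: "\<And>i. i \<in> I \<Longrightarrow> i \<in> {1..n} \<and> left_ok x i" and K: "finite K" "K \<subseteq> I"
  defines "y \<equiv> commuting_prod (simple_refl ` K) \<circ> x"
  shows "nc_perm y \<and> y permutes {1..n+1} \<and> (\<forall>i\<in>I - K. left_ok y i) \<and>
    nc_key n y \<le> nc_key n x \<and> (K \<noteq> {} \<longrightarrow> nc_key n y < nc_key n x)"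
  unfolding y_def using K
proof (induct K)
  case empty
  then show ?case using x I by (simp add: commuting_prod_def)
next
  case (insert i K)
  have na: "Suc k \<notin> insert i K" if "k \<in> insert i K" for k
    using I that insert(4) unfolding left_ok_def by blast
  let ?y = "commuting_prod (simple_refl ` K) \<circ> x"
  have IH: "nc_perm ?y" "?y permutes {1..n+1}" "\<And>k. k \<in> I - K \<Longrightarrow> left_ok ?y k"
    "nc_key n ?y \<le> nc_key n x"
    using insert(3)[OF insert_subset[THEN iffD1, OF insert(4), THEN conjunct2]] by blast+
  have e: "commuting_prod (simple_refl ` insert i K) \<circ> x = transpose i (Suc i) \<circ> ?y"
    using commuting_prod_simple_refl_insert(1)[OF insert(1,2) na] by (simp only: comp_assoc simple_refl_def[of i, unfolded Suc_eq_plus1[symmetric]])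
  have i: "i \<in> {1..n}" "Suc i \<in> ?y ` exc ?y" "i \<notin> ?y ` exc ?y"
    using IH(3)[of i] I insert(2,4) unfolding left_ok_def by blast+
  let ?z = "transpose i (Suc i) \<circ> ?y"
  note t = nc_perm_left_toggle[OF IH(1) i(2,3)]
  have zp: "?z permutes {1..n+1}" using permutes_transpose_comp[OF IH(2), of i "Suc i"] i(1) by simp
  have key: "nc_key n ?z < nc_key n x" using nc_key_left_toggle[OF IH(1,2) n i(2,3)] IH(4) by simp
  have L: "left_ok ?z k" if "k \<in> I - insert i K" for k
  proof -
    have "k \<noteq> i" "Suc k \<noteq> Suc i" "k \<in> I - K" using that by auto
    then show ?thesis using toggle_mem(1)[OF t(2)] IH(3)[of k] unfolding left_ok_def by blast
  qed
  show ?case unfolding e using t(1) zp key order_less_imp_le[OF key] L by blast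
qed

lemma removal_subset: "(removal n)\<^sup>*\<^sup>* p q \<Longrightarrow> fst q \<subseteq> fst p \<and> snd q \<subseteq> snd p"
proof (induct rule: rtranclp_induct)
  case (step q r)
  from step(2) have "fst r \<subseteq> fst q \<and> snd r \<subseteq> snd q" by cases auto
  with step(3) show ?case by blast
qed simp

text \<open>Every removal shrinks one of the sets. Existence gives meaning to the choice in
  \<open>x_elt\<close>.\<close>

lemma ending_pair_exists:
  assumes "finite L" "finite R"
  shows "\<exists>p. ending_pair n (L, R) p"
  using assms
proof (induct "card L + card R" arbitrary: L R rule: less_induct)
  case less
  have step: "\<exists>p. ending_pair n (L, R) p" if "removal n (L, R) (L', R')" "card L' + card R' < card L + card R"
    "finite L'" "finite R'" for L' R'
  proof -
    note st = that
    obtain p where "ending_pair n (L', R') p" using less(1)[OF st(2-4)] by blast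
    then show ?thesis using st(1) unfolding ending_pair_def by (auto intro: converse_rtranclp_into_rtranclp)
  qed
  have smaller: "card (L - {s}) + card R < card L + card R" if "s \<in> L" for s
    using card_Diff1_less[OF less(2) that] by linarith
  show ?case
  proof (cases "L \<inter> R = {}")
    case False
    then obtain s where "s \<in> L" "s \<in> R" by auto
    then show ?thesis using step[OF removal.intros(1)] smaller less(2,3) by blast
  next
    case True
    show ?thesis
    proof (cases "\<exists>j\<in>{2..n}. simple_refl j \<in> L \<and> simple_refl (j - 1) \<in> R")
      case True
      then obtain j where "j \<in> {2..n}" "simple_refl j \<in> L" "simple_refl (j - 1) \<in> R" by blast
      then show ?thesis using step[OF removal.intros(3)] smaller less(2,3) by blast
    next
      case False
      then have "ending_pair n (L, R) (L, R)" using True unfolding ending_pair_def by auto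
      then show ?thesis by blast
    qed
  qed
qed

lemma finite_descents: "finite (left_descents n w)" "finite (right_descents n w)"
  by (simp_all add: left_descents_def right_descents_def simple_refls_def)

text \<open>The argument works for any ending pair: right toggles first, then left toggles, each
  lowering the key. So \<open>psi n w\<close> arises only from the empty pair, and all else lies
  strictly below it.\<close>

lemma x_elt_cases:
  assumes n: "n \<ge> 1" and w: "w \<in> fully_commutative n"
    and L: "L \<subseteq> left_descents n w" and R: "R \<subseteq> right_descents n w"
  shows "nc_perm (x_elt n w L R)" "x_elt n w L R permutes {1..n+1}"
    "x_elt n w L R = psi n w \<or> nc_key n (x_elt n w L R) < nc_key n (psi n w)"
    "L = {} \<Longrightarrow> R = {} \<Longrightarrow> x_elt n w L R = psi n w"
proof -
  define p where "p = (SOME p. ending_pair n (L, R) p)"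
  have "finite L" "finite R" using L R finite_descents finite_subset by blast+
  then have ep: "ending_pair n (L, R) p" unfolding p_def by (rule someI_ex[OF ending_pair_exists])
  obtain L' R' where p: "p = (L', R')" by (cases p)
  have x: "x_elt n w L R = commuting_prod L' \<circ> psi n w \<circ> commuting_prod R'"
    unfolding x_elt_def p_def[symmetric] p by simp
  have sub: "L' \<subseteq> L" "R' \<subseteq> R" using removal_subset[of n "(L, R)" p] ep p unfolding ending_pair_def by auto
  have dis: "L' \<inter> R' = {}" "\<not> (\<exists>j\<in>{2..n}. simple_refl j \<in> L' \<and> simple_refl (j - 1) \<in> R')"
    using ep p unfolding ending_pair_def by auto
  note ps = psi_fully_commutative[OF w]
  define I where "I = {i\<in>{1..n}. simple_refl i \<in> L'}"
  define J where "J = {i\<in>{1..n}. simple_refl i \<in> R'}"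
  have L': "L' = simple_refl ` I"
  proof
    show "L' \<subseteq> simple_refl ` I"
    proof
      fix s assume "s \<in> L'"
      then have "s \<in> left_descents n w" using sub L by blast
      then obtain i where "i \<in> {1..n}" "s = simple_refl i"
        using left_descents_fully_commutative[OF w, of s] by blast
      then show "s \<in> simple_refl ` I" using \<open>s \<in> L'\<close> unfolding I_def by blast
    qed
  qed (auto simp: I_def)
  have R': "R' = simple_refl ` J"
  proof
    show "R' \<subseteq> simple_refl ` J"
    proof
      fix s assume "s \<in> R'"
      then have "s \<in> right_descents n w" using sub R by blast
      then obtain i where "i \<in> {1..n}" "s = simple_refl i"
        using right_descents_fully_commutative[OF w, of s] by blast
      then show "s \<in> simple_refl ` J" using \<open>s \<in> R'\<close> unfolding J_def by blast
    qed
  qed (auto simp: J_def)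
  have I: "i \<in> {1..n} \<and> left_ok (psi n w) i" if "i \<in> I" for i
  proof -
    have "simple_refl i \<in> left_descents n w" using that sub L unfolding I_def by blast
    then obtain k where "k \<in> {1..n}" "simple_refl i = simple_refl k" "Suc k \<in> w ` exc w" "k \<notin> w ` exc w"
      by (rule left_descents_fully_commutative[OF w])
    then show ?thesis using that unfolding left_ok_def ps(4) I_def by simp
  qed
  have J: "j \<in> {1..n} \<and> right_ok (psi n w) j" if "j \<in> J" for j
  proof -
    have "simple_refl j \<in> right_descents n w" using that sub R unfolding J_def by blast
    then obtain k where "k \<in> {1..n}" "simple_refl j = simple_refl k" "k \<in> exc w" "Suc k \<notin> exc w"
      by (rule right_descents_fully_commutative[OF w])
    then show ?thesis using that unfolding right_ok_def ps(3) J_def by simp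
  qed
  have IJ: "I \<inter> J = {}" using dis(1) unfolding I_def J_def by blast
  have adj: "Suc j \<notin> I" if "j \<in> J" for j
  proof
    assume "Suc j \<in> I"
    then have "Suc j \<in> {2..n}" "simple_refl (Suc j) \<in> L'" "simple_refl (Suc j - 1) \<in> R'"
      using that unfolding I_def J_def by auto
    then show False using dis(2) by blast
  qed
  have finI: "finite I" and finJ: "finite J" by (auto simp: I_def J_def)
  let ?y = "psi n w \<circ> commuting_prod (simple_refl ` J)"
  have y: "nc_perm ?y" "?y permutes {1..n+1}" "\<forall>i\<in>I. left_ok ?y i" "nc_key n ?y \<le> nc_key n (psi n w)"
    "J \<noteq> {} \<longrightarrow> nc_key n ?y < nc_key n (psi n w)"
    using right_toggles[OF n ps(1,2) I J IJ adj finJ order_refl] by blast+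
  let ?z = "commuting_prod (simple_refl ` I) \<circ> ?y"
  have Iy: "i \<in> {1..n} \<and> left_ok ?y i" if "i \<in> I" for i using y(3) that I by blast
  have z: "nc_perm ?z" "?z permutes {1..n+1}" "nc_key n ?z \<le> nc_key n ?y" "I \<noteq> {} \<longrightarrow> nc_key n ?z < nc_key n ?y"
    using left_toggles[OF n y(1,2) Iy finI order_refl] by blast+
  have xz: "x_elt n w L R = ?z" unfolding x L' R' by (simp add: comp_assoc)
  show "nc_perm (x_elt n w L R)" "x_elt n w L R permutes {1..n+1}" unfolding xz by (rule z)+
  have triv: "?z = psi n w" if "I = {}" "J = {}" using that by (simp add: commuting_prod_def)
  show "x_elt n w L R = psi n w \<or> nc_key n (x_elt n w L R) < nc_key n (psi n w)"
    unfolding xz using triv y z by (cases "I = {}"; cases "J = {}") auto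
  show "x_elt n w L R = psi n w" if "L = {}" "R = {}"
    unfolding xz using triv that sub L' R' by auto
qed

lemma finite_Q_set: "finite (Q_set n w)"
proof -
  have "Q_set n w \<subseteq> (\<lambda>(L, R). x_elt n w L R) ` (Pow (left_descents n w) \<times> Pow (right_descents n w))"
    unfolding Q_set_def by auto
  then show ?thesis using finite_descents[of n w] by (meson finite_Pow_iff finite_SigmaI finite_imageI finite_subset)
qed

section \<open>The basis theorem\<close>

text \<open>With \<open>F\<close> sorted by \<open>key\<close>, the matrix \<open>T\<close> is upper
  triangular with unit diagonal entries, so its determinant is a unit. As \<open>T\<close> is a
  product of square matrices, the determinant of the factor formed from \<open>C\<close> is a unit
  as well, and the adjugate solves the system without division.\<close>

lemma triangular_factor_solvable:
  fixes \<Phi> C T :: "'i \<Rightarrow> 'i \<Rightarrow> 'a::comm_ring_1" and key :: "'i \<Rightarrow> int"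
  assumes fin: "finite F"
    and T: "\<And>u w. u \<in> F \<Longrightarrow> w \<in> F \<Longrightarrow> T u w = (\<Sum>x\<in>F. \<Phi> u x * C w x)"
    and tri: "\<And>u w. u \<in> F \<Longrightarrow> w \<in> F \<Longrightarrow> T u w \<noteq> 0 \<Longrightarrow> u = w \<or> key u < key w"
    and unit: "\<And>w. w \<in> F \<Longrightarrow> \<exists>c. c * T w w = 1"
  shows "\<exists>a. \<forall>x\<in>F. (\<Sum>w\<in>F. a w * C w x) = d x"
proof -
  obtain ys where ys: "set ys = F" "distinct ys" using finite_distinct_list[OF fin] by blast
  define xs where "xs = sort_key key ys"
  have xs: "set xs = F" "distinct xs" "sorted (map key xs)" using ys by (simp_all add: xs_def)
  define N where "N = length xs"
  have xF: "xs ! i \<in> F" if "i < N" for i using that xs(1) nth_mem by (auto simp: N_def)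
  have bij: "bij_betw ((!) xs) {0..<N} F"
    using bij_betw_nth[OF xs(2), of "{0..<N}" F] xs(1) by (auto simp: N_def atLeast0LessThan)
  have reindex: "(\<Sum>x\<in>F. g x) = (\<Sum>k<N. g (xs ! k))" for g :: "'i \<Rightarrow> 'a"
    using sum.reindex_bij_betw[OF bij, of g] by (simp add: atLeast0LessThan)
  define MT where "MT = mat N N (\<lambda>(i, j). T (xs ! i) (xs ! j))"
  define MP where "MP = mat N N (\<lambda>(i, k). \<Phi> (xs ! i) (xs ! k))"
  \<comment> \<open>Rows belong to the coordinates \<open>x\<close>, so that applying
    \<open>MC\<close> to the coefficients gives the sums in the claim.\<close>
  define MC where "MC = mat N N (\<lambda>(k, j). C (xs ! j) (xs ! k))"
  have dims: "MT \<in> carrier_mat N N" "MP \<in> carrier_mat N N" "MC \<in> carrier_mat N N"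
    by (simp_all add: MT_def MP_def MC_def)
  have prod: "MT = MP * MC"
  proof (rule eq_matI)
    fix i j assume "i < dim_row (MP * MC)" "j < dim_col (MP * MC)"
    then have ij: "i < N" "j < N" using dims by auto
    then have "(MP * MC) $$ (i, j) = (\<Sum>k\<in>{0..<N}. \<Phi> (xs ! i) (xs ! k) * C (xs ! j) (xs ! k))"
      using dims by (simp add: MP_def MC_def scalar_prod_def)
    then show "MT $$ (i, j) = (MP * MC) $$ (i, j)"
      using ij T xF reindex by (simp add: MT_def atLeast0LessThan)
  qed (use dims in auto)
  have "upper_triangular MT"
    unfolding upper_triangular_def
  proof (intro allI impI)
    fix i j assume ij: "i < dim_row MT" "j < i"
    then have n: "i < N" "j < N" using dims by auto
    \<comment> \<open>Different elements may share a key; this is harmless, since a nonzero entry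
      off the diagonal requires a strictly smaller key.\<close>
    have "key (xs ! j) \<le> key (xs ! i)" using sorted_nth_mono[OF xs(3), of j i] ij n by (simp add: N_def)
    moreover have "xs ! i \<noteq> xs ! j" using nth_eq_iff_index_eq[OF xs(2)] ij n by (simp add: N_def)
    ultimately have "T (xs ! i) (xs ! j) = 0" using tri[of "xs ! i" "xs ! j"] xF n by fastforce
    then show "MT $$ (i, j) = 0" using n by (simp add: MT_def)
  qed
  then have det: "det MT = (\<Prod>i<N. T (xs ! i) (xs ! i))"
    using det_upper_triangular[OF _ dims(1)] dims(1)
    by (simp add: prod_list_diag_prod MT_def atLeast0LessThan)
  have "\<exists>c. c * (\<Prod>i\<in>A. T (xs ! i) (xs ! i)) = 1" if "A \<subseteq> {..<N}" for A
    using that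
  proof (induct A rule: infinite_finite_induct)
    case (insert i A)
    then obtain c where "c * (\<Prod>i\<in>A. T (xs ! i) (xs ! i)) = 1" by auto
    moreover obtain d where "d * T (xs ! i) (xs ! i) = 1" using unit[OF xF, of i] insert by auto
    ultimately have "(d * T (xs ! i) (xs ! i)) * (c * (\<Prod>i\<in>A. T (xs ! i) (xs ! i))) = 1" by simp
    then have "(c * d) * (T (xs ! i) (xs ! i) * (\<Prod>i\<in>A. T (xs ! i) (xs ! i))) = 1" by (simp add: ac_simps)
    then show ?case using insert by auto
  qed auto
  then obtain c where c: "c * det MT = 1" using det by auto
  then have c': "(c * det MP) * det MC = 1" using det_mult[OF dims(2,3)] prod by (simp add: mult.assoc)
  define z where "z = vec N (\<lambda>k. d (xs ! k))"
  define b where "b = adj_mat MC *\<^sub>v z"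
  have z: "z \<in> carrier_vec N" by (simp add: z_def)
  have adj: "adj_mat MC \<in> carrier_mat N N" "MC * adj_mat MC = det MC \<cdot>\<^sub>m 1\<^sub>m N" using adj_mat[OF dims(3)] by auto
  have b: "b \<in> carrier_vec N" unfolding b_def using adj z by simp
  have "MC *\<^sub>v b = (MC * adj_mat MC) *\<^sub>v z"
    unfolding b_def using assoc_mult_mat_vec[OF dims(3) adj(1) z] by simp
  also have "(MC * adj_mat MC) *\<^sub>v z = det MC \<cdot>\<^sub>v z"
  proof (rule eq_vecI)
    fix k assume "k < dim_vec (det MC \<cdot>\<^sub>v z)"
    then have k: "k < N" using z by simp
    have "((MC * adj_mat MC) *\<^sub>v z) $ k = (\<Sum>j = 0..<N. det MC * (if j = k then 1 else 0) * z $ j)"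
      unfolding adj(2) using k z by (simp add: scalar_prod_def)
    also have "\<dots> = (\<Sum>j = 0..<N. if j = k then det MC * z $ j else 0)"
      by (intro sum.cong refl) simp
    also have "\<dots> = det MC * z $ k" using k by simp
    finally show "((MC * adj_mat MC) *\<^sub>v z) $ k = (det MC \<cdot>\<^sub>v z) $ k" using k z by simp
  qed (use z dims adj(1) in auto)
  finally have sol: "MC *\<^sub>v b = det MC \<cdot>\<^sub>v z" .
  define idx where "idx = the_inv_into {0..<N} ((!) xs)"
  have idx: "idx (xs ! k) = k" if "k < N" for k
    unfolding idx_def using the_inv_into_f_f[OF bij_betw_imp_inj_on[OF bij]] that by simp
  define a where "a w = (c * det MP) * (b $ idx w)" for w
  have "(\<Sum>w\<in>F. a w * C w x) = d x" if x: "x \<in> F" for x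
  proof -
    obtain k where k: "k < N" "x = xs ! k" using x xs(1) by (auto simp: in_set_conv_nth N_def)
    have "(\<Sum>w\<in>F. a w * C w x) = (\<Sum>j<N. (c * det MP) * (C (xs ! j) x * b $ j))"
      unfolding reindex by (intro sum.cong refl) (simp add: a_def idx ac_simps)
    also have "\<dots> = (c * det MP) * (MC *\<^sub>v b) $ k"
      using k b dims(3) by (simp add: sum_distrib_left scalar_prod_def MC_def atLeast0LessThan)
    also have "\<dots> = ((c * det MP) * det MC) * d x" unfolding sol using k by (simp add: z_def mult.assoc)
    finally show ?thesis unfolding c' by simp
  qed
  then show ?thesis by blast
qed

section \<open>Triangularity of the elements X and the basis property\<close>

text \<open>Used for noncrossing as well as fully commutative \<open>u\<close>; the value is the
  same for \<open>w\<close> and \<open>psi n w\<close>.\<close>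

definition nc_entry :: "nat \<Rightarrow> (nat \<Rightarrow> nat) \<Rightarrow> free_elt \<Rightarrow> laurent"
  where "nc_entry n u p = tl_action p (delta (exc u)) (u ` exc u)"

lemma nc_entry_linear:
  "nc_entry n u (\<Sum>i\<in>A. scal (c i) * g i) = (\<Sum>i\<in>A. c i * nc_entry n u (g i))"
  by (simp add: nc_entry_def tl_action_sum tl_action_mult tl_action_scal)

lemma nc_entry_tl_eq: "tl_eq m p q \<Longrightarrow> nc_entry n u p = nc_entry n u q"
  unfolding nc_entry_def by (rule tl_action_eq)

text \<open>An element \<open>Z_elt n x\<close> has nonzero entries only at \<open>x\<close> and at
  smaller keys, and the members of \<open>Q_set n w\<close> other than \<open>psi n w\<close> have
  smaller keys than \<open>psi n w\<close>. So only the summand at \<open>psi n w\<close> reaches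
  the diagonal entry.\<close>

lemma X_elt_representative:
  assumes n: "n \<ge> 1" and w: "w \<in> fully_commutative n"
  shows "\<exists>p\<in>carrier (free_alg n). X_elt n w = tl_class n p \<and>
    (\<forall>u\<in>fully_commutative n. nc_entry n u p \<noteq> 0 \<longrightarrow> u = w \<or> nc_key n (psi n u) < nc_key n (psi n w)) \<and>
    (\<exists>c. c * nc_entry n w p = 1)"
proof -
  let ?Q = "Q_set n w" and ?y = "psi n w"
  interpret T: ring "TL n" by (rule ring_TL)
  have Q: "nc_perm x \<and> x permutes {1..n+1} \<and> (x = ?y \<or> nc_key n x < nc_key n ?y)" if xQ: "x \<in> ?Q" for x
  proof -
    obtain L R where LR: "x = x_elt n w L R" "L \<subseteq> left_descents n w" "R \<subseteq> right_descents n w"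
      using xQ unfolding Q_set_def by blast
    show ?thesis using x_elt_cases(1-3)[OF n w LR(2,3)] unfolding LR(1) by simp
  qed
  have yQ: "?y \<in> ?Q" unfolding Q_set_def using x_elt_cases(4)[OF n w, of "{}" "{}"] by (auto intro!: exI[of _ "{}"])
  have fin: "finite ?Q" by (rule finite_Q_set)
  define z where "z x = (SOME p. p \<in> carrier (free_alg n) \<and> Z_elt n x = tl_class n p \<and>
    (\<forall>x'. nc_perm x' \<longrightarrow> x' permutes {1..n+1} \<longrightarrow> nc_entry n x' p \<noteq> 0 \<longrightarrow>
      x' = x \<or> nc_key n x' < nc_key n x) \<and> (\<exists>e. nc_entry n x p = v_pow e))" for x
  have z: "z x \<in> carrier (free_alg n) \<and> Z_elt n x = tl_class n (z x) \<and>
    (\<forall>x'. nc_perm x' \<longrightarrow> x' permutes {1..n+1} \<longrightarrow> nc_entry n x' (z x) \<noteq> 0 \<longrightarrow>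
      x' = x \<or> nc_key n x' < nc_key n x) \<and> (\<exists>e. nc_entry n x (z x) = v_pow e)" if "x \<in> ?Q" for x
    unfolding z_def by (rule someI_ex) (use Z_elt_representative[of x n] Q[OF that] in \<open>unfold nc_entry_def, blast\<close>)
  define p where "p = (\<Sum>x\<in>?Q. scal (p_coeff n w x) * z x)"
  have cl: "scal (p_coeff n w x) * z x \<in> carrier (free_alg n)" if "x \<in> ?Q" for x
    using z[OF that] free_alg_closed(2)[OF scal_closed] by blast
  have "X_elt n w = finsum (TL n) (\<lambda>x. tl_class n (scal (p_coeff n w x) * z x)) ?Q"
    unfolding X_elt_def
  proof (rule T.finsum_cong')
    show "(\<lambda>x. tl_class n (scal (p_coeff n w x) * z x)) \<in> ?Q \<rightarrow> carrier (TL n)"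
      using tl_class_hom(1)[OF cl cl] by blast
    fix x assume x: "x \<in> ?Q"
    then have zx: "z x \<in> carrier (free_alg n)" "Z_elt n x = tl_class n (z x)" using z by blast+
    show "p_coeff n w x \<odot>\<^bsub>TL n\<^esub> Z_elt n x = tl_class n (scal (p_coeff n w x) * z x)"
      unfolding zx(2) by (rule tl_class_hom(5)[OF zx(1) zx(1), symmetric])
  qed simp
  also have "\<dots> = tl_class n p" unfolding p_def by (rule finsum_tl_class[OF fin cl])
  finally have X: "X_elt n w = tl_class n p" .
  have entry: "nc_entry n u p = (\<Sum>x\<in>?Q. p_coeff n w x * nc_entry n u (z x))" for u
    unfolding p_def by (rule nc_entry_linear)
  have psi_entry: "nc_entry n (psi n u) q = nc_entry n u q" if "u \<in> fully_commutative n" for u q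
    unfolding nc_entry_def psi_fully_commutative(3,4)[OF that] by (simp add: psi_fully_commutative(4)[OF that, unfolded psi_fully_commutative(3)[OF that]])
  show ?thesis
  proof (intro bexI[of _ p] conjI ballI impI X)
    show "p \<in> carrier (free_alg n)" unfolding p_def by (rule carrier_free_alg_sum[OF cl])
    fix u assume u: "u \<in> fully_commutative n" and nz: "nc_entry n u p \<noteq> 0"
    obtain x where x: "x \<in> ?Q" "nc_entry n u (z x) \<noteq> 0"
      using nz unfolding entry by (metis (no_types, lifting) mult_zero_right sum.neutral)
    have "nc_entry n (psi n u) (z x) \<noteq> 0" using x(2) psi_entry[OF u] by simp
    then have "psi n u = x \<or> nc_key n (psi n u) < nc_key n x"
      using z[OF x(1)] psi_fully_commutative(1,2)[OF u] by blast
    then have "psi n u = ?y \<or> nc_key n (psi n u) < nc_key n ?y" using Q[OF x(1)] by auto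
    then show "u = w \<or> nc_key n (psi n u) < nc_key n ?y" using psi_inj[OF u w] by blast
  next
    have "nc_entry n w (z x) = 0" if x: "x \<in> ?Q - {?y}" for x
    proof (rule ccontr)
      assume "nc_entry n w (z x) \<noteq> 0"
      then have "nc_entry n ?y (z x) \<noteq> 0" using psi_entry[OF w] by simp
      then have "?y = x \<or> nc_key n ?y < nc_key n x"
        using z[of x] x psi_fully_commutative(1,2)[OF w] by blast
      then show False using Q[of x] x by auto
    qed
    then have "nc_entry n w p = p_coeff n w ?y * nc_entry n w (z ?y)"
      unfolding entry using sum.remove[OF fin yQ, of "\<lambda>x. p_coeff n w x * nc_entry n w (z x)"] by simp
    moreover obtain e where "nc_entry n w (z ?y) = v_pow e" using z[OF yQ] psi_entry[OF w] by auto
    moreover define s :: laurent where "s = (if even (alpha n w ?y) then 1 else - 1)"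
    \<comment> \<open>At \<open>psi n w\<close> the exponent \<open>beta\<close> vanishes and the
      coefficient is a sign.\<close>
    moreover have "p_coeff n w ?y = s" by (simp add: p_coeff_def beta_def v_pow_0 s_def)
    ultimately have "nc_entry n w p = s * v_pow e" by simp
    moreover have "s * s = 1" by (simp add: s_def)
    moreover have "v_pow (- e) * v_pow e = 1" by (simp add: v_pow_0 flip: v_pow_add)
    ultimately have "(s * v_pow (- e)) * nc_entry n w p = 1"
      by (metis (no_types, lifting) mult.assoc mult.left_commute mult.right_neutral)
    then show "\<exists>c. c * nc_entry n w p = 1" by blast
  qed
qed

theorem proposition4p13:
  fixes n :: nat
  assumes "n \<ge> 1"
  shows "module_basis laurent_ring (TL n) (fully_commutative n) (X_elt n)"
proof -
  let ?F = "fully_commutative n"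
  interpret T: ring "TL n" by (rule ring_TL)
  have fin: "finite ?F" by (rule finite_fully_commutative)
  have "\<forall>w\<in>?F. \<exists>p. p \<in> carrier (free_alg n) \<and> X_elt n w = tl_class n p \<and>
    (\<forall>u\<in>?F. nc_entry n u p \<noteq> 0 \<longrightarrow> u = w \<or> nc_key n (psi n u) < nc_key n (psi n w)) \<and>
    (\<exists>c. c * nc_entry n w p = 1)"
    using X_elt_representative[OF assms] by blast
  from bchoice[OF this] obtain P where "\<forall>w\<in>?F. P w \<in> carrier (free_alg n) \<and> X_elt n w = tl_class n (P w) \<and>
    (\<forall>u\<in>?F. nc_entry n u (P w) \<noteq> 0 \<longrightarrow> u = w \<or> nc_key n (psi n u) < nc_key n (psi n w)) \<and>
    (\<exists>c. c * nc_entry n w (P w) = 1)" by blast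
  then have P: "\<And>w. w \<in> ?F \<Longrightarrow> P w \<in> carrier (free_alg n)" "\<And>w. w \<in> ?F \<Longrightarrow> X_elt n w = tl_class n (P w)"
    "\<And>u w. u \<in> ?F \<Longrightarrow> w \<in> ?F \<Longrightarrow> nc_entry n u (P w) \<noteq> 0 \<Longrightarrow> u = w \<or> nc_key n (psi n u) < nc_key n (psi n w)"
    "\<And>w. w \<in> ?F \<Longrightarrow> \<exists>c. c * nc_entry n w (P w) = 1"
    by blast+
  have lin: "finsum (TL n) (\<lambda>w. a w \<odot>\<^bsub>TL n\<^esub> X_elt n w) A = tl_class n (\<Sum>w\<in>A. scal (a w) * P w)"
    and lin_closed: "(\<Sum>w\<in>A. scal (a w) * P w) \<in> carrier (free_alg n)" if A: "A \<subseteq> ?F" for a A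
  proof -
    have cl: "scal (a w) * P w \<in> carrier (free_alg n)" if "w \<in> A" for w
      using P(1) A that free_alg_closed(2)[OF scal_closed] by blast
    then show "(\<Sum>w\<in>A. scal (a w) * P w) \<in> carrier (free_alg n)" by (rule carrier_free_alg_sum)
    have finA: "finite A" using A fin finite_subset by blast
    have "finsum (TL n) (\<lambda>w. a w \<odot>\<^bsub>TL n\<^esub> X_elt n w) A = finsum (TL n) (\<lambda>w. tl_class n (scal (a w) * P w)) A"
    proof (rule T.finsum_cong')
      show "(\<lambda>w. tl_class n (scal (a w) * P w)) \<in> A \<rightarrow> carrier (TL n)"
        using tl_class_hom(1)[OF cl cl] by blast
      fix w assume "w \<in> A"
      then have w: "w \<in> ?F" using A by blast
      show "a w \<odot>\<^bsub>TL n\<^esub> X_elt n w = tl_class n (scal (a w) * P w)"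
        unfolding P(2)[OF w] by (rule tl_class_hom(5)[OF P(1)[OF w] P(1)[OF w], symmetric])
    qed simp
    also have "\<dots> = tl_class n (\<Sum>w\<in>A. scal (a w) * P w)" by (rule finsum_tl_class[OF finA cl])
    finally show "finsum (TL n) (\<lambda>w. a w \<odot>\<^bsub>TL n\<^esub> X_elt n w) A = tl_class n (\<Sum>w\<in>A. scal (a w) * P w)" .
  qed
  let ?B = "\<lambda>w. tl_mono (nf_word (normal_form n w))"
  have "\<forall>w\<in>?F. \<exists>c. tl_eq n (P w) (\<Sum>x\<in>?F. scal (c x) * ?B x)" using TL_spanned P(1) by blast
  then obtain C where C: "\<And>w. w \<in> ?F \<Longrightarrow> tl_eq n (P w) (\<Sum>x\<in>?F. scal (C w x) * ?B x)" by metis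
  have T: "nc_entry n u (P w) = (\<Sum>x\<in>?F. nc_entry n u (?B x) * C w x)" if "w \<in> ?F" for u w
    using nc_entry_tl_eq[OF C[OF that]] by (simp add: nc_entry_linear mult.commute)
  have span: "\<exists>A a. finite A \<and> A \<subseteq> ?F \<and> a \<in> A \<rightarrow> carrier laurent_ring \<and>
      m = finsum (TL n) (\<lambda>i. a i \<odot>\<^bsub>TL n\<^esub> X_elt n i) A" if m: "m \<in> carrier (TL n)" for m
  proof -
    obtain q where q: "q \<in> carrier (free_alg n)" "m = tl_class n q" using m unfolding carrier_TL_eq by blast
    obtain d where d: "tl_eq n q (\<Sum>x\<in>?F. scal (d x) * ?B x)" using TL_spanned[OF q(1)] by blast
    \<comment> \<open>It suffices to match the coordinates \<open>d\<close> of a representative with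
      respect to the monomials.\<close>
    obtain a where a: "\<And>x. x \<in> ?F \<Longrightarrow> (\<Sum>w\<in>?F. a w * C w x) = d x"
      using triangular_factor_solvable[of ?F "\<lambda>u w. nc_entry n u (P w)" "\<lambda>u x. nc_entry n u (?B x)" C
        "\<lambda>u. nc_key n (psi n u)" d, OF fin T P(3,4)] by blast
    have "(\<Sum>w\<in>?F. scal (a w) * P w) - (\<Sum>w\<in>?F. scal (a w) * (\<Sum>x\<in>?F. scal (C w x) * ?B x)) =
        (\<Sum>w\<in>?F. scal (a w) * (P w - (\<Sum>x\<in>?F. scal (C w x) * ?B x)))"
      by (simp add: sum_subtractf right_diff_distrib)
    also have "\<dots> \<in> TL_ideal n"
    proof -
      have "(\<Sum>w\<in>A. scal (a w) * (P w - (\<Sum>x\<in>?F. scal (C w x) * ?B x))) \<in> TL_ideal n" if "A \<subseteq> ?F" for A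
        using that
      proof (induct A rule: infinite_finite_induct)
        case (insert w A)
        then have "scal (a w) * (P w - (\<Sum>x\<in>?F. scal (C w x) * ?B x)) \<in> TL_ideal n"
          using TL_ideal_closed(4)[OF _ scal_closed] C[of w] unfolding tl_eq_def by blast
        then show ?case using insert TL_ideal_closed(2) by simp
      qed (simp_all add: zero_in_TL_ideal)
      then show ?thesis by blast
    qed
    finally have e1: "tl_eq n (\<Sum>w\<in>?F. scal (a w) * P w) (\<Sum>w\<in>?F. scal (a w) * (\<Sum>x\<in>?F. scal (C w x) * ?B x))"
      unfolding tl_eq_def .
    have "(\<Sum>w\<in>?F. scal (a w) * (\<Sum>x\<in>?F. scal (C w x) * ?B x)) =
        (\<Sum>x\<in>?F. \<Sum>w\<in>?F. scal (a w * C w x) * ?B x)"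
      by (subst sum.swap) (simp add: sum_distrib_left scal_simps mult.assoc)
    also have "\<dots> = (\<Sum>x\<in>?F. scal (\<Sum>w\<in>?F. a w * C w x) * ?B x)"
    proof -
      have "scal (sum g A) = (\<Sum>w\<in>A. scal (g w))" for g :: "(nat \<Rightarrow> nat) \<Rightarrow> laurent" and A
        by (induct A rule: infinite_finite_induct) (simp_all add: scal_simps)
      then show ?thesis by (simp add: sum_distrib_right)
    qed
    also have "\<dots> = (\<Sum>x\<in>?F. scal (d x) * ?B x)" using a by simp
    finally have "tl_eq n (\<Sum>w\<in>?F. scal (a w) * P w) q" using e1 tl_eq_trans[OF _ tl_eq_sym[OF d]] by simp
    then have "m = finsum (TL n) (\<lambda>i. a i \<odot>\<^bsub>TL n\<^esub> X_elt n i) ?F"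
      using tl_class_eqI[OF _ lin_closed[OF order_refl] q(1)] lin[OF order_refl] q(2) by simp
    then show ?thesis using fin by (intro exI[of _ ?F] exI[of _ a]) (simp add: ring_of_type_algebra_def)
  qed
  have indep: "a i = 0" if A: "finite A" "A \<subseteq> ?F" and z: "finsum (TL n) (\<lambda>i. a i \<odot>\<^bsub>TL n\<^esub> X_elt n i) A = \<zero>\<^bsub>TL n\<^esub>"
    and i: "i \<in> A" for A a i
  proof (rule ccontr)
    assume "a i \<noteq> 0"
    define S where "S = {w \<in> A. a w \<noteq> 0}"
    have S: "finite S" "S \<noteq> {}" using A i \<open>a i \<noteq> 0\<close> by (auto simp: S_def)
    let ?k = "\<lambda>w. nc_key n (psi n w)"
    \<comment> \<open>Choose \<open>w\<close> with the greatest key among the nonzero coefficients;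
      triangularity then leaves only the summand of \<open>w\<close> in the entry at
      \<open>w\<close>.\<close>
    have "Max (?k ` S) \<in> ?k ` S" using S by (intro Max_in) auto
    then obtain w where w: "w \<in> S" "?k w = Max (?k ` S)" by auto
    have max: "?k u \<le> ?k w" if "u \<in> S" for u unfolding w(2) using S(1) that by (intro Max_ge) auto
    have wA: "w \<in> A" "w \<in> ?F" "a w \<noteq> 0" using w A by (auto simp: S_def)
    have "tl_class n (\<Sum>w\<in>A. scal (a w) * P w) = tl_class n 0" using z lin[OF A(2)] tl_class_zero by metis
    then have "tl_eq n (\<Sum>w\<in>A. scal (a w) * P w) 0" using mem_tl_class tl_eq_refl by blast
    then have "nc_entry n w (\<Sum>w\<in>A. scal (a w) * P w) = 0"
      using nc_entry_tl_eq[of n _ 0 n w] by (simp add: nc_entry_def)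
    then have "(\<Sum>u\<in>A. a u * nc_entry n w (P u)) = 0" by (simp add: nc_entry_linear)
    moreover have "a u * nc_entry n w (P u) = 0" if u: "u \<in> A - {w}" for u
    proof (cases "a u = 0")
      case False
      then have "\<not> ?k w < ?k u" using max[of u] u by (auto simp: S_def)
      then have "nc_entry n w (P u) = 0" using P(3)[OF wA(2), of u] u A by blast
      then show ?thesis by simp
    qed simp
    ultimately have "a w * nc_entry n w (P w) = 0"
      using sum.remove[OF A(1) wA(1), of "\<lambda>u. a u * nc_entry n w (P u)"] by simp
    moreover obtain c where "c * nc_entry n w (P w) = 1" using P(4)[OF wA(2)] by blast
    moreover have "c * (a w * nc_entry n w (P w)) = (c * nc_entry n w (P w)) * a w" by (simp only: ac_simps)
    ultimately have "a w = 0" by auto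
    then show False using wA(3) by contradiction
  qed
  have "X_elt n \<in> ?F \<rightarrow> carrier (TL n)" using P(1,2) tl_class_hom(1) by fastforce
  then show ?thesis
    unfolding module_basis_def using span indep by (simp add: ring_of_type_algebra_def del: TL_sel)
qed

end
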